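(* Let $X$ be an ortho-integral hyperbolic surface. Then every closed geodesic $\mu$ on $X$ satisfies $\operatorname{tr}_{\mathrm{SL}}^2(\mu)\in\mathbb{Z}$, where $|\operatorname{tr}_{\mathrm{SL}}(\mu)|=2\cosh(\ell(\mu)/2)$; that is, $4\cosh^2(\ell(\mu)/2)\in\mathbb{Z}$.
   Context: A hyperbolic surface here is a compact connected orientable surface of negative Euler characteristic with a hyperbolic metric and nonempty totally geodesic boundary. An orthogeodesic on $X$ is a geodesic arc (of positive length, possibly self-intersecting) meeting $\partial X$ perpendicularly at both endpoints. $X$ is ortho-integral (OI) if $\cosh(\ell(\eta))\in\mathbb{Z}$ for every orthogeodesic $\eta$ of $X$, where $\ell$ denotes length. *)

theory Defs
  imports "HOL-Analysis.Analysis" "HOL-Homology.Homology"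
begin

text \<open>
  The hyperbolic plane is the upper half-plane model. The chart model of a surface with totally
  geodesic boundary is the closed hyperbolic half-plane to the right of the geodesic
  \<open>Re z = 0\<close>.
\<close>

definition hyp_plane :: "complex set" where
  "hyp_plane = {z. Im z > 0}"

definition hyp_half_plane :: "complex set" where
  "hyp_half_plane = {z \<in> hyp_plane. Re z \<ge> 0}"

definition hyp_dist :: "complex \<Rightarrow> complex \<Rightarrow> real" where
  "hyp_dist z w = arcosh (1 + (cmod (z - w))\<^sup>2 / (2 * Im z * Im w))"

text \<open>The action of \<open>PSL(2,R)\<close>, i.e. the orientation preserving isometries.\<close>

definition hyp_motion :: "(complex \<Rightarrow> complex) \<Rightarrow> bool" where
  "hyp_motion g \<longleftrightarrow> (\<exists>a b c d :: real. a * d - b * c = 1 \<and>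
     g = moebius (complex_of_real a) (complex_of_real b) (complex_of_real c) (complex_of_real d))"

text \<open>A chart is a domain together with a map, whose values outside the domain are irrelevant.\<close>

type_synonym 'a chart = "'a set \<times> ('a \<Rightarrow> complex)"

definition is_chart :: "'a::topological_space set \<Rightarrow> 'a chart \<Rightarrow> bool" where
  "is_chart M = (\<lambda>(U, \<phi>). openin (top_of_set M) U \<and>
     openin (top_of_set hyp_half_plane) (\<phi> ` U) \<and>
     (\<exists>\<psi>. homeomorphism U (\<phi> ` U) \<phi> \<psi>))"

text \<open>
  The overlap of two charts may be disconnected, so the coordinate change is only required to be
  locally the restriction of a motion.
\<close>

definition charts_compatible :: "'a::topological_space set \<Rightarrow> 'a chart \<Rightarrow> 'a chart \<Rightarrow> bool" where
  "charts_compatible M = (\<lambda>(U, \<phi>) (V, \<psi>). \<forall>p \<in> U \<inter> V. \<exists>g W. hyp_motion g \<and>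
     openin (top_of_set M) W \<and> p \<in> W \<and> W \<subseteq> U \<inter> V \<and> (\<forall>q \<in> W. \<psi> q = g (\<phi> q)))"

text \<open>
  A hyperbolic metric with totally geodesic boundary, given by its charts that are orientation
  preserving local isometries onto relatively open subsets of the half-plane. Since the coordinate
  changes preserve orientation, such an atlas exists precisely on orientable surfaces; the
  orientation that it selects plays no role below.
\<close>

definition hyp_atlas :: "'a::topological_space set \<Rightarrow> 'a chart set \<Rightarrow> bool" where
  "hyp_atlas M A \<longleftrightarrow> (\<forall>\<kappa> \<in> A. is_chart M \<kappa>) \<and> (\<Union>(U, \<phi>) \<in> A. U) = M \<and>
     (\<forall>\<kappa> \<in> A. \<forall>\<kappa>' \<in> A. charts_compatible M \<kappa> \<kappa>')"

definition hyp_boundary :: "'a chart set \<Rightarrow> 'a set" where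
  "hyp_boundary A = {p. \<exists>(U, \<phi>) \<in> A. p \<in> U \<and> Re (\<phi> p) = 0}"

text \<open>
  Rank of an abelian group (written multiplicatively), as the maximal number of
  \<open>\<int>\<close>-linearly independent elements; only used for groups of finite rank.
\<close>

definition int_independent :: "('b, 'm) monoid_scheme \<Rightarrow> 'b set \<Rightarrow> bool" where
  "int_independent G S \<longleftrightarrow> finite S \<and> S \<subseteq> carrier G \<and>
     (\<forall>k :: 'b \<Rightarrow> int. finprod G (\<lambda>x. x [^]\<^bsub>G\<^esub> k x) S = \<one>\<^bsub>G\<^esub> \<longrightarrow> (\<forall>x \<in> S. k x = 0))"

definition group_rank :: "('b, 'm) monoid_scheme \<Rightarrow> nat" where
  "group_rank G = Sup {card S |S. int_independent G S}"

definition betti :: "nat \<Rightarrow> 'a topology \<Rightarrow> nat" where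
  "betti p X = group_rank (homology_group (int p) X)"

text \<open>The homology of a surface vanishes in degrees above 2.\<close>

definition surface_euler_char :: "'a topology \<Rightarrow> int" where
  "surface_euler_char X = int (betti 0 X) - int (betti 1 X) + int (betti 2 X)"

text \<open>
  The type class supplies the Hausdorff property; second countability follows from compactness.
\<close>

definition hyperbolic_surface :: "'a::t2_space set \<Rightarrow> 'a chart set \<Rightarrow> bool" where
  "hyperbolic_surface M A \<longleftrightarrow> compact M \<and> connected M \<and> hyp_atlas M A \<and>
     hyp_boundary A \<noteq> {} \<and> surface_euler_char (top_of_set M) < 0"

text \<open>
  Unit speed geodesics on an interval \<open>I\<close>: curves that in a chart are locally distance preserving.
  The half-plane is convex, so its distance is the restriction of \<^const>\<open>hyp_dist\<close>. One chart around
  each point suffices because coordinate changes are locally isometric.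
\<close>

definition geodesic_on :: "'a chart set \<Rightarrow> real set \<Rightarrow> (real \<Rightarrow> 'a) \<Rightarrow> bool" where
  "geodesic_on A I c \<longleftrightarrow> (\<forall>t \<in> I. \<exists>(U, \<phi>) \<in> A. \<exists>e > 0.
     (\<forall>s \<in> I \<inter> ball t e. c s \<in> U) \<and>
     (\<forall>s \<in> I \<inter> ball t e. \<forall>s' \<in> I \<inter> ball t e. hyp_dist (\<phi> (c s)) (\<phi> (c s')) = \<bar>s - s'\<bar>))"

text \<open>
  The boundary is vertical in the charts, with tangent direction \<open>\<i>\<close>. As the model is conformal,
  hyperbolic orthogonality is Euclidean orthogonality.
\<close>

definition perp_boundary_at :: "'a chart set \<Rightarrow> real set \<Rightarrow> (real \<Rightarrow> 'a) \<Rightarrow> real \<Rightarrow> bool" where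
  "perp_boundary_at A I c t \<longleftrightarrow> (\<exists>(U, \<phi>) \<in> A. c t \<in> U \<and> Re (\<phi> (c t)) = 0 \<and>
     (\<exists>v. ((\<lambda>s. \<phi> (c s)) has_vector_derivative v) (at t within I) \<and> v \<noteq> 0 \<and> v \<bullet> \<i> = 0))"

text \<open>Geodesics have unit speed, so the parameter \<open>l\<close> in the next two notions is the length.\<close>

definition orthogeodesic :: "'a chart set \<Rightarrow> (real \<Rightarrow> 'a) \<Rightarrow> real \<Rightarrow> bool" where
  "orthogeodesic A c l \<longleftrightarrow> l > 0 \<and> geodesic_on A {0..l} c \<and>
     perp_boundary_at A {0..l} c 0 \<and> perp_boundary_at A {0..l} c l"

text \<open>
  A closed geodesic is a periodic geodesic line, smooth also at its base point. It may
  intersect itself, lie in the boundary, or run several times around a shorter one.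
\<close>

definition closed_geodesic :: "'a chart set \<Rightarrow> (real \<Rightarrow> 'a) \<Rightarrow> real \<Rightarrow> bool" where
  "closed_geodesic A c l \<longleftrightarrow> l > 0 \<and> geodesic_on A UNIV c \<and> (\<forall>t. c (t + l) = c t)"

definition ortho_integral :: "'a chart set \<Rightarrow> bool" where
  "ortho_integral A \<longleftrightarrow> (\<forall>c l. orthogeodesic A c l \<longrightarrow> cosh l \<in> \<int>)"

text \<open>The absolute value of the trace of an \<open>SL(2,R)\<close> lift of the holonomy, in terms of length.\<close>

definition abs_tr_SL :: "real \<Rightarrow> real" where
  "abs_tr_SL l = 2 * cosh (l / 2)"

end

theory Submission
  imports Defs
begin

text \<open>
  Develop the surface over the whole hyperbolic plane by a map \<open>E\<close> that is a local isometry up to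
  folding along the boundary; it exists because compactness gives a uniform size to the discs over
  which germs of such maps extend, and the plane is simply connected. The preimage of the boundary
  is then a set of pairwise disjoint complete geodesics. Let \<open>E\<close> follow the closed
  geodesic of length \<open>l\<close> along the imaginary axis, so that \<open>E\<close> is invariant under \<open>z \<mapsto> e\<^sup>l z\<close>. Some
  boundary line \<open>L\<close> is not the axis and is separated from it by no other boundary line. For large
  \<open>n\<close>, the common perpendicular of \<open>L\<close> and \<open>e\<^sup>n\<^sup>l L\<close> projects to an orthogeodesic, and the cosine
  hyperbolic of its length is \<open>K (cosh (n l) - 1) - 1\<close> with \<open>K > 0\<close> not depending on \<open>n\<close>. The
  differences of consecutive values are integers satisfying \<open>D\<^sub>n\<^sub>+\<^sub>1 + D\<^sub>n\<^sub>-\<^sub>1 = 2 cosh l D\<^sub>n\<close> with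
  nonzero invariant \<open>D\<^sub>n\<^sup>2 - D\<^sub>n\<^sub>+\<^sub>1 D\<^sub>n\<^sub>-\<^sub>1\<close>. Hence \<open>2 cosh l\<close> is rational, and its denominator
  \<open>q\<close> satisfies \<open>q\<^sup>k dvd D\<^sub>n\<close> for all large \<open>n\<close>, so that \<open>q = 1\<close>.
\<close>

section \<open>An integral linear recurrence\<close>

text \<open>The plane is folded rather than cut because the universal cover of a surface with
  boundary is only a convex piece of the plane. A map on the whole plane lets continuation, the
  identity principle and reflection work on one open convex domain; the price is that chart
  statements hold only up to \<open>hfold\<close>, and that coordinate changes at the boundary must
  commute with \<open>hfold\<close>. The line must not be separated from the axis: where the
  perpendicular crossed another boundary line, \<open>E\<close> would bend it back and its image
  would not be a geodesic. A line off the axis has to be found, since the closed geodesic may itself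
  run in the boundary. The constant \<open>K\<close> is \<open>4 * \<alpha> * \<gamma>\<close> for
  the unit form \<open>(\<alpha>, \<beta>, \<gamma>)\<close> of \<open>L\<close>, that is, the
  squared hyperbolic sine of the distance from \<open>L\<close> to the axis. It is positive because
  a line sharing an endpoint with the axis would have translates accumulating at the axis. As
  \<open>K\<close> is an unknown real number, no single length gives information on
  \<open>cosh l\<close>; ratios of differences do.\<close>

lemma power_dvd_recurrence:
  fixes D :: "nat \<Rightarrow> int" and P q :: int
  assumes rec: "\<And>n. n \<ge> N \<Longrightarrow> P * D (Suc n) = q * (D (Suc (Suc n)) + D n)" and "coprime P q" "n \<ge> N + k"
  shows "q ^ k dvd D n"
  using assms(3)
proof (induction k arbitrary: n)
  case (Suc k)
  then obtain m where m: "n = Suc m" "m \<ge> N + k" by (cases n) auto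
  \<comment> \<open>Both neighbours of \<open>D n\<close> have index at least \<open>N + k\<close>,
    so they are divisible by \<open>q ^ k\<close>. The recurrence gains one factor \<open>q\<close>
    on \<open>P * D n\<close> and coprimality removes \<open>P\<close>; each gained factor costs one
    index.\<close>
  have "q ^ k dvd D (Suc (Suc m)) + D m" using Suc.IH m(2) by (intro dvd_add) auto
  hence "q ^ Suc k dvd P * D (Suc m)" using rec[of m] m(2) by simp
  moreover have "coprime (q ^ Suc k) P" using assms(2) by (simp add: coprime_commute)
  ultimately show ?case using m(1) by (simp add: coprime_dvd_mult_right_iff)
qed auto

text \<open>Differencing removes the additive constants, and the closed form
  \<open>s * sinh ((n + 1/2) * l)\<close> of the differences reduces the recurrence and the
  invariant to addition theorems.\<close>

lemma two_cosh_Ints: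
  fixes K l :: real
  assumes K: "K > 0" and l: "l > 0" and int: "\<And>n. n \<ge> N \<Longrightarrow> K * (cosh (real n * l) - 1) - 1 \<in> \<int>"
  shows "2 * cosh l \<in> \<int>"
proof -
  define d where "d n = K * (cosh (real (Suc n) * l) - cosh (real n * l))" for n
  define s where "s = 2 * K * sinh (l / 2)"
  have s: "s > 0" using K l by (simp add: s_def)
  have d: "d n = s * sinh ((real n + 1/2) * l)" for n
  proof -
    have e: "real (Suc n) * l = (real n + 1/2) * l + l / 2" "real n * l = (real n + 1/2) * l - l / 2"
      by (simp_all add: algebra_simps)
    show ?thesis unfolding d_def e s_def cosh_add cosh_diff by (simp add: algebra_simps)
  qed
  have pos: "d n > 0" for n using s l unfolding d by (simp add: add_nonneg_pos)
  have rec: "2 * cosh l * d (Suc n) = d (Suc (Suc n)) + d n" for n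
  proof -
    define a where "a = (real (Suc n) + 1/2) * l"
    have e: "(real (Suc (Suc n)) + 1/2) * l = a + l" "(real n + 1/2) * l = a - l"
      by (simp_all add: a_def algebra_simps)
    show ?thesis unfolding d e a_def[symmetric] sinh_add sinh_diff by (simp add: algebra_simps)
  qed
  have cas: "(d (Suc n))\<^sup>2 - d (Suc (Suc n)) * d n = s\<^sup>2 * (sinh l)\<^sup>2" for n
  proof -
    define a where "a = (real (Suc n) + 1/2) * l"
    have e: "(real (Suc (Suc n)) + 1/2) * l = a + l" "(real n + 1/2) * l = a - l"
      by (simp_all add: a_def algebra_simps)
    have c: "(cosh x)\<^sup>2 = (sinh x)\<^sup>2 + 1" for x :: real by (rule cosh_square_eq)
    have "(sinh a)\<^sup>2 - sinh (a + l) * sinh (a - l) = (sinh a)\<^sup>2 - ((sinh a)\<^sup>2 * (cosh l)\<^sup>2 - (cosh a)\<^sup>2 * (sinh l)\<^sup>2)"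
      unfolding sinh_add sinh_diff by (simp add: algebra_simps power2_eq_square)
    also have "\<dots> = (sinh l)\<^sup>2" unfolding c by (simp add: algebra_simps)
    finally have "(sinh a)\<^sup>2 - sinh (a + l) * sinh (a - l) = (sinh l)\<^sup>2" .
    hence "s\<^sup>2 * ((sinh a)\<^sup>2 - sinh (a + l) * sinh (a - l)) = s\<^sup>2 * (sinh l)\<^sup>2" by simp
    thus ?thesis unfolding d e a_def[symmetric] by (simp add: algebra_simps power2_eq_square)
  qed
  have "d n \<in> \<int>" if "n \<ge> N" for n
  proof -
    have "d n = (K * (cosh (real (Suc n) * l) - 1) - 1) - (K * (cosh (real n * l) - 1) - 1)"
      by (simp add: d_def algebra_simps)
    thus ?thesis using int[of n] int[of "Suc n"] that by (simp only:) (intro Ints_diff, auto)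
  qed
  hence "\<exists>m. n \<ge> N \<longrightarrow> d n = real_of_int m" for n by (auto elim: Ints_cases)
  then obtain D where D: "\<And>n. n \<ge> N \<Longrightarrow> d n = real_of_int (D n)" by metis
  have "2 * cosh l = (d (Suc (Suc N)) + d N) / d (Suc N)" using rec[of N] pos[of "Suc N"] by (simp add: field_simps)
  hence "2 * cosh l \<in> \<rat>" using D[of N] D[of "Suc N"] D[of "Suc (Suc N)"] by simp
  then obtain P q where q: "q > 0" "coprime P q" "2 * cosh l = real_of_int P / real_of_int q"
    by (elim Rats_cases') auto
  have recD: "P * D (Suc n) = q * (D (Suc (Suc n)) + D n)" if "n \<ge> N" for n
  proof -
    have "real_of_int P * d (Suc n) = q * (d (Suc (Suc n)) + d n)"
      using rec[of n] q(1) unfolding q(3) by (simp add: field_simps)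
    hence "real_of_int (P * D (Suc n)) = real_of_int (q * (D (Suc (Suc n)) + D n))" using D that by simp
    thus ?thesis by (simp only: of_int_eq_iff)
  qed
  define W where "W = (D (Suc N))\<^sup>2 - D (Suc (Suc N)) * D N"
  have WW: "(D (Suc n))\<^sup>2 - D (Suc (Suc n)) * D n = W" if "n \<ge> N" for n
  proof -
    have "real_of_int ((D (Suc n))\<^sup>2 - D (Suc (Suc n)) * D n) = real_of_int W"
      using cas[of n] cas[of N] D[of n] D[of "Suc n"] D[of "Suc (Suc n)"] D[of N] D[of "Suc N"] D[of "Suc (Suc N)"] that
      by (simp add: W_def)
    thus ?thesis by (simp only: of_int_eq_iff)
  qed
  have W0: "W \<noteq> 0"
  proof
    assume "W = 0"
    hence "s\<^sup>2 * (sinh l)\<^sup>2 = 0" using cas[of N] D[of N] D[of "Suc N"] D[of "Suc (Suc N)"]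
      by (simp add: W_def flip: of_int_power of_int_mult of_int_diff)
    thus False using s l by simp
  qed
  have "q ^ k dvd W" for k
  proof -
    note dv = power_dvd_recurrence[where D = D, OF recD q(2)]
    have "q ^ k dvd (D (Suc (N + k)))\<^sup>2 - D (Suc (Suc (N + k))) * D (N + k)"
      using dv[of N k "N + k"] dv[of N k "Suc (N + k)"] by (intro dvd_diff) (auto simp: power2_eq_square)
    thus ?thesis using WW[of "N + k"] by simp
  qed
  hence bound: "q ^ k \<le> \<bar>W\<bar>" for k using W0 by (metis dvd_abs_iff dvd_imp_le_int abs_of_pos q(1) zero_less_power)
  have "q = 1"
  proof (rule ccontr)
    assume "q \<noteq> 1"
    hence "q \<ge> 2" using q(1) by simp
    \<comment> \<open>Any exponent with \<open>2 ^ k > \<bar>W\<bar>\<close> would do;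
      \<open>\<bar>W\<bar>\<close> itself is one.\<close>
    hence "2 ^ nat \<bar>W\<bar> \<le> q ^ nat \<bar>W\<bar>" by (intro power_mono) auto
    also have "\<dots> \<le> \<bar>W\<bar>" by (rule bound)
    finally have "2 ^ nat \<bar>W\<bar> \<le> \<bar>W\<bar>" .
    moreover have "int (nat \<bar>W\<bar>) < int (2 ^ nat \<bar>W\<bar>)" by (simp only: of_nat_less_iff less_exp)
    ultimately show False by simp
  qed
  thus ?thesis using q(3) by simp
qed

section \<open>Motions of the hyperbolic plane\<close>

lemma hyp_planeD: "z \<in> hyp_plane \<Longrightarrow> Im z > 0"
  by (simp add: hyp_plane_def)

lemma open_hyp_plane: "open hyp_plane"
  unfolding hyp_plane_def by (rule open_halfspace_Im_gt)

lemma convex_hyp_plane: "convex hyp_plane"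
  unfolding hyp_plane_def by (rule convex_halfspace_Im_gt)

lemma moebius_denom_nonzero:
  fixes a b c d :: real
  assumes "a * d - b * c = 1" "Im z > 0"
  shows "of_real c * z + complex_of_real d \<noteq> 0"
proof
  assume "of_real c * z + complex_of_real d = 0"
  hence "c * Im z = 0" "c * Re z + d = 0"
    by (simp_all add: complex_eq_iff)
  with assms show False by auto
qed

abbreviation mob :: "real \<Rightarrow> real \<Rightarrow> real \<Rightarrow> real \<Rightarrow> complex \<Rightarrow> complex" where
  "mob a b c d \<equiv> moebius (complex_of_real a) (complex_of_real b) (complex_of_real c) (complex_of_real d)"

lemma mob_mult_denom:
  assumes "a * d - b * c = 1" "Im z > 0"
  shows "mob a b c d z * (of_real c * z + complex_of_real d) = a * z + b"
  using moebius_denom_nonzero[OF assms] by (simp add: moebius_def)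

lemma Im_mob:
  assumes "a * d - b * c = 1" "Im z > 0"
  shows "Im (mob a b c d z) = Im z / (cmod (c * z + d))\<^sup>2"
proof -
  have "Im (mob a b c d z) = (a * d - b * c) * Im z / (cmod (c * z + d))\<^sup>2"
    by (simp add: moebius_def Im_divide cmod_power2 algebra_simps)
  thus ?thesis using assms by simp
qed

lemma Re_mob:
  assumes "a * d - b * c = 1" "Im z > 0"
  shows "Re (mob a b c d z) =
    (a * c * (cmod z)\<^sup>2 + (a * d + b * c) * Re z + b * d) / (cmod (c * z + d))\<^sup>2"
  unfolding moebius_def Re_divide cmod_power2
  by (rule arg_cong2[where f = "(/)"]) (simp_all add: algebra_simps power2_eq_square)

lemma hyp_motionE:
  assumes "hyp_motion g"
  obtains a b c d where "a * d - b * c = 1" "g = mob a b c d"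
  using assms unfolding hyp_motion_def by blast

lemma hyp_motionI: "a * d - b * c = 1 \<Longrightarrow> hyp_motion (mob a b c d)"
  unfolding hyp_motion_def by blast

lemma motion_in_plane:
  assumes "hyp_motion g" "z \<in> hyp_plane"
  shows "g z \<in> hyp_plane"
proof -
  obtain a b c d where *: "a * d - b * c = 1" "g = mob a b c d"
    using assms(1) by (rule hyp_motionE)
  show ?thesis
    using Im_mob[OF *(1), of z] moebius_denom_nonzero[OF *(1), of z] hyp_planeD[OF assms(2)] *(2)
    by (simp add: hyp_plane_def)
qed

lemma motion_compose:
  assumes "hyp_motion g" "hyp_motion h"
  shows "\<exists>k. hyp_motion k \<and> (\<forall>z \<in> hyp_plane. k z = g (h z))"
proof -
  obtain a b c d where g: "a * d - b * c = 1" "g = mob a b c d"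
    using assms(1) by (rule hyp_motionE)
  obtain a' b' c' d' where h: "a' * d' - b' * c' = 1" "h = mob a' b' c' d'"
    using assms(2) by (rule hyp_motionE)
  let ?k = "mob (a * a' + b * c') (a * b' + b * d') (c * a' + d * c') (c * b' + d * d')"
  have det: "(a * a' + b * c') * (c * b' + d * d') - (a * b' + b * d') * (c * a' + d * c') = 1"
  proof -
    have "(a * a' + b * c') * (c * b' + d * d') - (a * b' + b * d') * (c * a' + d * c')
      = (a * d - b * c) * (a' * d' - b' * c')" by (simp add: algebra_simps)
    thus ?thesis using g h by simp
  qed
  show ?thesis
  proof (intro exI[of _ ?k] conjI ballI)
    show "hyp_motion ?k" using det by (rule hyp_motionI)
    fix z assume z: "z \<in> hyp_plane"
    hence Imz: "Im z > 0" by (rule hyp_planeD)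
    have hz: "Im (h z) > 0" using motion_in_plane[OF assms(2) z] by (rule hyp_planeD)
    have n1: "of_real c' * z + d' \<noteq> 0" using moebius_denom_nonzero[OF h(1) Imz] .
    have n2: "of_real c * h z + d \<noteq> 0" using moebius_denom_nonzero[OF g(1) hz] .
    have e: "h z = (a' * z + b') / (c' * z + d')" using h(2) by (simp add: moebius_def)
    have "g (h z) = (a * h z + b) / (c * h z + d)" using g(2) by (simp add: moebius_def)
    also have "\<dots> = ((a * h z + b) * (c' * z + d')) / ((c * h z + d) * (c' * z + d'))"
      using n1 by simp
    also have "(a * h z + b) * (c' * z + d') = a * (a' * z + b') + b * (c' * z + d')"
      unfolding e using n1 by (simp add: field_simps)
    also have "(c * h z + d) * (c' * z + d') = c * (a' * z + b') + d * (c' * z + d')"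
      unfolding e using n1 by (simp add: field_simps)
    finally show "?k z = g (h z)" by (simp add: moebius_def algebra_simps)
  qed
qed

lemma motion_inverse:
  assumes "hyp_motion g"
  shows "\<exists>k. hyp_motion k \<and> (\<forall>z \<in> hyp_plane. k (g z) = z \<and> g (k z) = z)"
proof -
  obtain a b c d where g: "a * d - b * c = 1" "g = mob a b c d"
    using assms(1) by (rule hyp_motionE)
  have det: "d * a - (-b) * (-c) = 1" using g by (simp add: algebra_simps)
  have ne: "complex_of_real a * d \<noteq> b * c"
    using g(1) by (metis diff_self of_real_eq_iff of_real_mult zero_neq_one)
  show ?thesis
  proof (intro exI[of _ "mob d (-b) (-c) a"] conjI ballI)
    show "hyp_motion (mob d (-b) (-c) a)" using hyp_motionI[OF det] .
    fix z assume z: "z \<in> hyp_plane"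
    hence Imz: "Im z > 0" by (rule hyp_planeD)
    show "mob d (- b) (- c) a (g z) = z"
      using moebius_inverse[of "complex_of_real a" d b c z] ne moebius_denom_nonzero[OF g(1) Imz] g(2)
      by simp
    show "g (mob d (- b) (- c) a z) = z"
      using moebius_inverse'[of "complex_of_real a" d b c z] ne moebius_denom_nonzero[OF det Imz] g(2)
      by simp
  qed
qed

lemma continuous_on_motion:
  assumes "hyp_motion g"
  shows "continuous_on hyp_plane g"
proof -
  obtain a b c d where *: "a * d - b * c = 1" "g = mob a b c d"
    using assms(1) by (rule hyp_motionE)
  show ?thesis unfolding * moebius_def
    by (intro continuous_intros) (use moebius_denom_nonzero[OF *(1)] hyp_planeD in auto)
qed

lemma isCont_motion:
  assumes "hyp_motion g" "z \<in> hyp_plane"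
  shows "isCont g z"
  using continuous_on_motion[OF assms(1)] assms(2) open_hyp_plane
  by (simp add: continuous_on_eq_continuous_at)

text \<open>On the plane this is \<open>2 * (cosh d - 1)\<close> for the hyperbolic distance
  \<open>d\<close>. It is rational in the coordinates and the modulus squared, so invariance can be
  checked without \<open>arcosh\<close>.\<close>

definition hyp_form :: "complex \<Rightarrow> complex \<Rightarrow> real" where
  "hyp_form z w = (cmod (z - w))\<^sup>2 / (Im z * Im w)"

lemma hyp_dist_hyp_form: "hyp_dist z w = arcosh (1 + hyp_form z w / 2)"
  by (simp add: hyp_dist_def hyp_form_def field_simps)

lemma hyp_form_motion:
  assumes "hyp_motion g" "z \<in> hyp_plane" "w \<in> hyp_plane"
  shows "hyp_form (g z) (g w) = hyp_form z w"
proof -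
  obtain a b c d where *: "a * d - b * c = 1" "g = mob a b c d"
    using assms(1) by (rule hyp_motionE)
  have iz: "Im z > 0" "Im w > 0" using assms hyp_planeD by auto
  define p where "p = of_real c * z + d"
  define q where "q = of_real c * w + d"
  have pq: "p \<noteq> 0" "q \<noteq> 0" unfolding p_def q_def
    using moebius_denom_nonzero[OF *(1)] iz by auto
  have "g z - g w = (z - w) / (p * q)"
  proof -
    have "g z = (a * z + b) / p" "g w = (a * w + b) / q"
      using * by (auto simp: moebius_def p_def q_def)
    hence "g z - g w = ((a * z + b) * q - (a * w + b) * p) / (p * q)"
      using pq by (simp add: diff_frac_eq)
    also have "(a * z + b) * q - (a * w + b) * p = complex_of_real (a * d - b * c) * (z - w)"
      unfolding p_def q_def by (simp add: algebra_simps)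
    finally show ?thesis using * by simp
  qed
  moreover have "Im (g z) = Im z / (cmod p)\<^sup>2" "Im (g w) = Im w / (cmod q)\<^sup>2"
    using Im_mob[OF *(1)] iz * p_def q_def by auto
  ultimately show ?thesis using pq iz
    by (simp add: hyp_form_def norm_divide norm_mult power_divide power_mult_distrib)
qed

lemma hyp_dist_motion:
  assumes "hyp_motion g" "z \<in> hyp_plane" "w \<in> hyp_plane"
  shows "hyp_dist (g z) (g w) = hyp_dist z w"
  using hyp_form_motion[OF assms] by (simp add: hyp_dist_hyp_form)

text \<open>Discs whose Euclidean radius is a fixed fraction of the height are comparable to
  hyperbolic discs of fixed radius, so a motion distorts the fraction by at most a constant,
  uniformly over all motions. This is the source of all uniform radii below.\<close>

lemma motion_ball:
  assumes "hyp_motion g" "z \<in> hyp_plane" "w \<in> ball z (k * Im z)" "k \<le> 1/2"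
  shows "w \<in> hyp_plane" "cmod (g w - g z) < 4 * k * Im (g z)"
proof -
  have iz: "Im z > 0" using assms hyp_planeD by blast
  have d: "cmod (w - z) < k * Im z" using assms(3) by (simp add: dist_norm norm_minus_commute)
  have k: "k > 0" using d iz by (metis norm_ge_zero order_le_less_trans zero_less_mult_pos2)
  have "\<bar>Im (w - z)\<bar> < k * Im z" using abs_Im_le_cmod[of "w - z"] d by linarith
  moreover have "k * Im z \<le> 1/2 * Im z" by (rule mult_right_mono) (use assms(4) iz in linarith)+
  ultimately have iw: "Im w > Im z / 2" unfolding minus_complex.sel by linarith
  thus w: "w \<in> hyp_plane" using iz by (simp add: hyp_plane_def)
  have gz: "Im (g z) > 0" "Im (g w) > 0"
    using motion_in_plane[OF assms(1) assms(2)] motion_in_plane[OF assms(1) w] hyp_planeD by auto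
  \<comment> \<open>The displacement relative to the height. Invariance of \<open>hyp_form\<close>
    yields \<open>s\<^sup>2 < 2 * k\<^sup>2 * (1 + s)\<close>, which is impossible for
    \<open>s \<ge> 4 * k\<close> when \<open>k \<le> 1/2\<close>.\<close>
  define s where "s = cmod (g w - g z) / Im (g z)"
  have s0: "s \<ge> 0" using gz by (simp add: s_def)
  have "Im (g w) \<le> Im (g z) + cmod (g w - g z)"
    using abs_Im_le_cmod[of "g w - g z"] by auto
  moreover have "Im (g z) * (1 + s) = Im (g z) + cmod (g w - g z)"
    using gz by (simp add: s_def distrib_left)
  ultimately have r: "Im (g w) \<le> Im (g z) * (1 + s)" by simp
  have "hyp_form (g w) (g z) = hyp_form w z" by (rule hyp_form_motion) (use assms w in auto)
  also have "hyp_form w z < 2 * k\<^sup>2"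
  proof -
    have "(cmod (w - z))\<^sup>2 < (k * Im z)\<^sup>2" using d by (simp add: power_strict_mono)
    also have "\<dots> \<le> 2 * k\<^sup>2 * (Im w * Im z)"
    proof -
      have "k\<^sup>2 * Im z * (Im z / 2) \<le> k\<^sup>2 * Im z * Im w"
        by (rule mult_left_mono) (use iw iz in auto)
      thus ?thesis by (simp add: power2_eq_square algebra_simps)
    qed
    finally show ?thesis using iz iw by (simp add: hyp_form_def divide_less_eq)
  qed
  finally have f: "(cmod (g w - g z))\<^sup>2 < 2 * k\<^sup>2 * (Im (g w) * Im (g z))"
    using gz by (simp add: hyp_form_def divide_less_eq)
  also have "\<dots> \<le> 2 * k\<^sup>2 * (Im (g z) * (1 + s) * Im (g z))"
    by (intro mult_left_mono mult_right_mono r) (use gz in auto)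
  finally have "(cmod (g w - g z))\<^sup>2 / (Im (g z))\<^sup>2 < 2 * k\<^sup>2 * (1 + s)"
    using gz by (simp add: divide_less_eq power2_eq_square algebra_simps)
  hence s2: "s\<^sup>2 < 2 * k\<^sup>2 * (1 + s)" by (simp add: s_def power_divide)
  have "s < 4 * k"
  proof (rule ccontr)
    assume "\<not> s < 4 * k"
    hence s4: "s \<ge> 4 * k" by simp
    have "2 * k\<^sup>2 * (1 + s) \<le> s\<^sup>2"
    proof -
      have "2 * k\<^sup>2 \<le> s\<^sup>2 / 8"
      proof -
        have "(4 * k)\<^sup>2 \<le> s\<^sup>2" using s4 k by (intro power_mono) auto
        thus ?thesis by (simp add: power2_eq_square)
      qed
      moreover have "2 * k\<^sup>2 * s \<le> s\<^sup>2 / 4"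
      proof -
        have "2 * k\<^sup>2 \<le> k" using assms(4) k by (simp add: power2_eq_square)
        hence "2 * k\<^sup>2 \<le> s / 4" using s4 by simp
        from mult_right_mono[OF this s0] show ?thesis by (simp add: power2_eq_square)
      qed
      moreover have "s\<^sup>2 \<ge> 0" by simp
      moreover have "2 * k\<^sup>2 * (1 + s) = 2 * k\<^sup>2 + 2 * k\<^sup>2 * s" by (simp add: distrib_left)
      ultimately show ?thesis by linarith
    qed
    thus False using s2 by simp
  qed
  thus "cmod (g w - g z) < 4 * k * Im (g z)" using gz by (simp add: s_def field_simps)
qed

text \<open>With denominators cleared, \<open>g z = h z\<close> is a polynomial equation of degree
  at most two.\<close>

lemma motion_eq_infinite:
  assumes "hyp_motion g" "hyp_motion h" "infinite S" "S \<subseteq> hyp_plane" "\<And>z. z \<in> S \<Longrightarrow> g z = h z"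
    and z: "z \<in> hyp_plane"
  shows "g z = h z"
proof -
  obtain a b c d where g: "a * d - b * c = 1" "g = mob a b c d"
    using assms(1) by (rule hyp_motionE)
  obtain a' b' c' d' where h: "a' * d' - b' * c' = 1" "h = mob a' b' c' d'"
    using assms(2) by (rule hyp_motionE)
  let ?p = "[:complex_of_real b, complex_of_real a:] * [:complex_of_real d', complex_of_real c':]
     - [:complex_of_real b', complex_of_real a':] * [:complex_of_real d, complex_of_real c:]"
  have eq: "g z = h z \<longleftrightarrow> poly ?p z = 0" if "z \<in> hyp_plane" for z
  proof -
    have "Im z > 0" using that by (rule hyp_planeD)
    hence n: "of_real c * z + d \<noteq> 0" "of_real c' * z + d' \<noteq> 0"
      using moebius_denom_nonzero[OF g(1)] moebius_denom_nonzero[OF h(1)] by blast+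
    show ?thesis using n unfolding g(2) h(2) moebius_def
      by (simp add: frac_eq_eq algebra_simps)
  qed
  have "S \<subseteq> {z. poly ?p z = 0}" using assms eq by auto
  hence "infinite {z. poly ?p z = 0}" using assms(3) finite_subset by blast
  hence "?p = 0" using poly_roots_finite by blast
  thus ?thesis using eq[OF z] by (metis poly_0)
qed

section \<open>Reflection and folding in the imaginary axis\<close>

definition mirror :: "complex \<Rightarrow> complex" where "mirror z = - cnj z"
definition hfold :: "complex \<Rightarrow> complex" where "hfold z = Complex \<bar>Re z\<bar> (Im z)"

lemma mirror_simps [simp]: "Re (mirror z) = - Re z" "Im (mirror z) = Im z" "mirror (mirror z) = z"
  by (simp_all add: mirror_def)

lemma hfold_simps [simp]: "Re (hfold z) = \<bar>Re z\<bar>" "Im (hfold z) = Im z" "hfold (mirror z) = hfold z"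
  by (simp_all add: hfold_def)

lemma mirror_in_plane [simp]: "mirror z \<in> hyp_plane \<longleftrightarrow> z \<in> hyp_plane"
  by (simp add: hyp_plane_def)

lemma hfold_in_plane: "z \<in> hyp_plane \<Longrightarrow> hfold z \<in> hyp_half_plane"
  by (simp add: hyp_plane_def hyp_half_plane_def)

lemma hfold_pos: "Re z \<ge> 0 \<Longrightarrow> hfold z = z"
  by (simp add: complex_eq_iff)

lemma hfold_neg: "Re z \<le> 0 \<Longrightarrow> hfold z = mirror z"
  by (simp add: complex_eq_iff)

lemma hfold_eq_iff: "hfold z = hfold w \<longleftrightarrow> z = w \<or> z = mirror w"
  by (auto simp: complex_eq_iff abs_eq_iff)

lemma dist_hfold: "dist (hfold z) (hfold w) \<le> dist z w"
proof -
  have "(\<bar>Re z\<bar> - \<bar>Re w\<bar>)\<^sup>2 \<le> (Re z - Re w)\<^sup>2"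
    using abs_triangle_ineq3[of "Re z" "Re w"] by (metis power2_abs power_mono abs_ge_zero)
  thus ?thesis by (simp add: dist_norm cmod_def)
qed

lemma continuous_on_hfold [continuous_intros]:
  "continuous_on S f \<Longrightarrow> continuous_on S (\<lambda>x. hfold (f x))"
  unfolding hfold_def Complex_eq by (intro continuous_intros)

lemma continuous_on_mirror [continuous_intros]:
  "continuous_on S f \<Longrightarrow> continuous_on S (\<lambda>x. mirror (f x))"
  unfolding mirror_def by (intro continuous_intros)

lemma hyp_dist_mirror: "hyp_dist (mirror z) (mirror w) = hyp_dist z w"
proof -
  have "mirror z - mirror w = - cnj (z - w)" by (simp add: mirror_def)
  hence "cmod (mirror z - mirror w) = cmod (z - w)" by (simp only: norm_minus_cancel complex_mod_cnj)
  thus ?thesis by (simp add: hyp_dist_def)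
qed

text \<open>Conjugation by the mirror negates \<open>b\<close> and \<open>c\<close> and keeps the
  determinant. The mirror itself is not a motion, so this is how arguments about the left half of
  the plane stay within the motions.\<close>

lemma motion_conj_mirror:
  assumes "hyp_motion g"
  shows "\<exists>k. hyp_motion k \<and> (\<forall>z \<in> hyp_plane. k z = mirror (g (mirror z)))"
proof -
  obtain a b c d where g: "a * d - b * c = 1" "g = mob a b c d"
    using assms(1) by (rule hyp_motionE)
  show ?thesis
  proof (intro exI[of _ "mob a (-b) (-c) d"] conjI ballI)
    show "hyp_motion (mob a (-b) (-c) d)" by (rule hyp_motionI) (use g in simp)
    fix z :: complex assume "z \<in> hyp_plane"
    have "(a * (- w) + b) / (c * (- w) + d) = - ((a * w + - b) / (- c * w + d))" for w :: complex
    proof -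
      have "a * (- w) + b = - (a * w + - b)" "c * (- w) + d = - c * w + d" by simp_all
      thus ?thesis by (simp only: minus_divide_left)
    qed
    moreover have "cnj (g (mirror z)) = (a * (-z) + b) / (c * (-z) + d)"
      unfolding g(2) moebius_def mirror_def by simp
    ultimately show "mob a (-b) (-c) d z = mirror (g (mirror z))"
      unfolding mirror_def[of "g (mirror z)"] moebius_def by simp
  qed
qed

text \<open>Motions preserve orientation. Algebraically, agreement with the mirror forces
  \<open>d = a\<close> and a real equation that restricts on a horizontal segment to a polynomial in
  \<open>Re z\<close>; its vanishing gives \<open>a = c = 0\<close>, against the
  determinant.\<close>

lemma motion_not_mirror:
  assumes "hyp_motion g" "open S" "S \<noteq> {}" "S \<subseteq> hyp_plane"
  shows "\<not> (\<forall>z \<in> S. g z = mirror z)"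
proof
  assume eq: "\<forall>z \<in> S. g z = mirror z"
  obtain a b c d where g: "a * d - b * c = 1" "g = mob a b c d"
    using assms(1) by (rule hyp_motionE)
  obtain z0 where z0: "z0 \<in> S" using assms(3) by blast
  obtain e where e: "e > 0" "ball z0 e \<subseteq> S" using assms(2) z0 open_contains_ball by blast
  have *: "c * (cmod z)\<^sup>2 + 2 * a * Re z + b = 0" "d = a" if "z \<in> S" for z
  proof -
    have i: "Im z > 0" using that assms(4) hyp_planeD by blast
    have "mirror z * (c * z + d) = a * z + b"
      using mob_mult_denom[OF g(1) i] eq that g(2) by simp
    hence "- (c * (cmod z)\<^sup>2) - d * Re z = a * Re z + b \<and> d * Im z = a * Im z"
      unfolding mirror_def complex_eq_iff cmod_power2
      by (simp add: algebra_simps power2_eq_square)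
    thus "c * (cmod z)\<^sup>2 + 2 * a * Re z + b = 0" "d = a" using i by (auto simp: algebra_simps)
  qed
  let ?p = "[:b + c * (Im z0)\<^sup>2, 2 * a, c:]"
  have "{Re z0 <..< Re z0 + e} \<subseteq> {x. poly ?p x = 0}"
  proof
    fix x assume x: "x \<in> {Re z0 <..< Re z0 + e}"
    have "Complex x (Im z0) \<in> S" using x e by (intro subsetD[OF e(2)]) (simp add: dist_norm cmod_def)
    from *(1)[OF this] show "x \<in> {x. poly ?p x = 0}"
      unfolding cmod_power2 by (simp add: algebra_simps power2_eq_square)
  qed
  moreover have "infinite {Re z0 <..< Re z0 + e}" using e by simp
  ultimately have "?p = 0" using poly_roots_finite finite_subset by blast
  hence "a = 0" "c = 0" by auto
  thus False using g *(2)[OF z0] by simp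
qed

text \<open>Makes the motion representing a folded germ unique. Pointwise \<open>g\<close> equals
  \<open>h\<close> or its mirror image. If the second alternative fails somewhere, it fails on an
  open set, where then \<open>g = h\<close>; if it holds throughout \<open>S\<close>, a motion
  composed from \<open>g\<close> and \<open>h\<close> equals the mirror on \<open>S\<close>, which
  \<open>motion_not_mirror\<close> excludes.\<close>

lemma hfold_motion_eq:
  assumes "hyp_motion g" "hyp_motion h" "open S" "S \<noteq> {}" "S \<subseteq> hyp_plane"
    and eq: "\<And>z. z \<in> S \<Longrightarrow> hfold (g z) = hfold (h z)" and z: "z \<in> hyp_plane"
  shows "g z = h z"
proof (cases "\<exists>z0 \<in> S. g z0 \<noteq> mirror (h z0)")
  case True
  let ?T = "{z \<in> S. g z - mirror (h z) \<in> - {0}}"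
  have c: "continuous_on S (\<lambda>z. g z - mirror (h z))"
    using continuous_on_motion assms
    by (intro continuous_intros) (auto intro: continuous_on_subset)
  have "open (S \<inter> (\<lambda>z. g z - mirror (h z)) -` (- {0}))"
    by (rule continuous_open_preimage[OF c assms(3)]) (simp add: open_Compl)
  hence "open ?T" by (simp add: Int_def vimage_def)
  moreover have "?T \<noteq> {}" using True by auto
  ultimately have "infinite ?T" using finite_imp_not_open by blast
  thus ?thesis
  proof (rule motion_eq_infinite[OF assms(1,2)])
    show "?T \<subseteq> hyp_plane" using assms by auto
    show "g w = h w" if "w \<in> ?T" for w using that eq[of w] by (auto simp: hfold_eq_iff)
  qed (rule z)
next
  case False
  obtain h2 where h2: "hyp_motion h2" "\<forall>z \<in> hyp_plane. h2 z = mirror (h (mirror z))"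
    using motion_conj_mirror[OF assms(2)] by blast
  obtain k where k: "hyp_motion k" "\<forall>z \<in> hyp_plane. k (h2 z) = z \<and> h2 (k z) = z"
    using motion_inverse[OF h2(1)] by blast
  obtain m where m: "hyp_motion m" "\<forall>z \<in> hyp_plane. m z = k (g z)"
    using motion_compose[OF k(1) assms(1)] by blast
  have "m z = mirror z" if "z \<in> S" for z
  proof -
    have z: "z \<in> hyp_plane" using that assms(5) by auto
    have "m z = k (mirror (h z))" using m z False that by simp
    also have "mirror (h z) = h2 (mirror z)" using bspec[OF h2(2), of "mirror z"] z by simp
    finally show ?thesis using bspec[OF k(2), of "mirror z"] z by simp
  qed
  thus ?thesis using motion_not_mirror[OF m(1) assms(3,4,5)] by blast
qed

section \<open>Geodesic lines\<close>

text \<open>The exponential makes this the parametrisation by arc length, see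
  \<open>hyp_dist_iaxis\<close>.\<close>

definition iaxis :: "real \<Rightarrow> complex" where "iaxis t = Complex 0 (exp t)"

lemma iaxis_simps [simp]: "Re (iaxis t) = 0" "Im (iaxis t) = exp t" "iaxis t \<in> hyp_plane"
  "cmod (iaxis t) = exp t"
  by (simp_all add: iaxis_def hyp_plane_def cmod_def)

lemma iaxis_eq_iff [simp]: "iaxis s = iaxis t \<longleftrightarrow> s = t"
  by (simp add: iaxis_def)

lemma iaxis_ln: "z \<in> hyp_plane \<Longrightarrow> Re z = 0 \<Longrightarrow> z = iaxis (ln (Im z))"
  by (simp add: complex_eq_iff hyp_plane_def)

lemma continuous_on_iaxis [continuous_intros]:
  "continuous_on S f \<Longrightarrow> continuous_on S (\<lambda>x. iaxis (f x))"
  unfolding iaxis_def Complex_eq by (intro continuous_intros)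

text \<open>
  Forms of unit norm correspond to oriented geodesics, their zero sets; for disjoint geodesics the
  absolute value of the product \<open>linner\<close> is the cosine hyperbolic of their distance.
\<close>

fun lform :: "real \<times> real \<times> real \<Rightarrow> complex \<Rightarrow> real" where
  "lform (\<alpha>, \<beta>, \<gamma>) z = \<alpha> * (cmod z)\<^sup>2 + \<beta> * Re z + \<gamma>"

fun linner :: "real \<times> real \<times> real \<Rightarrow> real \<times> real \<times> real \<Rightarrow> real" where
  "linner (\<alpha>, \<beta>, \<gamma>) (\<alpha>', \<beta>', \<gamma>') = \<beta> * \<beta>' - 2 * \<alpha> * \<gamma>' - 2 * \<alpha>' * \<gamma>"

text \<open>\<open>T\<close> substitutes \<open>(a * z + b) / (c * z + d)\<close> into the form and
  clears the denominator; the positive factor is the squared modulus of \<open>c * z + d\<close>.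
  \<open>linner\<close> is the polarised discriminant, which the substitution multiplies by the
  squared determinant.\<close>

lemma lform_pullback:
  assumes "hyp_motion h"
  shows "\<exists>T. (\<forall>v w. linner (T v) (T w) = linner v w) \<and>
    (\<forall>z \<in> hyp_plane. \<exists>c > 0. \<forall>v. lform (T v) z = c * lform v (h z))"
proof -
  obtain a b c d where h: "a * d - b * c = 1" "h = mob a b c d"
    using assms(1) by (rule hyp_motionE)
  let ?T = "\<lambda>(\<alpha>, \<beta>, \<gamma>). (\<alpha> * a\<^sup>2 + \<beta> * a * c + \<gamma> * c\<^sup>2,
    2 * \<alpha> * a * b + \<beta> * (a * d + b * c) + 2 * \<gamma> * c * d, \<alpha> * b\<^sup>2 + \<beta> * b * d + \<gamma> * d\<^sup>2)"
  show ?thesis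
  proof (intro exI[of _ ?T] conjI allI ballI)
    fix v w :: "real \<times> real \<times> real"
    obtain \<alpha> \<beta> \<gamma> where v: "v = (\<alpha>, \<beta>, \<gamma>)" by (cases v)
    obtain \<alpha>' \<beta>' \<gamma>' where w: "w = (\<alpha>', \<beta>', \<gamma>')" by (cases w)
    have "linner (?T v) (?T w) = (a * d - b * c)\<^sup>2 * linner v w"
      unfolding v w by (simp add: power2_eq_square algebra_simps)
    thus "linner (?T v) (?T w) = linner v w" using h by simp
  next
    fix z assume z: "z \<in> hyp_plane"
    have i: "Im z > 0" using z by (rule hyp_planeD)
    have n: "of_real c * z + d \<noteq> 0" using moebius_denom_nonzero[OF h(1) i] .
    let ?N = "(cmod (c * z + d))\<^sup>2"
    have N: "?N > 0" using n by simp
    show "\<exists>k > 0. \<forall>v. lform (?T v) z = k * lform v (h z)"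
    proof (intro exI[of _ ?N] conjI allI N)
      fix v :: "real \<times> real \<times> real"
      obtain \<alpha> \<beta> \<gamma> where v: "v = (\<alpha>, \<beta>, \<gamma>)" by (cases v)
      have 1: "?N * (cmod (h z))\<^sup>2 = (cmod (a * z + b))\<^sup>2"
        unfolding h(2) moebius_def using n by (simp add: norm_divide power_divide)
      have 2: "?N * Re (h z) = a * c * (cmod z)\<^sup>2 + (a * d + b * c) * Re z + b * d"
        using Re_mob[OF h(1) i] N by (simp add: h(2))
      have "?N * lform v (h z) = \<alpha> * (?N * (cmod (h z))\<^sup>2) + \<beta> * (?N * Re (h z)) + \<gamma> * ?N"
        unfolding v by (simp add: algebra_simps)
      also have "\<dots> = lform (?T v) z"
        unfolding 1 2 unfolding v cmod_power2 by (simp add: power2_eq_square algebra_simps cmod_power2[unfolded power2_eq_square])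
      finally show "lform (?T v) z = ?N * lform v (h z)" by simp
    qed
  qed
qed

text \<open>A quadratic polynomial of discriminant one factors as
  \<open>(a * x + b) * (c * x + d)\<close> with \<open>a * d - b * c = 1\<close> for suitable signs,
  since the discriminant of such a product is \<open>(a * d - b * c)\<^sup>2\<close>. The three
  coefficients of the product are those in the numerator of \<open>Re_mob\<close>.\<close>

lemma hyp_motion_of_lform:
  assumes "linner v v = 1"
  shows "\<exists>h. hyp_motion h \<and> (\<forall>z \<in> hyp_plane. \<exists>c > 0. lform v z = c * Re (h z))"
proof -
  obtain \<alpha> \<beta> \<gamma> where v: "v = (\<alpha>, \<beta>, \<gamma>)" by (cases v)
  have u: "\<beta> * \<beta> - 4 * \<alpha> * \<gamma> = 1" using assms v by simp
  obtain a b c d where m: "a * d - b * c = 1" "a * c = \<alpha>" "a * d + b * c = \<beta>" "b * d = \<gamma>"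
  proof (cases "\<alpha> = 0")
    case False
    show ?thesis
      by (rule that[of \<alpha> "(\<beta> + 1) / (2 * \<alpha>)" "(\<beta> - 1) / 2" 1]) (use False u in \<open>auto simp: field_simps\<close>)
  next
    case True
    hence "(\<beta> - 1) * (\<beta> + 1) = 0" using u by (simp add: algebra_simps)
    hence "\<beta> = 1 \<or> \<beta> = -1" by auto
    thus ?thesis
    proof
      assume "\<beta> = 1" thus ?thesis using True by (intro that[of 1 1 \<gamma> 0]) auto
    next
      assume "\<beta> = -1" thus ?thesis using True by (intro that[of 0 "-\<gamma>" "-1" 1]) auto
    qed
  qed
  show ?thesis
  proof (intro exI[of _ "mob a b c d"] conjI ballI)
    show "hyp_motion (mob a b c d)" using m(1) by (rule hyp_motionI)
    fix z assume z: "z \<in> hyp_plane"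
    have i: "Im z > 0" using z by (rule hyp_planeD)
    have n: "of_real c * z + d \<noteq> 0" using moebius_denom_nonzero[OF m(1) i] .
    show "\<exists>k > 0. lform v z = k * Re (mob a b c d z)"
      by (rule exI[of _ "(cmod (c * z + d))\<^sup>2"]) (use n m v Re_mob[OF m(1) i] in auto)
  qed
qed

lemma lform_of_hyp_motion:
  assumes "hyp_motion h"
  shows "\<exists>v. linner v v = 1 \<and> (\<forall>z \<in> hyp_plane. \<exists>c > 0. lform v z = c * Re (h z))"
proof -
  obtain T where T: "\<forall>v w. linner (T v) (T w) = linner v w"
    "\<forall>z \<in> hyp_plane. \<exists>c > 0. \<forall>v. lform (T v) z = c * lform v (h z)"
    using lform_pullback[OF assms] by blast
  have "linner (T (0, 1, 0)) (T (0, 1, 0)) = 1" using T(1) by simp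
  moreover have "\<exists>c > 0. lform (T (0, 1, 0)) z = c * Re (h z)" if "z \<in> hyp_plane" for z
    using T(2) that by (force dest: bspec)
  ultimately show ?thesis by blast
qed

lemma Re_motion_axis_forms:
  assumes "hyp_motion h"
  shows "\<exists>\<alpha> \<beta> \<gamma>. \<beta>\<^sup>2 = 1 + 4 * \<alpha> * \<gamma> \<and>
    (\<forall>z \<in> hyp_plane. \<exists>c > 0. \<alpha> * (cmod z)\<^sup>2 + \<beta> * Re z + \<gamma> = c * Re (h z))"
proof -
  obtain v where v: "linner v v = 1" "\<forall>z \<in> hyp_plane. \<exists>c > 0. lform v z = c * Re (h z)"
    using lform_of_hyp_motion[OF assms] by blast
  obtain \<alpha> \<beta> \<gamma> where e: "v = (\<alpha>, \<beta>, \<gamma>)" by (cases v)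
  show ?thesis using v unfolding e
    by (intro exI[of _ \<alpha>] exI[of _ \<beta>] exI[of _ \<gamma>]) (simp add: power2_eq_square)
qed

lemma quadratic_zero_infinite:
  fixes a b c :: real
  assumes "infinite S" "\<And>x. x \<in> S \<Longrightarrow> a * x\<^sup>2 + b * x + c = 0"
  shows "a = 0 \<and> b = 0 \<and> c = 0"
proof -
  have "S \<subseteq> {x. poly [:c, b, a:] x = 0}"
    using assms(2) by (auto simp: algebra_simps power2_eq_square)
  hence "[:c, b, a:] = 0" using assms(1) poly_roots_finite finite_subset by blast
  thus ?thesis by auto
qed

text \<open>On the axis the form of \<open>h\<close> is
  \<open>\<alpha> * (exp s)\<^sup>2 + \<gamma>\<close>. Infinitely many zeros kill
  \<open>\<alpha>\<close> and \<open>\<gamma>\<close>, leaving a nonzero multiple of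
  \<open>Re z\<close>.\<close>

lemma Re_motion_zero_on_axis:
  assumes "hyp_motion h" "infinite S" "\<And>s. s \<in> S \<Longrightarrow> Re (h (iaxis s)) = 0" "z \<in> hyp_plane"
  shows "Re (h z) = 0 \<longleftrightarrow> Re z = 0"
proof -
  obtain \<alpha> \<beta> \<gamma> where f: "\<beta>\<^sup>2 = 1 + 4 * \<alpha> * \<gamma>"
    "\<forall>z \<in> hyp_plane. \<exists>c > 0. \<alpha> * (cmod z)\<^sup>2 + \<beta> * Re z + \<gamma> = c * Re (h z)"
    using Re_motion_axis_forms[OF assms(1)] by blast
  have "\<alpha> = 0 \<and> 0 = (0::real) \<and> \<gamma> = 0"
  proof (rule quadratic_zero_infinite[of "exp ` S"])
    show "infinite (exp ` S)" using assms(2) by (simp add: finite_image_iff inj_on_def)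
    fix x assume "x \<in> exp ` S"
    then obtain s where s: "s \<in> S" "x = exp s" by auto
    show "\<alpha> * x\<^sup>2 + 0 * x + \<gamma> = 0"
      using bspec[OF f(2), of "iaxis s"] assms(3)[OF s(1)] s by auto
  qed
  thus ?thesis using f(1) bspec[OF f(2) assms(4)] by auto
qed

lemma motion_eq_on_axis:
  assumes "hyp_motion g" "hyp_motion h" "infinite S" "\<And>s. s \<in> S \<Longrightarrow> g (iaxis s) = h (iaxis s)"
    "z \<in> hyp_plane"
  shows "g z = h z"
proof (rule motion_eq_infinite[OF assms(1,2), of "iaxis ` S"])
  show "infinite (iaxis ` S)" using assms(3) by (simp add: finite_image_iff inj_on_def)
qed (use assms in auto)

lemma infinite_if_eventually_nhds:
  fixes t :: real
  assumes "eventually P (nhds t)"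
  shows "infinite {s. P s}"
proof -
  obtain S where S: "open S" "t \<in> S" "\<forall>s \<in> S. P s" using assms unfolding eventually_nhds by blast
  have "infinite S" using S finite_imp_not_open by blast
  thus ?thesis using S(3) finite_subset[of S "{s. P s}"] by blast
qed

lemma eventually_nhds_isCont:
  assumes "isCont f x" "eventually P (nhds (f x))"
  shows "eventually (\<lambda>y. P (f y)) (nhds x)"
proof -
  have "filterlim f (nhds (f x)) (nhds x)"
    using assms(1) by (simp add: isCont_def tendsto_at_iff_tendsto_nhds)
  thus ?thesis using assms(2) by (rule filterlim_iff[THEN iffD1, rule_format])
qed

lemma isCont_iaxis: "isCont iaxis t"
  using continuous_on_iaxis[of UNIV "\<lambda>x. x"] by (simp add: continuous_on_eq_continuous_at)

lemma motion_Re_sign_locally: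
  assumes "hyp_motion h" "z \<in> hyp_plane" "Re (h z) \<noteq> 0"
  shows "eventually (\<lambda>w. Re (h w) * Re (h z) > 0) (nhds z)"
proof -
  have "isCont (\<lambda>w. Re (h w) * Re (h z)) z" using isCont_motion[OF assms(1,2)] by simp
  moreover have "eventually (\<lambda>x. x \<in> {0<..}) (nhds (Re (h z) * Re (h z)))"
    using assms(3) by (intro eventually_nhds_in_open) (auto simp: zero_less_mult_iff)
  ultimately have "eventually (\<lambda>w. Re (h w) * Re (h z) \<in> {0<..}) (nhds z)" by (rule eventually_nhds_isCont)
  thus ?thesis by simp
qed

lemma eventually_iaxis:
  assumes "eventually P (nhds (iaxis t))"
  shows "eventually (\<lambda>s. P (iaxis s)) (nhds t)"
  using eventually_nhds_isCont[OF isCont_iaxis assms] .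

text \<open>Inclusion of one geodesic in another near a single point suffices. Composing with the
  inverse of \<open>h\<close> turns the first geodesic into the imaginary axis, on which the second
  form then vanishes infinitely often.\<close>

lemma hline_unique:
  assumes "hyp_motion h" "hyp_motion k" "z \<in> hyp_plane" "Re (h z) = 0"
    and "eventually (\<lambda>y. Re (h y) = 0 \<longrightarrow> Re (k y) = 0) (nhds z)" "y \<in> hyp_plane"
  shows "Re (h y) = 0 \<longleftrightarrow> Re (k y) = 0"
proof -
  obtain h' where h': "hyp_motion h'" "\<forall>z \<in> hyp_plane. h' (h z) = z \<and> h (h' z) = z"
    using motion_inverse[OF assms(1)] by blast
  obtain m where m: "hyp_motion m" "\<forall>z \<in> hyp_plane. m z = k (h' z)"
    using motion_compose[OF assms(2) h'(1)] by blast
  have hz: "h z \<in> hyp_plane" using motion_in_plane[OF assms(1,3)] .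
  define t where "t = ln (Im (h z))"
  have t: "h z = iaxis t" unfolding t_def by (rule iaxis_ln[OF hz assms(4)])
  have c: "isCont h' (iaxis t)" by (rule isCont_motion[OF h'(1)]) simp
  have z: "z = h' (iaxis t)" using h'(2) assms(3) t by metis
  have "eventually (\<lambda>w. Re (h (h' w)) = 0 \<longrightarrow> Re (k (h' w)) = 0) (nhds (iaxis t))"
    by (rule eventually_nhds_isCont[OF c]) (use assms(5) z in simp)
  from infinite_if_eventually_nhds[OF eventually_iaxis[OF this]]
  have inf: "infinite {s. Re (h (h' (iaxis s))) = 0 \<longrightarrow> Re (k (h' (iaxis s))) = 0}" .
  have "Re (m w) = 0 \<longleftrightarrow> Re w = 0" if "w \<in> hyp_plane" for w
    by (rule Re_motion_zero_on_axis[OF m(1) inf _ that]) (use h'(2) m(2) in auto)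
  from this[of "h y"] show ?thesis
    using m(2) h'(2) assms(6) motion_in_plane[OF assms(1,6)] by auto
qed

lemma hline_connected:
  assumes "hyp_motion h"
  shows "connected {z \<in> hyp_plane. Re (h z) = 0}"
proof -
  obtain h' where h': "hyp_motion h'" "\<forall>z \<in> hyp_plane. h' (h z) = z \<and> h (h' z) = z"
    using motion_inverse[OF assms(1)] by blast
  have "{z \<in> hyp_plane. Re (h z) = 0} = range (\<lambda>t. h' (iaxis t))" (is "?L = ?R")
  proof
    show "?L \<subseteq> ?R"
    proof
      fix z assume z: "z \<in> ?L"
      hence "h z = iaxis (ln (Im (h z)))" using iaxis_ln motion_in_plane[OF assms] by blast
      thus "z \<in> ?R" using h'(2) z by (metis (mono_tags, lifting) mem_Collect_eq rangeI)
    qed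
    show "?R \<subseteq> ?L" using h' motion_in_plane[OF h'(1)] by auto
  qed
  moreover have "continuous_on UNIV (\<lambda>t. h' (iaxis t))"
    by (rule continuous_on_compose2[OF continuous_on_motion[OF h'(1)]])
      (auto intro: continuous_intros)
  ultimately show ?thesis by (metis connected_UNIV connected_continuous_image)
qed

section \<open>Distances on the imaginary axis and isometric curves\<close>

lemma cosh_hyp_dist:
  assumes "z \<in> hyp_plane" "w \<in> hyp_plane"
  shows "cosh (hyp_dist z w) = 1 + hyp_form z w / 2"
  unfolding hyp_dist_hyp_form
  by (rule cosh_arcosh_real) (use assms hyp_planeD in \<open>auto simp: hyp_form_def less_imp_le\<close>)

lemma hyp_dist_eqI:
  assumes "z \<in> hyp_plane" "w \<in> hyp_plane" "1 + hyp_form z w / 2 = cosh r"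
  shows "hyp_dist z w = \<bar>r\<bar>"
  unfolding hyp_dist_hyp_form assms(3) 
  using arcosh_cosh_real[of "\<bar>r\<bar>"] by (simp only: cosh_real_abs abs_ge_zero)

lemma hyp_form_iaxis: "1 + hyp_form z (iaxis t) / 2 = ((cmod z)\<^sup>2 + (exp t)\<^sup>2) / (2 * Im z * exp t)"
  if "z \<in> hyp_plane"
proof -
  have "(cmod (z - iaxis t))\<^sup>2 = (cmod z)\<^sup>2 + (exp t)\<^sup>2 - 2 * Im z * exp t"
    unfolding cmod_power2 by (simp add: power2_eq_square algebra_simps)
  thus ?thesis using hyp_planeD[OF that] by (simp add: hyp_form_def field_simps)
qed

lemma cosh_real_eq: "cosh (x::real) = (exp x + exp (- x)) / 2"
  by (simp add: cosh_def)

lemma hyp_dist_iaxis [simp]: "hyp_dist (iaxis s) (iaxis t) = \<bar>s - t\<bar>"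
proof (rule hyp_dist_eqI)
  have "((exp s)\<^sup>2 + (exp t)\<^sup>2) / (2 * exp s * exp t) = cosh (s - t)"
    by (simp add: cosh_real_eq exp_diff field_simps power2_eq_square)
  thus "1 + hyp_form (iaxis s) (iaxis t) / 2 = cosh (s - t)" using hyp_form_iaxis[of "iaxis s" t] by simp
qed auto

lemma hyp_dist_motion_axis: "hyp_motion h \<Longrightarrow> hyp_dist (h (iaxis s)) (h (iaxis t)) = \<bar>s - t\<bar>"
  by (simp add: hyp_dist_motion)

text \<open>The two distance conditions are linear equations in \<open>(cmod z)\<^sup>2\<close> and
  \<open>Im z\<close>. Their difference gives \<open>Im z = exp s\<close>, and then the modulus is
  \<open>exp s\<close> as well.\<close>

lemma axis_point_unique:
  assumes z: "z \<in> hyp_plane" and "s0 \<noteq> s1" "hyp_dist z (iaxis s0) = \<bar>s - s0\<bar>" "hyp_dist z (iaxis s1) = \<bar>s - s1\<bar>"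
  shows "z = iaxis s"
proof -
  have *: "(cmod z)\<^sup>2 + (exp t)\<^sup>2 = Im z * (exp s + (exp t)\<^sup>2 * exp (- s))"
    if "hyp_dist z (iaxis t) = \<bar>s - t\<bar>" for t
  proof -
    have "((cmod z)\<^sup>2 + (exp t)\<^sup>2) / (2 * Im z * exp t) = cosh (s - t)"
      using cosh_hyp_dist[OF z, of "iaxis t"] that hyp_form_iaxis[OF z, of t] by simp
    hence "(cmod z)\<^sup>2 + (exp t)\<^sup>2 = 2 * Im z * exp t * cosh (s - t)"
      using hyp_planeD[OF z] by (simp add: field_simps)
    also have "\<dots> = Im z * (exp s + (exp t)\<^sup>2 * exp (- s))"
      by (simp add: cosh_real_eq exp_diff exp_minus field_simps power2_eq_square)
    finally show ?thesis .
  qed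
  have ne: "(exp s0)\<^sup>2 - (exp s1)\<^sup>2 \<noteq> 0"
    using assms(2) by (simp add: power2_eq_iff_nonneg)
  have "((exp s0)\<^sup>2 - (exp s1)\<^sup>2) = Im z * exp (- s) * ((exp s0)\<^sup>2 - (exp s1)\<^sup>2)"
    using *[OF assms(3)] *[OF assms(4)] by (simp add: algebra_simps)
  hence "Im z * exp (- s) = 1" using ne by simp
  hence y: "Im z = exp s" by (simp add: exp_minus field_simps)
  have "exp s * (exp s + (exp s0)\<^sup>2 * exp (- s)) = (exp s)\<^sup>2 + (exp s0)\<^sup>2"
    by (simp add: exp_minus field_simps power2_eq_square)
  hence "(cmod z)\<^sup>2 = (exp s)\<^sup>2"
    using *[OF assms(3)] unfolding y by simp
  hence "Re z = 0" using y unfolding cmod_power2 by simp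
  thus ?thesis using y by (simp add: complex_eq_iff)
qed

lemma motion_scale:
  assumes "r > 0"
  shows "\<exists>g. hyp_motion g \<and> (\<forall>z. g z = of_real r * z)"
proof (intro exI conjI allI)
  let ?s = "sqrt r"
  have s: "?s > 0" using assms by simp
  show "hyp_motion (mob ?s 0 0 (1 / ?s))" by (rule hyp_motionI) (use s in simp)
  show "mob ?s 0 0 (1 / ?s) z = of_real r * z" for z
  proof -
    have "complex_of_real ?s * complex_of_real ?s = of_real r"
      using assms by (simp flip: of_real_mult)
    thus ?thesis using s by (simp add: moebius_def mult.commute mult.left_commute)
  qed
qed

lemma motion_inversion: "\<exists>g. hyp_motion g \<and> (\<forall>z. g z = - 1 / z)"
  by (intro exI[of _ "mob 0 (-1) 1 0"] conjI hyp_motionI) (simp_all add: moebius_def)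

lemma iaxis_shift: "of_real (exp r) * iaxis s = iaxis (r + s)"
  by (simp add: iaxis_def exp_add complex_eq_iff)

lemma iaxis_inversion: "- 1 / iaxis s = iaxis (- s)"
proof -
  have "iaxis s \<noteq> 0" by (simp add: complex_eq_iff)
  moreover have "- 1 = iaxis (- s) * iaxis s" by (simp add: complex_eq_iff exp_minus)
  ultimately show ?thesis by (simp add: divide_eq_eq)
qed

lemma two_points_to_axis:
  assumes z: "z \<in> hyp_plane" and w: "w \<in> hyp_plane"
  shows "\<exists>h. hyp_motion h \<and> Re (h z) = 0 \<and> Re (h w) = 0"
proof -
  obtain \<alpha> \<beta> \<gamma> where f: "\<beta>\<^sup>2 - 4 * \<alpha> * \<gamma> > 0" "lform (\<alpha>, \<beta>, \<gamma>) z = 0" "lform (\<alpha>, \<beta>, \<gamma>) w = 0"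
  proof (cases "Re z = Re w")
    case True thus ?thesis by (intro that[of 1 0 "- Re z"]) auto
  next
    case False
    \<comment> \<open>Circle through both points with centre on the real line: \<open>b\<close> and
      \<open>g\<close> solve the two linear equations for a form with leading coefficient 1.\<close>
    define b where "b = - ((cmod z)\<^sup>2 - (cmod w)\<^sup>2) / (Re z - Re w)"
    define g where "g = - (cmod z)\<^sup>2 - b * Re z"
    have "b * (Re z - Re w) = - ((cmod z)\<^sup>2 - (cmod w)\<^sup>2)" using False by (simp add: b_def)
    hence "(cmod w)\<^sup>2 + b * Re w + g = 0" by (simp add: g_def algebra_simps)
    moreover have "b\<^sup>2 - 4 * g = (b + 2 * Re z)\<^sup>2 + 4 * (Im z)\<^sup>2"
      unfolding g_def cmod_power2 by (simp add: power2_eq_square algebra_simps)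
    moreover have "\<dots> > 0" using hyp_planeD[OF z] by (simp add: add_nonneg_pos)
    ultimately show ?thesis by (intro that[of b 1 g]) (auto simp: g_def)
  qed
  define n where "n = sqrt (\<beta>\<^sup>2 - 4 * \<alpha> * \<gamma>)"
  have n: "n > 0" "n * n = \<beta>\<^sup>2 - 4 * \<alpha> * \<gamma>" using f(1) by (simp_all add: n_def)
  have "linner (\<alpha> / n, \<beta> / n, \<gamma> / n) (\<alpha> / n, \<beta> / n, \<gamma> / n) = (\<beta>\<^sup>2 - 4 * \<alpha> * \<gamma>) / (n * n)"
    by (simp add: diff_divide_distrib power2_eq_square)
  also have "\<dots> = 1" using n by auto
  finally obtain h where h: "hyp_motion h"
    "\<forall>z \<in> hyp_plane. \<exists>c > 0. lform (\<alpha> / n, \<beta> / n, \<gamma> / n) z = c * Re (h z)"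
    using hyp_motion_of_lform by blast
  have "lform (\<alpha> / n, \<beta> / n, \<gamma> / n) y = lform (\<alpha>, \<beta>, \<gamma>) y / n" for y
    by (simp add: add_divide_distrib)
  hence "Re (h z) = 0" "Re (h w) = 0" using bspec[OF h(2) z] bspec[OF h(2) w] f by auto
  thus ?thesis using h(1) by blast
qed

text \<open>Two points of the curve are moved to the axis and their parameters matched by a
  translation, preceded by the inversion \<open>- 1 / z\<close> if the direction is wrong. Distances
  to these two points then determine every other point, so no differentiability is involved.\<close>

lemma isometric_curve_is_axis:
  assumes c: "\<And>s. s \<in> I \<Longrightarrow> c s \<in> hyp_plane"
    and d: "\<And>s s'. s \<in> I \<Longrightarrow> s' \<in> I \<Longrightarrow> hyp_dist (c s) (c s') = \<bar>s - s'\<bar>"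
    and I: "s0 \<in> I" "s1 \<in> I" "s0 \<noteq> s1"
  shows "\<exists>h. hyp_motion h \<and> (\<forall>s \<in> I. c s = h (iaxis s))"
proof -
  obtain h where h: "hyp_motion h" "Re (h (c s0)) = 0" "Re (h (c s1)) = 0"
    using two_points_to_axis[OF c[OF I(1)] c[OF I(2)]] by blast
  have hc: "h (c s) \<in> hyp_plane" if "s \<in> I" for s using motion_in_plane[OF h(1) c[OF that]] .
  define t0 where "t0 = ln (Im (h (c s0)))"
  define t1 where "t1 = ln (Im (h (c s1)))"
  have t: "h (c s0) = iaxis t0" "h (c s1) = iaxis t1"
    unfolding t0_def t1_def using iaxis_ln hc h I by blast+
  have "\<bar>t0 - t1\<bar> = \<bar>s0 - s1\<bar>"
    using hyp_dist_motion[OF h(1) c[OF I(1)] c[OF I(2)]] d[OF I(1,2)] unfolding t by simp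
  then obtain k where k: "hyp_motion k" "k (iaxis t0) = iaxis s0" "k (iaxis t1) = iaxis s1"
  proof -
    assume a: "\<bar>t0 - t1\<bar> = \<bar>s0 - s1\<bar>"
    assume r: "\<And>k. hyp_motion k \<Longrightarrow> k (iaxis t0) = iaxis s0 \<Longrightarrow> k (iaxis t1) = iaxis s1 \<Longrightarrow> thesis"
    consider "t0 - t1 = s0 - s1" | "t0 - t1 = s1 - s0" using a by linarith
    thus thesis
    proof cases
      case 1
      obtain g where g: "hyp_motion g" "\<forall>z. g z = of_real (exp (s0 - t0)) * z"
        using motion_scale[of "exp (s0 - t0)"] by auto
      show ?thesis by (rule r[OF g(1)]) (use g 1 in \<open>auto simp: iaxis_shift\<close>)
    next
      case 2
      obtain g where g: "hyp_motion g" "\<forall>z. g z = of_real (exp (s0 + t0)) * z"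
        using motion_scale[of "exp (s0 + t0)"] by auto
      obtain j where j: "hyp_motion j" "\<forall>z. j z = - 1 / z" using motion_inversion by blast
      obtain m where m: "hyp_motion m" "\<forall>z \<in> hyp_plane. m z = g (j z)"
        using motion_compose[OF g(1) j(1)] by blast
      have "m (iaxis s) = iaxis (s0 + t0 - s)" for s
      proof -
        have "m (iaxis s) = of_real (exp (s0 + t0)) * (- 1 / iaxis s)"
          using bspec[OF m(2), of "iaxis s"] g(2) j(2) by simp
        thus ?thesis unfolding iaxis_inversion iaxis_shift by simp
      qed
      thus ?thesis by (intro r[OF m(1)]) (use 2 in \<open>auto simp: algebra_simps\<close>)
    qed
  qed
  obtain m where m: "hyp_motion m" "\<forall>z \<in> hyp_plane. m z = k (h z)"
    using motion_compose[OF k(1) h(1)] by blast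
  obtain n where n: "hyp_motion n" "\<forall>z \<in> hyp_plane. n (m z) = z \<and> m (n z) = z"
    using motion_inverse[OF m(1)] by blast
  have e: "m (c s0) = iaxis s0" "m (c s1) = iaxis s1" using m(2) c I t k by auto
  have "c s = n (iaxis s)" if s: "s \<in> I" for s
  proof -
    have "m (c s) = iaxis s"
    proof (rule axis_point_unique[OF _ I(3)])
      show "m (c s) \<in> hyp_plane" using motion_in_plane[OF m(1) c[OF s]] .
      show "hyp_dist (m (c s)) (iaxis s0) = \<bar>s - s0\<bar>"
        using hyp_dist_motion[OF m(1) c[OF s] c[OF I(1)]] d[OF s I(1)] e by simp
      show "hyp_dist (m (c s)) (iaxis s1) = \<bar>s - s1\<bar>"
        using hyp_dist_motion[OF m(1) c[OF s] c[OF I(2)]] d[OF s I(2)] e by simp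
    qed
    thus ?thesis using n(2) c[OF s] by metis
  qed
  thus ?thesis using n(1) by blast
qed

text \<open>A geodesic that touches another one without crossing it coincides with it:
  \<open>\<alpha> * (exp s)\<^sup>2 + \<gamma>\<close> is monotone in \<open>s\<close>, so it can
  vanish at \<open>t\<close> without changing sign only if \<open>\<alpha> = 0\<close>.\<close>

lemma tangent_to_axis:
  assumes "hyp_motion h" "eventually (\<lambda>s. Re (h (iaxis s)) \<ge> 0) (nhds t)" "Re (h (iaxis t)) = 0"
    "z \<in> hyp_plane"
  shows "Re (h z) = 0 \<longleftrightarrow> Re z = 0"
proof -
  obtain \<alpha> \<beta> \<gamma> where f: "\<beta>\<^sup>2 = 1 + 4 * \<alpha> * \<gamma>"
    "\<forall>z \<in> hyp_plane. \<exists>c > 0. \<alpha> * (cmod z)\<^sup>2 + \<beta> * Re z + \<gamma> = c * Re (h z)"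
    using Re_motion_axis_forms[OF assms(1)] by blast
  have 0: "\<alpha> * (exp t)\<^sup>2 + \<gamma> = 0" using bspec[OF f(2), of "iaxis t"] assms(3) by auto
  have "eventually (\<lambda>s. \<alpha> * (exp s)\<^sup>2 + \<gamma> \<ge> 0) (nhds t)"
    using assms(2)
  proof eventually_elim
    case (elim s)
    thus ?case using bspec[OF f(2), of "iaxis s"] by (auto simp: zero_le_mult_iff)
  qed
  then obtain e where e: "e > 0" "\<forall>s. dist s t < e \<longrightarrow> \<alpha> * (exp s)\<^sup>2 + \<gamma> \<ge> 0"
    unfolding eventually_nhds_metric by blast
  have "\<alpha> * (exp (t + e/2))\<^sup>2 + \<gamma> \<ge> 0" "\<alpha> * (exp (t - e/2))\<^sup>2 + \<gamma> \<ge> 0"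
    using e by (auto simp: dist_real_def)
  hence "\<alpha> * ((exp (t + e/2))\<^sup>2 - (exp t)\<^sup>2) \<ge> 0" "\<alpha> * ((exp (t - e/2))\<^sup>2 - (exp t)\<^sup>2) \<ge> 0"
    using 0 by (simp_all add: algebra_simps)
  moreover have "(exp (t + e/2))\<^sup>2 > (exp t)\<^sup>2" "(exp (t - e/2))\<^sup>2 < (exp t)\<^sup>2"
    using e by (simp_all add: power_strict_mono)
  ultimately have "\<alpha> = 0" by (smt (verit) zero_le_mult_iff)
  moreover from this have "\<gamma> = 0" using 0 by simp
  ultimately show ?thesis using f(1) bspec[OF f(2) assms(4)] by auto
qed

section \<open>Germs of folded developments\<close>

text \<open>\<open>Re\<close> of a motion has no local minimum with value zero. Vertical
  displacements of the argument force \<open>\<alpha> = 0\<close>, horizontal ones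
  \<open>\<beta> = 0\<close>, against \<open>\<beta>\<^sup>2 = 1 + 4 * \<alpha> * \<gamma>\<close>.
  This separates interior points from boundary points.\<close>

lemma motion_Re_nonneg_interior:
  assumes "hyp_motion g" "z0 \<in> hyp_plane" "eventually (\<lambda>z. Re (g z) \<ge> 0) (nhds z0)"
  shows "Re (g z0) \<noteq> 0"
proof
  assume 0: "Re (g z0) = 0"
  obtain \<alpha> \<beta> \<gamma> where f: "\<beta>\<^sup>2 = 1 + 4 * \<alpha> * \<gamma>"
    "\<forall>z \<in> hyp_plane. \<exists>c > 0. \<alpha> * (cmod z)\<^sup>2 + \<beta> * Re z + \<gamma> = c * Re (g z)"
    using Re_motion_axis_forms[OF assms(1)] by blast
  define Q where "Q z = \<alpha> * (cmod z)\<^sup>2 + \<beta> * Re z + \<gamma>" for z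
  have "eventually (\<lambda>z. z \<in> hyp_plane) (nhds z0)"
    using open_hyp_plane assms(2) by (simp add: eventually_nhds_in_open)
  with assms(3) have "eventually (\<lambda>z. Q z \<ge> 0) (nhds z0)"
  proof eventually_elim
    case (elim z)
    thus ?case using f(2) unfolding Q_def by (metis less_imp_le mult_nonneg_nonneg)
  qed
  then obtain e where e: "e > 0" "\<And>z. dist z z0 < e \<Longrightarrow> Q z \<ge> 0"
    unfolding eventually_nhds_metric by blast
  have Q0: "Q z0 = 0" using f(2) 0 assms(2) unfolding Q_def by auto
  define d where "d = min (e / 2) (Im z0)"
  have d: "d > 0" "d < e" "d \<le> Im z0" using e hyp_planeD[OF assms(2)] by (auto simp: d_def)
  have y: "Q (Complex x y) = \<alpha> * (x\<^sup>2 + y\<^sup>2) + \<beta> * x + \<gamma>" for x y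
    by (simp add: Q_def cmod_power2)
  have near: "Q (Complex x y) \<ge> 0" if "\<bar>x - Re z0\<bar> + \<bar>y - Im z0\<bar> \<le> d" for x y
  proof (rule e(2))
    have "cmod (Complex x y - z0) \<le> \<bar>x - Re z0\<bar> + \<bar>y - Im z0\<bar>"
      using cmod_le[of "Complex x y - z0"] by simp
    thus "dist (Complex x y) z0 < e" using that d by (simp add: dist_norm)
  qed
  have 00: "\<alpha> * ((Re z0)\<^sup>2 + (Im z0)\<^sup>2) + \<beta> * Re z0 + \<gamma> = 0"
    using Q0 y[of "Re z0" "Im z0"] by simp
  have "Q (Complex (Re z0) (Im z0 + d)) \<ge> 0" "Q (Complex (Re z0) (Im z0 - d)) \<ge> 0"
    using d by (auto intro: near)
  hence "\<alpha> * ((Im z0 + d)\<^sup>2 - (Im z0)\<^sup>2) \<ge> 0" "\<alpha> * ((Im z0 - d)\<^sup>2 - (Im z0)\<^sup>2) \<ge> 0"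
    using 00 unfolding y by (auto simp: algebra_simps)
  moreover have "(Im z0 + d)\<^sup>2 > (Im z0)\<^sup>2" "(Im z0 - d)\<^sup>2 < (Im z0)\<^sup>2"
    using d by (auto intro!: power_strict_mono)
  ultimately have a: "\<alpha> = 0" by (smt (verit) zero_le_mult_iff)
  have "Q (Complex (Re z0 + d) (Im z0)) \<ge> 0" "Q (Complex (Re z0 - d) (Im z0)) \<ge> 0"
    using d by (auto intro: near)
  hence "\<beta> * d \<ge> 0" "\<beta> * d \<le> 0" using 00 unfolding y a by (auto simp: algebra_simps)
  hence "\<beta> * d = 0" by linarith
  hence "\<beta> = 0" using d by simp
  thus False using f(1) a by simp
qed

lemma mirror_iaxis [simp]: "mirror (iaxis s) = iaxis s"
  by (simp add: complex_eq_iff)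

text \<open>The situation of a coordinate change at a boundary point. Near that point the half-plane
  goes into itself, so by tangency the axis is preserved, and so is its right side; a motion
  preserving the axis commutes with the mirror because both sides of that identity agree on the
  axis. Continuation across the boundary thereby does not depend on the chart.\<close>

lemma boundary_motion_commutes_hfold:
  assumes "hyp_motion k" and e: "e > 0" "\<And>z. z \<in> hyp_half_plane \<Longrightarrow> dist z (iaxis t) < e \<Longrightarrow> Re (k z) \<ge> 0"
    and "Re (k (iaxis t)) = 0" and z: "z \<in> hyp_plane"
  shows "hfold (k z) = k (hfold z)"
proof -
  have ev: "eventually (\<lambda>s. Re (k (iaxis s)) \<ge> 0) (nhds t)"
  proof -
    have "eventually (\<lambda>z. dist z (iaxis t) < e) (nhds (iaxis t))"
      using e(1) by (auto simp: eventually_nhds_metric)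
    from eventually_iaxis[OF this] show ?thesis
      by eventually_elim (rule e(2), auto simp: hyp_half_plane_def)
  qed
  have zero: "Re (k w) = 0 \<longleftrightarrow> Re w = 0" if "w \<in> hyp_plane" for w
    using tangent_to_axis[OF assms(1) ev assms(4) that] .
  obtain \<alpha> \<beta> \<gamma> where f: "\<beta>\<^sup>2 = 1 + 4 * \<alpha> * \<gamma>"
    "\<forall>z \<in> hyp_plane. \<exists>c > 0. \<alpha> * (cmod z)\<^sup>2 + \<beta> * Re z + \<gamma> = c * Re (k z)"
    using Re_motion_axis_forms[OF assms(1)] by blast
  have "\<alpha> * x\<^sup>2 + 0 * x + \<gamma> = 0" if "x \<in> range exp" for x
  proof -
    obtain s where s: "x = exp s" using \<open>x \<in> range exp\<close> by (rule rangeE)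
    show ?thesis using bspec[OF f(2), of "iaxis s"] zero[of "iaxis s"] s by auto
  qed
  moreover have "infinite (range (exp :: real \<Rightarrow> real))" by (simp add: finite_image_iff inj_on_def infinite_UNIV_char_0)
  ultimately have ag: "\<alpha> = 0" "\<gamma> = 0" using quadratic_zero_infinite[of "range exp" \<alpha> 0 \<gamma>] by auto
  have scaled: "\<exists>c > 0. \<beta> * Re w = c * Re (k w)" if "w \<in> hyp_plane" for w
    using bspec[OF f(2) that] ag by simp
  have b: "\<beta> > 0"
  proof -
    \<comment> \<open>A point strictly to the right of the axis decides the sign of
      \<open>\<beta>\<close>.\<close>
    let ?w = "iaxis t + of_real (e / 2)"
    have w: "?w \<in> hyp_half_plane" "dist ?w (iaxis t) < e" "?w \<in> hyp_plane" "Re ?w > 0"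
      using e(1) by (auto simp: hyp_half_plane_def hyp_plane_def dist_norm)
    obtain c where "c > 0" "\<beta> * Re ?w = c * Re (k ?w)" using scaled[OF w(3)] by blast
    hence "\<beta> * Re ?w \<ge> 0" using e(2)[OF w(1,2)] by simp
    hence "\<beta> \<ge> 0" using w(4) by (simp add: zero_le_mult_iff)
    moreover have "\<beta> \<noteq> 0" using f(1) ag by auto
    ultimately show ?thesis by simp
  qed
  have pos: "Re (k w) \<ge> 0" if "w \<in> hyp_plane" "Re w \<ge> 0" for w
  proof -
    obtain c where "c > 0" "\<beta> * Re w = c * Re (k w)" using scaled[OF \<open>w \<in> hyp_plane\<close>] by blast
    moreover have "\<beta> * Re w \<ge> 0" using b that by simp
    ultimately show ?thesis by (simp add: zero_le_mult_iff)
  qed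
  obtain k' where k': "hyp_motion k'" "\<forall>z \<in> hyp_plane. k' z = mirror (k (mirror z))"
    using motion_conj_mirror[OF assms(1)] by blast
  have "k' (iaxis s) = k (iaxis s)" for s
    using bspec[OF k'(2), of "iaxis s"] zero[of "iaxis s"] by (simp add: complex_eq_iff)
  hence comm: "k w = mirror (k (mirror w))" if "w \<in> hyp_plane" for w
    using motion_eq_on_axis[OF k'(1) assms(1), of UNIV w] that k'(2) infinite_UNIV_char_0[where ?'a = real] by metis
  show ?thesis
  proof (cases "Re z \<ge> 0")
    case True thus ?thesis using pos[OF z] by (simp add: hfold_pos)
  next
    case False
    have "hfold (k z) = hfold (k (mirror z))" using comm[OF z] by (metis hfold_simps(3))
    also have "\<dots> = k (mirror z)" using pos[of "mirror z"] z False by (intro hfold_pos) auto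
    finally show ?thesis using False by (simp add: hfold_neg)
  qed
qed

text \<open>
  Folding the plane along the imaginary axis gives the half-plane of the charts, so that a map \<open>E\<close>
  represented by a folded motion continues across the boundary lines as by reflection.
\<close>

definition germ_rep :: "'a set \<Rightarrow> ('a \<Rightarrow> complex) \<Rightarrow> (complex \<Rightarrow> complex) \<Rightarrow> (complex \<Rightarrow> 'a) \<Rightarrow> complex \<Rightarrow> bool" where
  "germ_rep U \<phi> h E z \<longleftrightarrow> hyp_motion h \<and> eventually (\<lambda>w. E w \<in> U \<and> \<phi> (E w) = hfold (h w)) (nhds z)"

definition dev_at :: "'a chart set \<Rightarrow> (complex \<Rightarrow> 'a) \<Rightarrow> complex \<Rightarrow> bool" where
  "dev_at A E z \<longleftrightarrow> (\<exists>U \<phi> h. (U, \<phi>) \<in> A \<and> germ_rep U \<phi> h E z)"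

lemma germ_repD:
  assumes "germ_rep U \<phi> h E z"
  shows "hyp_motion h" "eventually (\<lambda>w. E w \<in> U \<and> \<phi> (E w) = hfold (h w)) (nhds z)"
    "E z \<in> U" "\<phi> (E z) = hfold (h z)"
  using assms eventually_nhds_x_imp_x unfolding germ_rep_def by fast+

lemma isCont_hfold_motion:
  assumes "hyp_motion h" "z \<in> hyp_plane"
  shows "isCont (\<lambda>w. hfold (h w)) z"
  using continuous_on_hfold[OF continuous_on_motion[OF assms(1)]] assms(2) open_hyp_plane
  by (simp add: continuous_on_eq_continuous_at)

lemma eventually_in_plane: "z \<in> hyp_plane \<Longrightarrow> eventually (\<lambda>w. w \<in> hyp_plane) (nhds z)"
  using open_hyp_plane by (simp add: eventually_nhds_in_open)

section \<open>Charts, boundary points and uniqueness of developments\<close>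

locale surface_atlas =
  fixes M :: "'a::t2_space set" and A :: "'a chart set"
  assumes atlas: "hyp_atlas M A"
begin

lemma chart_props:
  assumes "(U, \<phi>) \<in> A"
  shows "openin (top_of_set M) U" "\<phi> ` U \<subseteq> hyp_half_plane" "inj_on \<phi> U" "continuous_on U \<phi>"
    "openin (top_of_set hyp_half_plane) (\<phi> ` U)"
    "\<And>W. openin (top_of_set M) W \<Longrightarrow> openin (top_of_set hyp_half_plane) (\<phi> ` (U \<inter> W))"
proof -
  have c: "is_chart M (U, \<phi>)" using atlas assms unfolding hyp_atlas_def by blast
  show U: "openin (top_of_set M) U" and o: "openin (top_of_set hyp_half_plane) (\<phi> ` U)"
    using c by (auto simp: is_chart_def)
  show "\<phi> ` U \<subseteq> hyp_half_plane" using openin_imp_subset[OF o] .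
  obtain \<psi> where h: "homeomorphism U (\<phi> ` U) \<phi> \<psi>" using c by (auto simp: is_chart_def)
  show "continuous_on U \<phi>" using h by (rule homeomorphism_cont1)
  show "inj_on \<phi> U" using h by (metis homeomorphism_apply1 inj_onI)
  fix W assume W: "openin (top_of_set M) W"
  have "openin (top_of_set U) (U \<inter> W)"
    using W openin_imp_subset[OF U] by (metis inf_commute openin_subtopology_Int2 subtopology_subtopology inf.absorb_iff2)
  hence "openin (top_of_set (\<phi> ` U)) (\<phi> ` (U \<inter> W))" using h by (rule homeomorphism_imp_open_map[rotated])
  thus "openin (top_of_set hyp_half_plane) (\<phi> ` (U \<inter> W))" using o by (rule openin_trans)
qed

lemma chart_in_half:
  assumes "(U, \<phi>) \<in> A" "p \<in> U"
  shows "\<phi> p \<in> hyp_plane" "Re (\<phi> p) \<ge> 0" "p \<in> M"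
  using chart_props(2)[OF assms(1)] openin_imp_subset[OF chart_props(1)[OF assms(1)]] assms(2)
  by (auto simp: hyp_half_plane_def)

lemma chart_ball:
  assumes "(U, \<phi>) \<in> A" "openin (top_of_set M) W" "p \<in> U" "p \<in> W"
  obtains e where "e > 0" "ball (\<phi> p) e \<inter> hyp_half_plane \<subseteq> \<phi> ` (U \<inter> W)"
  using chart_props(6)[OF assms(1,2)] assms(3,4) unfolding openin_contains_ball by blast

lemma transition:
  assumes "(U, \<phi>) \<in> A" "(V, \<psi>) \<in> A" "p \<in> U" "p \<in> V"
  shows "\<exists>k W. hyp_motion k \<and> openin (top_of_set M) W \<and> p \<in> W \<and> W \<subseteq> U \<inter> V \<and>
    (\<forall>q \<in> W. \<psi> q = k (\<phi> q))"
proof -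
  have "charts_compatible M (U, \<phi>) (V, \<psi>)" using atlas assms unfolding hyp_atlas_def by blast
  thus ?thesis using assms(3,4) unfolding charts_compatible_def by blast
qed

text \<open>If \<open>p\<close> were interior in the second chart, the coordinate change would map a
  full neighbourhood into \<open>Re z \<ge> 0\<close> while reaching the value 0 at its
  centre.\<close>

lemma boundary_chart_independent:
  assumes "(U, \<phi>) \<in> A" "(V, \<psi>) \<in> A" "p \<in> U" "p \<in> V" "Re (\<phi> p) = 0"
  shows "Re (\<psi> p) = 0"
proof (rule ccontr)
  assume "Re (\<psi> p) \<noteq> 0"
  hence pos: "Re (\<psi> p) > 0" using chart_in_half[OF assms(2,4)] by simp
  obtain k W where k: "hyp_motion k" "openin (top_of_set M) W" "p \<in> W" "W \<subseteq> V \<inter> U"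
    "\<forall>q \<in> W. \<phi> q = k (\<psi> q)" using transition[OF assms(2,1,4,3)] by blast
  obtain e where e: "e > 0" "ball (\<psi> p) e \<inter> hyp_half_plane \<subseteq> \<psi> ` (V \<inter> W)"
    by (rule chart_ball[OF assms(2) k(2) assms(4) k(3)])
  have P: "\<psi> p \<in> hyp_plane" using chart_in_half[OF assms(2,4)] by simp
  have "Re (k (\<psi> p)) \<noteq> 0"
  proof (rule motion_Re_nonneg_interior[OF k(1) P])
    have "eventually (\<lambda>z. z \<in> ball (\<psi> p) e) (nhds (\<psi> p))" using e(1) by (intro eventually_nhds_in_open) auto
    moreover have "eventually (\<lambda>z. z \<in> {z. Re z > 0}) (nhds (\<psi> p))"
      using pos by (intro eventually_nhds_in_open open_halfspace_Re_gt) auto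
    ultimately show "eventually (\<lambda>z. Re (k z) \<ge> 0) (nhds (\<psi> p))" using eventually_in_plane[OF P]
    proof eventually_elim
      case (elim z)
      hence "z \<in> \<psi> ` (V \<inter> W)" using e(2) by (auto simp: hyp_half_plane_def)
      then obtain q where q: "q \<in> V" "q \<in> W" "z = \<psi> q" by blast
      hence "\<phi> q = k z" "q \<in> U" using k by auto
      thus ?case using chart_in_half(2)[OF assms(1)] by metis
    qed
  qed
  thus False using bspec[OF k(5,3)] assms(5) by simp
qed

lemma boundary_iff: "(U, \<phi>) \<in> A \<Longrightarrow> p \<in> U \<Longrightarrow> p \<in> hyp_boundary A \<longleftrightarrow> Re (\<phi> p) = 0"
  unfolding hyp_boundary_def using boundary_chart_independent by blast

text \<open>Continuity of \<open>E\<close> at \<open>z\<close> as a map into \<open>M\<close>; it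
  has to be read off from the chart, where the germ is a folded motion.\<close>

lemma germ_eventually_in:
  assumes "(U, \<phi>) \<in> A" "z \<in> hyp_plane" "germ_rep U \<phi> h E z" "openin (top_of_set M) W" "E z \<in> W"
  shows "eventually (\<lambda>w. E w \<in> W) (nhds z)"
proof -
  note g = germ_repD[OF assms(3)]
  obtain e where e: "e > 0" "ball (\<phi> (E z)) e \<inter> hyp_half_plane \<subseteq> \<phi> ` (U \<inter> W)"
    by (rule chart_ball[OF assms(1,4) g(3) assms(5)])
  have "eventually (\<lambda>v. v \<in> ball (\<phi> (E z)) e) (nhds (hfold (h z)))"
    using e(1) g(4) by (intro eventually_nhds_in_open) auto
  from eventually_nhds_isCont[OF isCont_hfold_motion[OF g(1) assms(2)] this]
  show ?thesis using g(2) eventually_in_plane[OF assms(2)]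
  proof eventually_elim
    case (elim w)
    have "hfold (h w) \<in> hyp_half_plane" using hfold_in_plane motion_in_plane[OF g(1)] elim by blast
    then obtain q where q: "q \<in> U" "q \<in> W" "hfold (h w) = \<phi> q" using e(2) elim by blast
    hence "E w = q" using elim chart_props(3)[OF assms(1)] by (auto dest: inj_onD)
    thus ?case using q by simp
  qed
qed

lemma dev_at_in:
  assumes "dev_at A E z" "z \<in> hyp_plane"
  shows "E z \<in> M" "openin (top_of_set M) W \<Longrightarrow> E z \<in> W \<Longrightarrow> eventually (\<lambda>w. E w \<in> W) (nhds z)"
proof -
  obtain U \<phi> h where U: "(U, \<phi>) \<in> A" "germ_rep U \<phi> h E z"
    using assms(1) unfolding dev_at_def by blast
  show "E z \<in> M" using chart_in_half(3)[OF U(1) germ_repD(3)[OF U(2)]] .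
  show "eventually (\<lambda>w. E w \<in> W) (nhds z)" if "openin (top_of_set M) W" "E z \<in> W"
    using germ_eventually_in[OF U(1) assms(2) U(2) that] .
qed

text \<open>To the right of the fold the coordinate change is composed with \<open>h\<close>
  directly; on the fold this still works because it commutes with \<open>hfold\<close>; to the left
  its conjugate by the mirror is used. The extra clause records that one map \<open>k\<close>
  changes both the charts and the motions, which is what transfers a lifted curve from chart to
  chart.\<close>

lemma chart_change:
  assumes "(U, \<phi>) \<in> A" "(V, \<psi>) \<in> A" "z \<in> hyp_plane" "germ_rep U \<phi> h E z" "E z \<in> V"
  shows "\<exists>h2. germ_rep V \<psi> h2 E z \<and> (Re (h z) \<ge> 0 \<longrightarrow>
    (\<exists>k W. openin (top_of_set M) W \<and> E z \<in> W \<and> W \<subseteq> U \<inter> V \<and> (\<forall>q \<in> W. \<psi> q = k (\<phi> q)) \<and>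
       (\<forall>w \<in> hyp_plane. h2 w = k (h w))))"
proof -
  note g = germ_repD[OF assms(4)]
  obtain k W where k: "hyp_motion k" "openin (top_of_set M) W" "E z \<in> W" "W \<subseteq> U \<inter> V"
    "\<forall>q \<in> W. \<psi> q = k (\<phi> q)" using transition[OF assms(1,2) g(3) assms(5)] by blast
  have hz: "h z \<in> hyp_plane" by (rule motion_in_plane[OF g(1) assms(3)])
  have ev: "eventually (\<lambda>w. E w \<in> W \<and> w \<in> hyp_plane \<and> \<psi> (E w) = k (hfold (h w)) \<and> Re (\<psi> (E w)) \<ge> 0) (nhds z)"
    using germ_eventually_in[OF assms(1,3,4) k(2,3)] g(2) eventually_in_plane[OF assms(3)]
  proof eventually_elim
    case (elim w)
    thus ?case using k(4,5) chart_in_half(2)[OF assms(2), of "E w"] by auto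
  qed
  obtain kh where kh: "hyp_motion kh" "\<forall>w \<in> hyp_plane. kh w = k (h w)"
    using motion_compose[OF k(1) g(1)] by blast
  show ?thesis
  proof (cases "Re (h z) \<ge> 0")
    case True
    have "eventually (\<lambda>w. hfold (k (h w)) = k (hfold (h w))) (nhds z)"
    proof (cases "Re (h z) = 0")
      case False
      from motion_Re_sign_locally[OF g(1) assms(3) this] ev show ?thesis
      proof eventually_elim
        case (elim w)
        hence "hfold (h w) = h w" using True by (intro hfold_pos) (auto simp: zero_less_mult_iff)
        thus ?case using elim hfold_pos[of "k (h w)"] by auto
      qed
    next
      case 0: True
      define t where "t = ln (Im (h z))"
      have t: "h z = iaxis t" unfolding t_def by (rule iaxis_ln[OF hz 0])
      have p: "\<phi> (E z) = iaxis t" using g(4) t by (simp add: hfold_pos)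
      obtain e where e: "e > 0" "ball (\<phi> (E z)) e \<inter> hyp_half_plane \<subseteq> \<phi> ` (U \<inter> W)"
        by (rule chart_ball[OF assms(1) k(2) g(3) k(3)])
      have "Re (k w) \<ge> 0" if "w \<in> hyp_half_plane" "dist w (iaxis t) < e" for w
      proof -
        have "w \<in> \<phi> ` (U \<inter> W)" using e(2) that p by (auto simp: dist_commute)
        then obtain q where "q \<in> W" "w = \<phi> q" by blast
        thus ?thesis using k(4,5) chart_in_half(2)[OF assms(2), of q] by auto
      qed
      moreover have "Re (k (iaxis t)) = 0"
        using boundary_chart_independent[OF assms(1,2) g(3) assms(5)] bspec[OF k(5,3)] p by simp
      ultimately have comm: "hfold (k w) = k (hfold w)" if "w \<in> hyp_plane" for w
        using boundary_motion_commutes_hfold[OF k(1) e(1)] that by blast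
      from ev show ?thesis
        by eventually_elim (use motion_in_plane[OF g(1)] comm in auto)
    qed
    with ev have "eventually (\<lambda>w. E w \<in> V \<and> \<psi> (E w) = hfold (kh w)) (nhds z)"
      by eventually_elim (use k(4) kh(2) in auto)
    hence "germ_rep V \<psi> kh E z" using kh by (simp add: germ_rep_def)
    thus ?thesis using k kh(2) by blast
  next
    case False
    obtain k' where k': "hyp_motion k'" "\<forall>z \<in> hyp_plane. k' z = mirror (k (mirror z))"
      using motion_conj_mirror[OF k(1)] by blast
    obtain m where m: "hyp_motion m" "\<forall>w \<in> hyp_plane. m w = k' (h w)"
      using motion_compose[OF k'(1) g(1)] by blast
    have "Re (h z) \<noteq> 0" using False by simp
    from motion_Re_sign_locally[OF g(1) assms(3) this] ev
    have "eventually (\<lambda>w. E w \<in> V \<and> \<psi> (E w) = hfold (m w)) (nhds z)"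
    proof eventually_elim
      case (elim w)
      have hw: "h w \<in> hyp_plane" using motion_in_plane[OF g(1)] elim by blast
      have "Re (h w) \<le> 0" using elim False by (auto simp: zero_less_mult_iff)
      have "m w = mirror (k (mirror (h w)))" using m(2) k'(2) hw elim by simp
      hence "hfold (m w) = hfold (k (mirror (h w)))" by simp
      also have "k (mirror (h w)) = \<psi> (E w)" using elim \<open>Re (h w) \<le> 0\<close> by (simp add: hfold_neg)
      finally show ?case using elim k(4) by (auto simp: hfold_pos)
    qed
    hence "germ_rep V \<psi> m E z" using m by (simp add: germ_rep_def)
    thus ?thesis using False by auto
  qed
qed

lemma dev_at_rep:
  assumes "dev_at A E z" "z \<in> hyp_plane" "(V, \<psi>) \<in> A" "E z \<in> V"
  shows "\<exists>h. germ_rep V \<psi> h E z"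
proof -
  obtain U \<phi> h where U: "(U, \<phi>) \<in> A" "germ_rep U \<phi> h E z"
    using assms(1) unfolding dev_at_def by blast
  show ?thesis using chart_change[OF U(1) assms(3,2) U(2) assms(4)] by blast
qed

text \<open>The assumption asks only for agreement arbitrarily close to \<open>z\<close>, not at
  \<open>z\<close>: this is the closedness half of the identity principle below. An open set of
  agreement determines the motion.\<close>

lemma germ_unique:
  assumes "(U, \<phi>) \<in> A" "z \<in> hyp_plane" "germ_rep U \<phi> h E z" "germ_rep U \<phi> h' E' z"
    and near: "\<And>N. open N \<Longrightarrow> z \<in> N \<Longrightarrow> \<exists>z' \<in> N. eventually (\<lambda>w. E w = E' w) (nhds z')"
  shows "\<And>w. w \<in> hyp_plane \<Longrightarrow> h w = h' w" "eventually (\<lambda>w. E w = E' w) (nhds z)"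
proof -
  note g = germ_repD[OF assms(3)] and g' = germ_repD[OF assms(4)]
  have "eventually (\<lambda>w. w \<in> hyp_plane \<and> (E w \<in> U \<and> \<phi> (E w) = hfold (h w)) \<and> E' w \<in> U \<and> \<phi> (E' w) = hfold (h' w)) (nhds z)"
    using g(2) g'(2) eventually_in_plane[OF assms(2)] by eventually_elim auto
  then obtain N where N: "open N" "z \<in> N" "\<forall>w \<in> N. w \<in> hyp_plane \<and> (E w \<in> U \<and> \<phi> (E w) = hfold (h w)) \<and> E' w \<in> U \<and> \<phi> (E' w) = hfold (h' w)"
    unfolding eventually_nhds by blast
  obtain z' where z': "z' \<in> N" "eventually (\<lambda>w. E w = E' w) (nhds z')" using near[OF N(1,2)] by blast
  then obtain N' where N': "open N'" "z' \<in> N'" "\<forall>w \<in> N'. E w = E' w" unfolding eventually_nhds by blast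
  show eq: "h w = h' w" if "w \<in> hyp_plane" for w
  proof (rule hfold_motion_eq[OF g(1) g'(1), of "N \<inter> N'"])
    show "open (N \<inter> N')" "N \<inter> N' \<noteq> {}" "N \<inter> N' \<subseteq> hyp_plane" using N N' z' by auto
    show "hfold (h y) = hfold (h' y)" if "y \<in> N \<inter> N'" for y
      using that N(3) N'(3) by (metis IntE)
  qed (rule that)
  show "eventually (\<lambda>w. E w = E' w) (nhds z)"
    unfolding eventually_nhds
  proof (intro exI[of _ N] conjI ballI N(1,2))
    fix w assume w: "w \<in> N"
    hence "\<phi> (E w) = \<phi> (E' w)" "E w \<in> U" "E' w \<in> U" using N(3) eq by auto
    thus "E w = E' w" using chart_props(3)[OF assms(1)] by (auto dest: inj_onD)
  qed
qed

text \<open>Identity principle for developments. \<open>S\<close> is where the germs agree and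
  \<open>T\<close> is the exterior of \<open>S\<close>. A point in neither is a limit of
  \<open>S\<close>, so the values agree there by the Hausdorff property, both germs are seen in one
  chart, and \<open>germ_unique\<close> puts the point into \<open>S\<close>.\<close>

lemma dev_identity:
  assumes "open W" "connected W" "W \<subseteq> hyp_plane"
    and dev: "\<And>z. z \<in> W \<Longrightarrow> dev_at A E z" "\<And>z. z \<in> W \<Longrightarrow> dev_at A E' z"
    and "z0 \<in> W" "eventually (\<lambda>w. E w = E' w) (nhds z0)" "z \<in> W"
  shows "eventually (\<lambda>w. E w = E' w) (nhds z)"
proof -
  define S where "S = {z. eventually (\<lambda>w. E w = E' w) (nhds z)}"
  define T where "T = {z. \<exists>N. open N \<and> z \<in> N \<and> N \<inter> S = {}}"
  have "open S" unfolding S_def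
    by (subst open_subopen) (force simp: eventually_nhds)
  moreover have "open T" unfolding T_def by (subst open_subopen) blast
  moreover have "S \<inter> T \<inter> W = {}" unfolding T_def by blast
  moreover have "W \<subseteq> S \<union> T"
  proof
    fix y assume y: "y \<in> W"
    show "y \<in> S \<union> T"
    proof (rule ccontr)
      assume n: "y \<notin> S \<union> T"
      hence near: "\<exists>z' \<in> N. eventually (\<lambda>w. E w = E' w) (nhds z')" if "open N" "y \<in> N" for N
        using that unfolding S_def T_def by blast
      have yH: "y \<in> hyp_plane" using y assms(3) by blast
      have "E y = E' y"
      proof (rule ccontr)
        assume "E y \<noteq> E' y"
        then obtain P Q where PQ: "open P" "open Q" "E y \<in> P" "E' y \<in> Q" "P \<inter> Q = {}"
          using hausdorff by metis
        have "eventually (\<lambda>w. E w \<in> M \<inter> P) (nhds y)"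
          using dev_at_in(1)[OF dev(1)[OF y] yH] PQ
          by (intro dev_at_in(2)[OF dev(1)[OF y] yH openin_open_Int]) auto
        moreover have "eventually (\<lambda>w. E' w \<in> M \<inter> Q) (nhds y)"
          using dev_at_in(1)[OF dev(2)[OF y] yH] PQ
          by (intro dev_at_in(2)[OF dev(2)[OF y] yH openin_open_Int]) auto
        ultimately have "eventually (\<lambda>w. E w \<in> P \<and> E' w \<in> Q) (nhds y)" by eventually_elim auto
        then obtain N where N: "open N" "y \<in> N" "\<forall>w \<in> N. E w \<in> P \<and> E' w \<in> Q" unfolding eventually_nhds by blast
        obtain z' where "z' \<in> N" "eventually (\<lambda>w. E w = E' w) (nhds z')" using near[OF N(1,2)] by blast
        hence "z' \<in> N" "E z' = E' z'" by (auto dest: eventually_nhds_x_imp_x)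
        thus False using N(3) PQ(5) by auto
      qed
      moreover obtain U \<phi> h where U: "(U, \<phi>) \<in> A" "germ_rep U \<phi> h E y" using dev(1)[OF y] unfolding dev_at_def by blast
      ultimately obtain h' where "germ_rep U \<phi> h' E' y"
        using dev_at_rep[OF dev(2)[OF y] yH U(1)] germ_repD(3)[OF U(2)] by auto
      from germ_unique(2)[OF U(1) yH U(2) this near] n show False unfolding S_def by auto
    qed
  qed
  ultimately have "S \<inter> W = {} \<or> T \<inter> W = {}" by (intro connectedD[OF assms(2)]) auto
  moreover have "z0 \<in> S" using assms(7) by (simp add: S_def)
  ultimately have "T \<inter> W = {}" using assms(6) by blast
  thus ?thesis using \<open>W \<subseteq> S \<union> T\<close> assms(8) unfolding S_def by blast
qed


text \<open>The only source of developments: a motion, followed by the fold and an inverse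
  chart.\<close>

lemma germ_rep_inv_into:
  assumes "hyp_motion h" "z \<in> hyp_plane" "open B" "h z \<in> B"
    and "\<And>v. v \<in> B \<Longrightarrow> v \<in> hyp_plane \<Longrightarrow> hfold v \<in> \<phi> ` U"
  shows "germ_rep U \<phi> h (\<lambda>w. inv_into U \<phi> (hfold (h w))) z"
proof -
  have "eventually (\<lambda>v. v \<in> B) (nhds (h z))" using assms by (intro eventually_nhds_in_open)
  from eventually_nhds_isCont[OF isCont_motion[OF assms(1,2)] this] eventually_in_plane[OF assms(2)]
  have "eventually (\<lambda>w. inv_into U \<phi> (hfold (h w)) \<in> U \<and> \<phi> (inv_into U \<phi> (hfold (h w))) = hfold (h w)) (nhds z)"
  proof eventually_elim
    case (elim w)
    hence "hfold (h w) \<in> \<phi> ` U" using assms(5) motion_in_plane[OF assms(1)] by blast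
    thus ?case by (simp add: inv_into_into f_inv_into_f)
  qed
  thus ?thesis using assms(1) by (simp add: germ_rep_def)
qed

definition germ_extends :: "(complex \<Rightarrow> 'a) \<Rightarrow> complex \<Rightarrow> complex set \<Rightarrow> bool" where
  "germ_extends E z S \<longleftrightarrow> (\<exists>E'. (\<forall>w \<in> S. dev_at A E' w) \<and> eventually (\<lambda>w. E w = E' w) (nhds z))"

text \<open>\<open>N\<close> and \<open>\<kappa>\<close> depend on \<open>p\<close> alone, not on
  \<open>E\<close> or \<open>z\<close>, so that compactness can make them uniform. The second
  property is a substitute for the lifting of paths: near any point over \<open>N\<close>, a global
  development takes every value in \<open>N\<close>, within a bounded hyperbolic distance.\<close>

lemma local_extension:
  assumes p: "p \<in> M"
  shows "\<exists>N \<kappa>. openin (top_of_set M) N \<and> p \<in> N \<and> 0 < \<kappa> \<and> \<kappa> \<le> 1/2 \<and>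
    (\<forall>E z. z \<in> hyp_plane \<longrightarrow> dev_at A E z \<longrightarrow> E z \<in> N \<longrightarrow>
      germ_extends E z (ball z (\<kappa> * Im z))) \<and>
    (\<forall>E z. z \<in> hyp_plane \<longrightarrow> (\<forall>w \<in> hyp_plane. dev_at A E w) \<longrightarrow> E z \<in> N \<longrightarrow>
      (\<forall>q \<in> N. \<exists>z' \<in> hyp_plane. E z' = q \<and> cmod (z' - z) \<le> Im z / 2))"
proof -
  obtain U \<phi> where U: "(U, \<phi>) \<in> A" "p \<in> U" using atlas p unfolding hyp_atlas_def by blast
  note cp = chart_props[OF U(1)]
  have ip: "Im (\<phi> p) > 0" using chart_in_half(1)[OF U] by (rule hyp_planeD)
  obtain e where e: "e > 0" "ball (\<phi> p) e \<inter> hyp_half_plane \<subseteq> \<phi> ` U"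
    using chart_ball[OF U(1) cp(1) U(2) U(2)] by auto
  \<comment> \<open>Of the radius \<open>3 * \<delta>\<close> inside the chart,
    \<open>\<delta>\<close> is spent on the distance of \<open>\<phi> (E z)\<close> from
    \<open>\<phi> p\<close> and \<open>2 * \<delta>\<close> on a disc around \<open>h z\<close>. The
    32 makes \<open>2 * \<delta>\<close> less than an eighth of the height of \<open>h z\<close>, so
    that \<open>motion_ball\<close> applied to the inverse motion gives
    \<open>Im z / 2\<close>.\<close>
  define \<delta> where "\<delta> = min (e / 3) (Im (\<phi> p) / 32)"
  have d: "\<delta> > 0" "3 * \<delta> \<le> e" "32 * \<delta> \<le> Im (\<phi> p)" using e ip by (auto simp: \<delta>_def)
  define N where "N = U \<inter> \<phi> -` ball (\<phi> p) \<delta>"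
  \<comment> \<open>Chosen so that the radius \<open>4 * \<kappa> * Im (h z)\<close> of
    \<open>motion_ball\<close> is at most \<open>2 * \<delta>\<close>.\<close>
  define \<kappa> where "\<kappa> = min (1/2) (\<delta> / (2 * (Im (\<phi> p) + \<delta>)))"
  have k: "0 < \<kappa>" "\<kappa> \<le> 1/2" "4 * \<kappa> * (Im (\<phi> p) + \<delta>) \<le> 2 * \<delta>"
  proof -
    show "0 < \<kappa>" "\<kappa> \<le> 1/2" using d ip by (auto simp: \<kappa>_def)
    have "\<kappa> \<le> \<delta> / (2 * (Im (\<phi> p) + \<delta>))" by (simp add: \<kappa>_def)
    thus "4 * \<kappa> * (Im (\<phi> p) + \<delta>) \<le> 2 * \<delta>" using d ip by (simp add: pos_le_divide_eq distrib_left)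
  qed
  have "openin (top_of_set U) N" unfolding N_def by (rule continuous_openin_preimage_gen[OF cp(4)]) simp
  hence N: "openin (top_of_set M) N" using cp(1) by (rule openin_trans)
  have pN: "p \<in> N" using U d by (simp add: N_def)
  have chart: "\<exists>h. germ_rep U \<phi> h E z \<and> (\<forall>v \<in> ball (h z) (2 * \<delta>). v \<in> hyp_plane \<longrightarrow> hfold v \<in> \<phi> ` U) \<and>
      \<bar>Im (h z) - Im (\<phi> p)\<bar> < \<delta>"
    if z: "z \<in> hyp_plane" and E: "dev_at A E z" and EN: "E z \<in> N" for E z
  proof -
    have EU: "E z \<in> U" "dist (\<phi> p) (\<phi> (E z)) < \<delta>" using EN by (auto simp: N_def)
    obtain h where h: "germ_rep U \<phi> h E z" using dev_at_rep[OF E z U(1) EU(1)] by blast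
    have "hfold v \<in> \<phi> ` U" if v: "v \<in> ball (h z) (2 * \<delta>)" "v \<in> hyp_plane" for v
    proof -
      have "dist (\<phi> (E z)) (hfold v) < 2 * \<delta>"
        using dist_hfold[of "h z" v] germ_repD(4)[OF h] v by simp
      hence "dist (\<phi> p) (hfold v) < e"
        using EU d dist_triangle[of "\<phi> p" "hfold v" "\<phi> (E z)"] by linarith
      thus ?thesis using e(2) hfold_in_plane[OF v(2)] by auto
    qed
    moreover have "Im (h z) = Im (\<phi> (E z))" using germ_repD(4)[OF h] by simp
    hence "\<bar>Im (h z) - Im (\<phi> p)\<bar> < \<delta>"
      using EU(2) abs_Im_le_cmod[of "\<phi> (E z) - \<phi> p"] by (simp add: dist_norm norm_minus_commute)
    ultimately show ?thesis using h by blast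
  qed
  have ext: "\<exists>E'. (\<forall>w \<in> hyp_plane. h w \<in> ball (h z) (2 * \<delta>) \<longrightarrow> dev_at A E' w) \<and>
      eventually (\<lambda>w. E w = E' w) (nhds z) \<and> (\<forall>w. E' w = inv_into U \<phi> (hfold (h w)))"
    if z: "z \<in> hyp_plane" and h: "germ_rep U \<phi> h E z" and
      B: "\<forall>v \<in> ball (h z) (2 * \<delta>). v \<in> hyp_plane \<longrightarrow> hfold v \<in> \<phi> ` U" for E z h
  proof (intro exI[of _ "\<lambda>w. inv_into U \<phi> (hfold (h w))"] conjI ballI impI)
    fix w assume "w \<in> hyp_plane" "h w \<in> ball (h z) (2 * \<delta>)"
    hence "germ_rep U \<phi> h (\<lambda>w. inv_into U \<phi> (hfold (h w))) w"
      using B by (intro germ_rep_inv_into[OF germ_repD(1)[OF h], where B = "ball (h z) (2 * \<delta>)"]) auto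
    thus "dev_at A (\<lambda>w. inv_into U \<phi> (hfold (h w))) w" using U(1) unfolding dev_at_def by blast
  next
    show "eventually (\<lambda>w. E w = inv_into U \<phi> (hfold (h w))) (nhds z)"
      using germ_repD(2)[OF h] by eventually_elim (use cp(3) in \<open>metis inv_into_f_f\<close>)
  qed auto
  have c1: "germ_extends E z (ball z (\<kappa> * Im z))"
    if z: "z \<in> hyp_plane" and E: "dev_at A E z" and EN: "E z \<in> N" for E z
  proof -
    obtain h where h: "germ_rep U \<phi> h E z" "\<forall>v \<in> ball (h z) (2 * \<delta>). v \<in> hyp_plane \<longrightarrow> hfold v \<in> \<phi> ` U"
      "\<bar>Im (h z) - Im (\<phi> p)\<bar> < \<delta>" using chart[OF z E EN] by blast
    obtain E' where E': "\<forall>w \<in> hyp_plane. h w \<in> ball (h z) (2 * \<delta>) \<longrightarrow> dev_at A E' w"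
      "eventually (\<lambda>w. E w = E' w) (nhds z)" using ext[OF z h(1,2)] by blast
    have "dev_at A E' w" if w: "w \<in> ball z (\<kappa> * Im z)" for w
    proof -
      note m = motion_ball[OF germ_repD(1)[OF h(1)] z w k(2)]
      have "4 * \<kappa> * Im (h z) \<le> 4 * \<kappa> * (Im (\<phi> p) + \<delta>)"
        using h(3) k(1) by (intro mult_left_mono) auto
      hence "cmod (h w - h z) < 2 * \<delta>" using m(2) k(3) by linarith
      thus ?thesis using E'(1) m(1) by (simp add: dist_norm norm_minus_commute)
    qed
    thus ?thesis using E'(2) unfolding germ_extends_def by blast
  qed
  have c2: "\<exists>z' \<in> hyp_plane. E z' = q \<and> cmod (z' - z) \<le> Im z / 2"
    if z: "z \<in> hyp_plane" and E: "\<forall>w \<in> hyp_plane. dev_at A E w" and EN: "E z \<in> N" and q: "q \<in> N" for E z q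
  proof -
    obtain h where h: "germ_rep U \<phi> h E z" "\<forall>v \<in> ball (h z) (2 * \<delta>). v \<in> hyp_plane \<longrightarrow> hfold v \<in> \<phi> ` U"
      "\<bar>Im (h z) - Im (\<phi> p)\<bar> < \<delta>" using chart[OF z bspec[OF E z] EN] by blast
    obtain E' where E': "\<forall>w \<in> hyp_plane. h w \<in> ball (h z) (2 * \<delta>) \<longrightarrow> dev_at A E' w"
      "eventually (\<lambda>w. E w = E' w) (nhds z)" "\<forall>w. E' w = inv_into U \<phi> (hfold (h w))"
      using ext[OF z h(1,2)] by blast
    have hm: "hyp_motion h" using germ_repD(1)[OF h(1)] .
    obtain h' where h': "hyp_motion h'" "\<forall>z \<in> hyp_plane. h' (h z) = z \<and> h (h' z) = z"
      using motion_inverse[OF hm] by blast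
    have hz: "h z \<in> hyp_plane" using motion_in_plane[OF hm z] .
    have ih: "Im (h z) > 31 * \<delta>" using h(3) d by auto
    have sub: "ball (h z) (2 * \<delta>) \<subseteq> hyp_plane"
    proof
      fix v assume "v \<in> ball (h z) (2 * \<delta>)"
      hence "\<bar>Im (h z - v)\<bar> < 2 * \<delta>" using abs_Im_le_cmod[of "h z - v"] by (simp add: dist_norm)
      thus "v \<in> hyp_plane" using ih d(1) by (auto simp: hyp_plane_def)
    qed
    \<comment> \<open>Connected open preimage of the disc; on it the given \<open>E\<close> must
      coincide with the explicit extension \<open>E'\<close>.\<close>
    define G where "G = h' ` ball (h z) (2 * \<delta>)"
    have Gin: "w \<in> G \<longleftrightarrow> w \<in> hyp_plane \<and> h w \<in> ball (h z) (2 * \<delta>)" for w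
    proof
      assume "w \<in> G"
      then obtain v where v: "v \<in> ball (h z) (2 * \<delta>)" "w = h' v" unfolding G_def by blast
      have "v \<in> hyp_plane" using v(1) sub by blast
      thus "w \<in> hyp_plane \<and> h w \<in> ball (h z) (2 * \<delta>)"
        using v h'(2) motion_in_plane[OF h'(1)] by auto
    next
      assume "w \<in> hyp_plane \<and> h w \<in> ball (h z) (2 * \<delta>)"
      thus "w \<in> G" unfolding G_def using h'(2) by (intro image_eqI[of _ _ "h w"]) auto
    qed
    have "open (hyp_plane \<inter> h -` ball (h z) (2 * \<delta>))"
      by (rule continuous_open_preimage[OF continuous_on_motion[OF hm] open_hyp_plane]) simp
    moreover have "G = hyp_plane \<inter> h -` ball (h z) (2 * \<delta>)" using Gin by blast
    ultimately have "open G" by simp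
    have "connected G" unfolding G_def
      by (rule connected_continuous_image[OF continuous_on_subset[OF continuous_on_motion[OF h'(1)] sub]]) simp
    have zG: "z \<in> G" using Gin z d by auto
    have same: "E w = E' w" if "w \<in> G" for w
    proof -
      have "eventually (\<lambda>w. E w = E' w) (nhds w)"
        by (rule dev_identity[OF \<open>open G\<close> \<open>connected G\<close> _ _ _ zG E'(2) that]) (use E E'(1) Gin in auto)
      thus ?thesis by (rule eventually_nhds_x_imp_x)
    qed
    \<comment> \<open>Of the two points that fold to \<open>\<phi> q\<close>, the one on the same
      side as \<open>h z\<close>, so that its distance to \<open>h z\<close> is the distance in the
      chart.\<close>
    define v where "v = (if Re (h z) \<ge> 0 then \<phi> q else mirror (\<phi> q))"
    have qU: "q \<in> U" "dist (\<phi> p) (\<phi> q) < \<delta>" "E z \<in> U" "dist (\<phi> p) (\<phi> (E z)) < \<delta>"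
      using q EN by (auto simp: N_def)
    have qh: "\<phi> q \<in> hyp_plane" "Re (\<phi> q) \<ge> 0" using chart_in_half[OF U(1) qU(1)] by auto
    have fv: "hfold v = \<phi> q" and vH: "v \<in> hyp_plane" using qh by (auto simp: v_def hfold_pos)
    have "dist (h z) v = dist (\<phi> (E z)) (\<phi> q)"
    proof (cases "Re (h z) \<ge> 0")
      case True thus ?thesis using germ_repD(4)[OF h(1)] by (simp add: v_def hfold_pos)
    next
      case False
      have "dist (mirror a) (mirror b) = dist a b" for a b :: complex
        by (simp add: dist_norm cmod_def power2_commute)
      hence "dist (mirror (h z)) (mirror v) = dist (h z) v" .
      thus ?thesis using False germ_repD(4)[OF h(1)] by (simp add: v_def hfold_neg)
    qed
    also have "\<dots> < 2 * \<delta>" using qU dist_triangle3[of "\<phi> (E z)" "\<phi> q" "\<phi> p"] by linarith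
    finally have dv: "dist (h z) v < 2 * \<delta>" .
    define z' where "z' = h' v"
    have z': "z' \<in> hyp_plane" "h z' = v" using h'(2) vH motion_in_plane[OF h'(1)] by (auto simp: z'_def)
    have "z' \<in> G" using Gin z' dv by auto
    hence "E z' = inv_into U \<phi> (\<phi> q)" using same E'(3) z' fv by auto
    also have "\<dots> = q" using cp(3) qU(1) by simp
    finally have "E z' = q" .
    moreover have "cmod (z' - z) \<le> Im z / 2"
    proof -
      have "v \<in> ball (h z) (1/8 * Im (h z))" using dv ih d(1) by auto
      from motion_ball(2)[OF h'(1) hz this] have "cmod (h' v - h' (h z)) < 4 * (1/8) * Im (h' (h z))" by simp
      thus ?thesis using h'(2) z by (simp add: z'_def)
    qed
    ultimately show ?thesis using z'(1) by blast
  qed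
  show ?thesis
    by (intro exI[of _ N] exI[of _ \<kappa>] conjI allI impI ballI) (fact N pN k(1) k(2) c1 c2)+
qed

section \<open>Extension to the whole plane\<close>


lemma compact_finite_subcover_openin:
  assumes "compact M" "\<And>p. p \<in> M \<Longrightarrow> openin (top_of_set M) (N p) \<and> p \<in> N p"
  obtains F where "finite F" "F \<subseteq> M" "M \<subseteq> (\<Union>p \<in> F. N p)"
proof -
  have "\<forall>p \<in> M. \<exists>T. open T \<and> N p = M \<inter> T" using assms(2) by (auto simp: openin_open)
  then obtain T where T: "\<And>p. p \<in> M \<Longrightarrow> open (T p) \<and> N p = M \<inter> T p" by metis
  have "M \<subseteq> (\<Union>p \<in> M. T p)" using T assms(2) by blast
  then obtain F where "F \<subseteq> M" "finite F" "M \<subseteq> (\<Union>p \<in> F. T p)"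
    using compactE_image[OF assms(1), of M T] T by blast
  moreover from this have "M \<subseteq> (\<Union>p \<in> F. N p)" using T by blast
  ultimately show ?thesis using that by blast
qed

lemma uniform_extension:
  assumes "compact M"
  shows "\<exists>\<kappa>. 0 < \<kappa> \<and> \<kappa> \<le> 1/2 \<and> (\<forall>E z. z \<in> hyp_plane \<longrightarrow> dev_at A E z \<longrightarrow>
    germ_extends E z (ball z (\<kappa> * Im z)))"
proof -
  define P where "P N \<kappa> \<longleftrightarrow> openin (top_of_set M) N \<and> 0 < \<kappa> \<and> \<kappa> \<le> 1/2 \<and>
    (\<forall>E z. z \<in> hyp_plane \<longrightarrow> dev_at A E z \<longrightarrow> E z \<in> N \<longrightarrow>
      germ_extends E z (ball z (\<kappa> * Im z)))" for N \<kappa>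
  have "\<exists>N \<kappa>. p \<in> N \<and> P N \<kappa>" if "p \<in> M" for p
    using local_extension[OF that] unfolding P_def
    by (elim exE conjE) (intro exI conjI, assumption+)
  then obtain N \<kappa> where NP: "\<And>p. p \<in> M \<Longrightarrow> p \<in> N p \<and> P (N p) (\<kappa> p)" by metis
  have N: "\<And>p. p \<in> M \<Longrightarrow> openin (top_of_set M) (N p) \<and> p \<in> N p"
    and k: "\<And>p. p \<in> M \<Longrightarrow> 0 < \<kappa> p \<and> \<kappa> p \<le> 1/2"
    using NP unfolding P_def by auto
  have ext: "germ_extends E z (ball z (\<kappa> p * Im z))"
    if "p \<in> M" "z \<in> hyp_plane" "dev_at A E z" "E z \<in> N p" for p E z
    using conjunct2[OF NP[OF that(1)]] that(2,3,4) unfolding P_def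
    by (elim conjE allE[of _ E] allE[of _ z]) simp
  obtain F where F: "finite F" "F \<subseteq> M" "M \<subseteq> (\<Union>p \<in> F. N p)"
    using compact_finite_subcover_openin[OF assms N] by blast
  define k0 where "k0 = Min (insert (1/2) (\<kappa> ` F))"
  have fin: "finite (insert (1/2) (\<kappa> ` F))" using F(1) by simp
  have k0: "0 < k0" using k F(2) unfolding k0_def by (subst Min_gr_iff[OF fin]) auto
  have k0': "k0 \<le> 1/2" "\<And>p. p \<in> F \<Longrightarrow> k0 \<le> \<kappa> p" unfolding k0_def by (rule Min_le[OF fin], simp)+
  show ?thesis
  proof (intro exI[of _ k0] conjI allI impI k0 k0'(1))
    fix E z assume z: "z \<in> hyp_plane" and E: "dev_at A E z"
    obtain p where p: "p \<in> F" "E z \<in> N p" using F(3) dev_at_in(1)[OF E z] by blast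
    obtain E' where E': "\<forall>w \<in> ball z (\<kappa> p * Im z). dev_at A E' w" "eventually (\<lambda>w. E w = E' w) (nhds z)"
      using ext[OF _ z E p(2)] p F(2) unfolding germ_extends_def by blast
    have "ball z (k0 * Im z) \<subseteq> ball z (\<kappa> p * Im z)"
      using k0'(2)[OF p(1)] hyp_planeD[OF z] by (intro subset_ball mult_right_mono) auto
    thus "germ_extends E z (ball z (k0 * Im z))"
      using E' unfolding germ_extends_def by blast
  qed
qed

text \<open>
  The ratio \<open>\<bar>Re z\<bar> / Im z\<close> measures the distance to the imaginary axis. Whether it is bounded on
  the fibre over a point is locally constant; a fibre inside the axis would make it bounded on
  every fibre, and by compactness on the whole plane.
\<close>

lemma fibre_not_in_axis:
  assumes "compact M" "connected M" and dev: "\<And>z. z \<in> hyp_plane \<Longrightarrow> dev_at A E z" and "b \<in> M"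
  shows "\<exists>z \<in> hyp_plane. E z = b \<and> Re z \<noteq> 0"
proof (rule ccontr)
  assume "\<not> ?thesis"
  hence b: "\<forall>z \<in> hyp_plane. E z = b \<longrightarrow> Re z = 0" by blast
  define R where "R N \<longleftrightarrow> (\<forall>z. z \<in> hyp_plane \<longrightarrow> (\<forall>w \<in> hyp_plane. dev_at A E w) \<longrightarrow> E z \<in> N \<longrightarrow>
      (\<forall>q \<in> N. \<exists>z' \<in> hyp_plane. E z' = q \<and> cmod (z' - z) \<le> Im z / 2))" for N
  have "\<exists>N. openin (top_of_set M) N \<and> p \<in> N \<and> R N" if "p \<in> M" for p
    using local_extension[OF that] unfolding R_def
    by (elim exE conjE) (intro exI conjI, assumption+, erule allE[of _ E])
  then obtain N where NR: "\<And>p. p \<in> M \<Longrightarrow> openin (top_of_set M) (N p) \<and> p \<in> N p \<and> R (N p)" by metis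
  hence N: "\<And>p. p \<in> M \<Longrightarrow> openin (top_of_set M) (N p) \<and> p \<in> N p" by blast
  have near: "\<exists>z' \<in> hyp_plane. E z' = q \<and> cmod (z' - z) \<le> Im z / 2"
    if "p \<in> M" "z \<in> hyp_plane" "E z \<in> N p" "q \<in> N p" for p z q
  proof -
    have "R (N p)" using NR[OF that(1)] by blast
    thus ?thesis using that(2,3,4) dev unfolding R_def by simp
  qed
  define G where "G q C \<longleftrightarrow> C \<ge> 0 \<and> (\<forall>z \<in> hyp_plane. E z = q \<longrightarrow> \<bar>Re z\<bar> \<le> C * Im z)" for q and C :: real
  \<comment> \<open>The nearby point over \<open>q\<close> has height at most
    \<open>3/2 * Im z\<close> and its real part differs by at most \<open>Im z / 2\<close>; the
    constants 3/2 and 1/2 are rounded up to 2 and 1.\<close>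
  have G: "G q' (2 * C + 1)" if p: "p \<in> M" "q \<in> N p" "q' \<in> N p" and g: "G q C" for p q q' C
    unfolding G_def
  proof (intro conjI ballI impI)
    show "2 * C + 1 \<ge> 0" using g by (simp add: G_def)
    fix z assume z: "z \<in> hyp_plane" "E z = q'"
    have i: "Im z > 0" using z(1) by (rule hyp_planeD)
    obtain z' where z': "z' \<in> hyp_plane" "E z' = q" "cmod (z' - z) \<le> Im z / 2"
      using near[OF p(1) z(1)] z(2) p by blast
    have "\<bar>Re z'\<bar> \<le> C * Im z'" "C \<ge> 0" using g z' by (auto simp: G_def)
    moreover have "Im z' \<le> 3/2 * Im z" "\<bar>Re z\<bar> \<le> \<bar>Re z'\<bar> + Im z / 2"
      using abs_Im_le_cmod[of "z' - z"] abs_Re_le_cmod[of "z' - z"] z'(3) by auto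
    moreover from this have "C * Im z' \<le> C * (2 * Im z)" using \<open>C \<ge> 0\<close> i by (intro mult_left_mono) auto
    ultimately have "\<bar>Re z\<bar> \<le> C * (2 * Im z) + Im z / 2" by linarith
    thus "\<bar>Re z\<bar> \<le> (2 * C + 1) * Im z" using i by (simp add: algebra_simps)
  qed
  define S where "S = {p \<in> M. \<exists>C. G p C}"
  have "openin (top_of_set M) S"
  proof (subst openin_subopen, rule ballI)
    fix p assume p: "p \<in> S"
    hence "N p \<subseteq> M" using openin_imp_subset N[of p] unfolding S_def by blast
    hence "N p \<subseteq> S" using p G[of p p] N[of p] unfolding S_def by blast
    thus "\<exists>T. openin (top_of_set M) T \<and> p \<in> T \<and> T \<subseteq> S" using N[of p] p unfolding S_def by blast
  qed
  moreover have "openin (top_of_set M) (M - S)"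
  proof (subst openin_subopen, rule ballI)
    fix p assume p: "p \<in> M - S"
    hence "N p \<subseteq> M" using openin_imp_subset N[of p] by blast
    hence "N p \<subseteq> M - S" using p G[of p _ p] N[of p] unfolding S_def by blast
    thus "\<exists>T. openin (top_of_set M) T \<and> p \<in> T \<and> T \<subseteq> M - S" using N[of p] p by blast
  qed
  hence "closedin (top_of_set M) S" by (simp add: closedin_def S_def)
  moreover have "b \<in> S" using b assms(4) unfolding S_def G_def by (auto intro!: exI[of _ 0])
  ultimately have "S = M" using assms(2) by (auto simp: connected_clopen)
  hence "\<forall>p \<in> M. \<exists>C. G p C" unfolding S_def by blast
  then obtain C where C: "\<And>p. p \<in> M \<Longrightarrow> G p (C p)" by metis
  obtain F where F: "finite F" "F \<subseteq> M" "M \<subseteq> (\<Union>p \<in> F. N p)"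
    using compact_finite_subcover_openin[OF assms(1) N] by blast
  define K where "K = Max (insert 0 ((\<lambda>p. 2 * C p + 1) ` F))"
  \<comment> \<open>Its ratio \<open>K + 1\<close> exceeds the common bound for all fibres.\<close>
  let ?z = "Complex (K + 1) 1"
  have z: "?z \<in> hyp_plane" by (simp add: hyp_plane_def)
  obtain p where p: "p \<in> F" "E ?z \<in> N p" using F(3) dev_at_in(1)[OF dev[OF z] z] by blast
  have "G (E ?z) (2 * C p + 1)" using G[of p p "E ?z"] p F(2) N C by blast
  hence "\<bar>Re ?z\<bar> \<le> (2 * C p + 1) * Im ?z" using z unfolding G_def by blast
  moreover have "2 * C p + 1 \<le> K" "0 \<le> K" unfolding K_def using F(1) p(1) by (auto intro!: Max_ge)
  ultimately show False by simp
qed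

lemma dev_at_cong:
  assumes "dev_at A E z" "eventually (\<lambda>w. E w = E' w) (nhds z)"
  shows "dev_at A E' z"
proof -
  obtain U \<phi> h where U: "(U, \<phi>) \<in> A" "germ_rep U \<phi> h E z" using assms(1) unfolding dev_at_def by blast
  have "eventually (\<lambda>w. E' w \<in> U \<and> \<phi> (E' w) = hfold (h w)) (nhds z)"
    using germ_repD(2)[OF U(2)] assms(2) by eventually_elim auto
  thus ?thesis using U germ_repD(1)[OF U(2)] unfolding dev_at_def germ_rep_def by blast
qed

text \<open>On \<open>V\<close> heights exceed \<open>m\<close>, so every germ extends to a disc of
  the fixed radius \<open>\<kappa> * m\<close>, and the domain can grow by half of that in each
  step. Convexity does the work of simple connectedness: intersections of \<open>V\<close> with
  discs, and of discs, are connected, so the local extensions agree on overlaps.\<close>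

lemma extension_step:
  assumes k: "0 < \<kappa>" "\<kappa> \<le> 1/2"
    and ext: "\<And>E z. z \<in> hyp_plane \<Longrightarrow> dev_at A E z \<Longrightarrow>
      germ_extends E z (ball z (\<kappa> * Im z))"
    and V: "convex V" "open V" "m > 0" "\<And>z. z \<in> V \<Longrightarrow> Im z > m" and z0: "z0 \<in> V" "dev_at A E0 z0"
  shows "germ_extends E0 z0 (V \<inter> ball z0 (real (Suc n) * (\<kappa> * m / 2)))"
  unfolding germ_extends_def
proof (induction n)
  have VH: "V \<subseteq> hyp_plane" using V(3,4) by (force simp: hyp_plane_def)
  define \<epsilon> where "\<epsilon> = \<kappa> * m"
  have eps: "\<epsilon> > 0" "\<epsilon> < m" using k V(3) by (auto simp: \<epsilon>_def mult_less_cancel_right1)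
  have sub: "ball v \<epsilon> \<subseteq> ball v (\<kappa> * Im v)" "ball v \<epsilon> \<subseteq> hyp_plane" if "v \<in> V" for v
  proof -
    show "ball v \<epsilon> \<subseteq> ball v (\<kappa> * Im v)"
      using V(4)[OF that] k by (intro subset_ball) (simp add: \<epsilon>_def)
    show "ball v \<epsilon> \<subseteq> hyp_plane"
    proof
      fix w assume "w \<in> ball v \<epsilon>"
      hence "\<bar>Im (v - w)\<bar> < \<epsilon>" using abs_Im_le_cmod[of "v - w"] by (simp add: dist_norm)
      thus "w \<in> hyp_plane" using eps V(4)[OF that] by (auto simp: hyp_plane_def)
    qed
  qed
  {
    case 0
    obtain E' where E': "\<forall>w \<in> ball z0 (\<kappa> * Im z0). dev_at A E' w" "eventually (\<lambda>w. E0 w = E' w) (nhds z0)"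
      using ext[OF _ z0(2)] VH z0(1) unfolding germ_extends_def by blast
    have "ball z0 (real (Suc 0) * (\<kappa> * m / 2)) \<subseteq> ball z0 \<epsilon>" using eps by (intro subset_ball) (simp add: \<epsilon>_def)
    thus ?case using E' sub(1)[OF z0(1)] by (intro exI[of _ E']) auto
  next
    case (Suc n)
    define r where "r = real (Suc n) * (\<epsilon> / 2)"
    have r0: "r > 0" using eps by (simp add: r_def)
    obtain E where E: "\<And>w. w \<in> V \<inter> ball z0 r \<Longrightarrow> dev_at A E w" "eventually (\<lambda>w. E0 w = E w) (nhds z0)"
      using Suc unfolding r_def \<epsilon>_def by blast
    define V1 where "V1 = V \<inter> ball z0 r"
    have V1: "convex V1" "open V1" "V1 \<subseteq> V" "z0 \<in> V1" using V z0 r0 by (auto simp: V1_def convex_Int)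
    have "\<forall>v \<in> V1. \<exists>X. (\<forall>w \<in> ball v \<epsilon>. dev_at A X w) \<and> eventually (\<lambda>w. E w = X w) (nhds v)"
    proof
      fix v assume v: "v \<in> V1"
      hence vV: "v \<in> V" "v \<in> hyp_plane" using V1(3) VH by auto
      show "\<exists>X. (\<forall>w \<in> ball v \<epsilon>. dev_at A X w) \<and> eventually (\<lambda>w. E w = X w) (nhds v)"
        using ext[OF vV(2) E(1)] v sub(1)[OF vV(1)] unfolding V1_def germ_extends_def by blast
    qed
    then obtain X where X: "\<And>v w. v \<in> V1 \<Longrightarrow> w \<in> ball v \<epsilon> \<Longrightarrow> dev_at A (X v) w"
      "\<And>v. v \<in> V1 \<Longrightarrow> eventually (\<lambda>w. E w = X v w) (nhds v)"
      unfolding bchoice_iff by blast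
    \<comment> \<open>\<open>A1\<close> compares a disc extension with \<open>E\<close> on the old
      domain, \<open>A2\<close> two disc extensions beyond it. The agreement needed to start
      \<open>A2\<close> is found at the centre \<open>v'\<close>, which still lies in the old
      domain.\<close>
    have A1: "eventually (\<lambda>w. E w = X v w) (nhds y)" if "v \<in> V1" "y \<in> V1" "y \<in> ball v \<epsilon>" for v y
    proof (rule dev_identity[of "V1 \<inter> ball v \<epsilon>" E "X v" v])
      show "open (V1 \<inter> ball v \<epsilon>)" using V1 by auto
      show "connected (V1 \<inter> ball v \<epsilon>)" using V1 by (intro convex_connected convex_Int) auto
    qed (use that V1 VH eps E(1) X V1_def in auto)
    have A2: "X v y = X v' y" if "v \<in> V1" "v' \<in> V1" "v' \<in> ball v \<epsilon>" "y \<in> ball v \<epsilon>" "y \<in> ball v' \<epsilon>" for v v' y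
    proof -
      have ev: "eventually (\<lambda>w. X v w = X v' w) (nhds v')"
        using A1[OF that(1,2,3)] X(2)[OF that(2)] by eventually_elim simp
      have "eventually (\<lambda>w. X v w = X v' w) (nhds y)"
      proof (rule dev_identity[of "ball v \<epsilon> \<inter> ball v' \<epsilon>", OF _ _ _ _ _ _ ev])
        show "connected (ball v \<epsilon> \<inter> ball v' \<epsilon>)" by (intro convex_connected convex_Int) auto
        show "ball v \<epsilon> \<inter> ball v' \<epsilon> \<subseteq> hyp_plane" using sub(2)[of v] V1(3) that by blast
      qed (use that X(1) eps in auto)
      thus ?thesis by (rule eventually_nhds_x_imp_x)
    qed
    \<comment> \<open>The extension takes its value at \<open>w\<close> from the disc around the point \<open>\<zeta> w\<close> of the segment from \<open>z0\<close> to \<open>w\<close>.\<close>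
    define c where "c = real (Suc n) / real (Suc (Suc n))"
    have c: "0 < c" "c < 1" "1 - c = 1 / real (Suc (Suc n))" by (auto simp: c_def field_simps)
    define \<zeta> where "\<zeta> w = z0 + of_real c * (w - z0)" for w
    \<comment> \<open>Here \<open>c * r' = r\<close> and
      \<open>(1 - c) * r' = \<epsilon> / 2\<close>: contracting towards \<open>z0\<close> by
      \<open>c\<close> carries the larger disc into the old one and moves its points by less than
      half the radius of the discs.\<close>
    define r' where "r' = real (Suc (Suc n)) * (\<epsilon> / 2)"
    define V2 where "V2 = V \<inter> ball z0 r'"
    have z: "\<zeta> w \<in> V1" "dist w (\<zeta> w) < \<epsilon> / 2" if w: "w \<in> V2" for w
    proof -
      have d: "cmod (w - z0) < r'" and wV: "w \<in> V" using w by (auto simp: V2_def dist_norm norm_minus_commute)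
      have "\<zeta> w = (1 - c) *\<^sub>R z0 + c *\<^sub>R w" by (simp add: \<zeta>_def scaleR_conv_of_real algebra_simps)
      hence "\<zeta> w \<in> V" using convexD_alt[OF V(1) z0(1) wV, of c] c(1,2) by simp
      moreover have "cmod (\<zeta> w - z0) = c * cmod (w - z0)" using c by (simp add: \<zeta>_def norm_mult)
      hence "cmod (\<zeta> w - z0) < c * r'" using d c by simp
      moreover have "c * r' = r" by (simp add: c_def r_def r'_def)
      ultimately show "\<zeta> w \<in> V1" by (simp add: V1_def dist_norm norm_minus_commute)
      have "w - \<zeta> w = of_real (1 - c) * (w - z0)" by (simp add: \<zeta>_def algebra_simps)
      hence "cmod (w - \<zeta> w) = \<bar>1 - c\<bar> * cmod (w - z0)" by (simp only: norm_mult norm_of_real)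
      hence "dist w (\<zeta> w) = (1 - c) * cmod (w - z0)" using c(1,2) by (simp add: dist_norm)
      also have "\<dots> < (1 - c) * r'" using d c by (intro mult_strict_left_mono) auto
      also have "\<dots> = \<epsilon> / 2" unfolding c(3) r'_def by simp
      finally show "dist w (\<zeta> w) < \<epsilon> / 2" .
    qed
    define E' where "E' w = X (\<zeta> w) w" for w
    have near: "eventually (\<lambda>y. E' y = X (\<zeta> w) y) (nhds w)" if w: "w \<in> V2" for w
    proof -
      have "open (V2 \<inter> ball w (\<epsilon> / 2))" using V by (auto simp: V2_def)
      hence "eventually (\<lambda>y. y \<in> V2 \<inter> ball w (\<epsilon> / 2)) (nhds w)"
        using w eps by (intro eventually_nhds_in_open) auto
      thus ?thesis
      proof eventually_elim
        case (elim y)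
        hence y: "y \<in> V2" "dist w y < \<epsilon> / 2" by auto
        have "\<zeta> w - \<zeta> y = of_real c * (w - y)" by (simp add: \<zeta>_def algebra_simps)
        hence "dist (\<zeta> w) (\<zeta> y) = c * dist w y" using c by (simp add: dist_norm norm_mult)
        also have "\<dots> \<le> 1 * dist w y" using c by (intro mult_right_mono) auto
        finally have 1: "dist (\<zeta> w) (\<zeta> y) < \<epsilon>" using y eps by simp
        have 2: "dist (\<zeta> w) y < \<epsilon>" using z(2)[OF w] y(2) dist_triangle[of "\<zeta> w" y w] by (simp add: dist_commute)
        show ?case unfolding E'_def
          by (rule A2[symmetric]) (use z[OF w] z[OF y(1)] 1 2 eps in \<open>auto simp: dist_commute\<close>)
      qed
    qed
    have dev: "dev_at A E' w" if w: "w \<in> V2" for w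
    proof (rule dev_at_cong)
      show "dev_at A (X (\<zeta> w)) w" using z[OF w] eps by (intro X(1)) (auto simp: dist_commute)
      show "eventually (\<lambda>y. X (\<zeta> w) y = E' y) (nhds w)" using near[OF w] by eventually_elim simp
    qed
    have "z0 \<in> V2" using z0 eps by (simp add: V2_def r'_def)
    moreover have "\<zeta> z0 = z0" by (simp add: \<zeta>_def)
    ultimately have near0: "eventually (\<lambda>y. E' y = X z0 y) (nhds z0)" using near[of z0] by simp
    have "eventually (\<lambda>w. E0 w = E' w) (nhds z0)"
      using near0 X(2)[OF V1(4)] E(2) by eventually_elim simp
    thus ?case using dev unfolding V2_def r'_def \<epsilon>_def by blast
  }
qed

text \<open>The radius of \<open>extension_step\<close> shrinks with the lower bound on the height,
  so each target \<open>w\<close> gets its own convex region and its own extension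
  \<open>Y w\<close>. The regions all contain \<open>z0\<close> and meet in convex sets, hence the
  diagonal \<open>Y y y\<close> is locally one of these extensions.\<close>

lemma global_extension:
  assumes "compact M" and z0: "z0 \<in> hyp_plane" "dev_at A E0 z0"
  shows "germ_extends E0 z0 hyp_plane"
proof -
  obtain \<kappa> where k: "0 < \<kappa>" "\<kappa> \<le> 1/2" and ext: "\<And>E z. z \<in> hyp_plane \<Longrightarrow> dev_at A E z \<Longrightarrow>
      germ_extends E z (ball z (\<kappa> * Im z))"
    using uniform_extension[OF assms(1)] by blast
  define m where "m w = min (Im z0) (Im w) / 2" for w
  \<comment> \<open>Large enough to contain \<open>z0\<close> and \<open>w\<close>, yet bounded and
    with heights bounded away from 0, so that finitely many steps exhaust it.\<close>
  define V where "V w = {z. Im z > m w} \<inter> ball z0 (dist z0 w + 1)" for w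
  have V: "convex (V w)" "open (V w)" "m w > 0" "\<And>z. z \<in> V w \<Longrightarrow> Im z > m w" "z0 \<in> V w" "w \<in> V w"
      "V w \<subseteq> hyp_plane" if "w \<in> hyp_plane" for w
  proof -
    have i: "Im z0 > 0" "Im w > 0" using z0(1) that hyp_planeD by auto
    show "convex (V w)" unfolding V_def by (intro convex_Int convex_halfspace_Im_gt convex_ball)
    show "open (V w)" unfolding V_def by (intro open_Int open_halfspace_Im_gt open_ball)
    show m0: "m w > 0" using i by (simp add: m_def)
    show "Im z > m w" if "z \<in> V w" for z using that by (simp add: V_def)
    show "z0 \<in> V w" "w \<in> V w" using i by (auto simp: V_def m_def add_nonneg_pos)
    show "V w \<subseteq> hyp_plane" using m0 by (auto simp: V_def hyp_plane_def)
  qed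
  have "\<forall>w \<in> hyp_plane. \<exists>Y. (\<forall>y \<in> V w. dev_at A Y y) \<and> eventually (\<lambda>y. E0 y = Y y) (nhds z0)"
  proof
    fix w assume w: "w \<in> hyp_plane"
    have e: "\<kappa> * m w / 2 > 0" using k V(3)[OF w] by simp
    obtain n where n: "dist z0 w + 1 < real n * (\<kappa> * m w / 2)" using reals_Archimedean3[OF e] by blast
    have "real n * (\<kappa> * m w / 2) \<le> real (Suc n) * (\<kappa> * m w / 2)" using e by (intro mult_right_mono) auto
    hence "V w \<subseteq> V w \<inter> ball z0 (real (Suc n) * (\<kappa> * m w / 2))" using n by (auto simp: V_def)
    thus "\<exists>Y. (\<forall>y \<in> V w. dev_at A Y y) \<and> eventually (\<lambda>y. E0 y = Y y) (nhds z0)"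
      using extension_step[OF k ext V(1,2,3,4,5)[OF w] z0(2), of n]
      unfolding germ_extends_def by blast
  qed
  then obtain Y where Y: "\<And>w y. w \<in> hyp_plane \<Longrightarrow> y \<in> V w \<Longrightarrow> dev_at A (Y w) y"
    "\<And>w. w \<in> hyp_plane \<Longrightarrow> eventually (\<lambda>y. E0 y = Y w y) (nhds z0)"
    unfolding bchoice_iff by blast
  have near: "eventually (\<lambda>y. Y y y = Y w y) (nhds w)" if w: "w \<in> hyp_plane" for w
  proof -
    have "eventually (\<lambda>y. y \<in> V w) (nhds w)" using V[OF w] by (intro eventually_nhds_in_open)
    thus ?thesis
    proof eventually_elim
      case (elim y)
      hence y: "y \<in> hyp_plane" using V(7)[OF w] by blast
      have ev: "eventually (\<lambda>x. Y y x = Y w x) (nhds z0)"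
        using Y(2)[OF y] Y(2)[OF w] by eventually_elim simp
      have "eventually (\<lambda>x. Y y x = Y w x) (nhds y)"
      proof (rule dev_identity[of "V y \<inter> V w", OF _ _ _ _ _ _ ev])
        show "open (V y \<inter> V w)" using V(2)[OF w] V(2)[OF y] by blast
        show "connected (V y \<inter> V w)" using V(1)[OF w] V(1)[OF y] by (intro convex_connected convex_Int)
      qed (use V[OF w] V[OF y] Y(1)[OF w] Y(1)[OF y] elim in auto)
      thus ?case by (rule eventually_nhds_x_imp_x)
    qed
  qed
  show ?thesis unfolding germ_extends_def
  proof (intro exI[of _ "\<lambda>y. Y y y"] conjI ballI)
    fix w assume w: "w \<in> hyp_plane"
    show "dev_at A (\<lambda>y. Y y y) w"
      by (rule dev_at_cong[OF Y(1)[OF w V(6)[OF w]]]) (use near[OF w] in \<open>auto elim: eventually_mono\<close>)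
  next
    show "eventually (\<lambda>w. E0 w = Y w w) (nhds z0)"
      using near[OF z0(1)] Y(2)[OF z0(1)] by eventually_elim simp
  qed
qed

end

section \<open>Boundary lines and the closed geodesic\<close>

lemma isCont_reflection:
  assumes "hyp_motion h" "hyp_motion h'" "w \<in> hyp_plane"
  shows "isCont (\<lambda>w. h' (mirror (h w))) w"
proof -
  have "continuous_on hyp_plane (\<lambda>w. h' (mirror (h w)))"
    by (rule continuous_on_compose2[OF continuous_on_motion[OF assms(2)]
          continuous_on_mirror[OF continuous_on_motion[OF assms(1)]]])
      (use motion_in_plane[OF assms(1)] in auto)
  thus ?thesis using assms(3) open_hyp_plane by (simp add: continuous_on_eq_continuous_at)
qed

context surface_atlas
begin

lemma dev_at_compose_motion:
  assumes "dev_at A E (g z)" "hyp_motion g" "z \<in> hyp_plane"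
  shows "dev_at A (\<lambda>w. E (g w)) z"
proof -
  obtain U \<phi> h where U: "(U, \<phi>) \<in> A" "germ_rep U \<phi> h E (g z)" using assms(1) unfolding dev_at_def by blast
  obtain m where m: "hyp_motion m" "\<forall>w \<in> hyp_plane. m w = h (g w)"
    using motion_compose[OF germ_repD(1)[OF U(2)] assms(2)] by blast
  have "eventually (\<lambda>w. E (g w) \<in> U \<and> \<phi> (E (g w)) = hfold (m w)) (nhds z)"
    using eventually_nhds_isCont[OF isCont_motion[OF assms(2,3)] germ_repD(2)[OF U(2)]]
      eventually_in_plane[OF assms(3)]
    by eventually_elim (use m(2) in simp)
  thus ?thesis using U(1) m(1) unfolding dev_at_def germ_rep_def by blast
qed

lemma germ_boundary:
  assumes "(U, \<phi>) \<in> A" "germ_rep U \<phi> h E z"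
  shows "eventually (\<lambda>w. E w \<in> hyp_boundary A \<longleftrightarrow> Re (h w) = 0) (nhds z)"
  using germ_repD(2)[OF assms(2)]
proof eventually_elim
  case (elim w)
  hence "E w \<in> hyp_boundary A \<longleftrightarrow> Re (hfold (h w)) = 0" using boundary_iff[OF assms(1)] by simp
  thus ?case by simp
qed

text \<open>Reflection in the line, followed by \<open>E\<close>, is again a development, and it
  agrees with \<open>E\<close> near \<open>z\<close> because the fold identifies reflected points;
  the identity principle spreads this over the plane.\<close>

lemma dev_reflection:
  assumes dev: "\<And>w. w \<in> hyp_plane \<Longrightarrow> dev_at A E w"
    and U: "(U, \<phi>) \<in> A" "germ_rep U \<phi> h E z" and z: "z \<in> hyp_plane" "Re (h z) = 0"
    and h': "hyp_motion h'" "\<forall>z \<in> hyp_plane. h' (h z) = z \<and> h (h' z) = z" and w: "w \<in> hyp_plane"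
  shows "E (h' (mirror (h w))) = E w"
proof -
  have h: "hyp_motion h" using germ_repD(1)[OF U(2)] .
  define s where "s w = h' (mirror (h w))" for w
  have sH: "s w \<in> hyp_plane" if "w \<in> hyp_plane" for w
    unfolding s_def using motion_in_plane[OF h that] motion_in_plane[OF h'(1)] by simp
  have hs: "h (s w) = mirror (h w)" if "w \<in> hyp_plane" for w
    unfolding s_def using motion_in_plane[OF h that] h'(2) by simp
  have scont: "isCont s w" if "w \<in> hyp_plane" for w
    unfolding s_def by (rule isCont_reflection[OF h h'(1) that])
  have sdev: "dev_at A (\<lambda>w. E (s w)) w" if w: "w \<in> hyp_plane" for w
  proof -
    obtain V \<psi> k where V: "(V, \<psi>) \<in> A" "germ_rep V \<psi> k E (s w)"
      using dev[OF sH[OF w]] unfolding dev_at_def by blast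
    obtain m where m: "hyp_motion m" "\<forall>y \<in> hyp_plane. m y = k (h' y)"
      using motion_compose[OF germ_repD(1)[OF V(2)] h'(1)] by blast
    obtain m' where m': "hyp_motion m'" "\<forall>y \<in> hyp_plane. m' y = mirror (m (mirror y))"
      using motion_conj_mirror[OF m(1)] by blast
    \<comment> \<open>The reflection reverses orientation, so a further mirror is composed to obtain
      a motion; \<open>hfold\<close> does not see it.\<close>
    obtain n where n: "hyp_motion n" "\<forall>y \<in> hyp_plane. n y = m' (h y)"
      using motion_compose[OF m'(1) h] by blast
    have "eventually (\<lambda>y. E (s y) \<in> V \<and> \<psi> (E (s y)) = hfold (n y)) (nhds w)"
      using eventually_nhds_isCont[OF scont[OF w] germ_repD(2)[OF V(2)]] eventually_in_plane[OF w]
    proof eventually_elim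
      case (elim y)
      have hy: "h y \<in> hyp_plane" using motion_in_plane[OF h] elim by blast
      have "n y = mirror (k (s y))" using n(2) m'(2) m(2) hy elim by (simp add: s_def)
      thus ?case using elim by simp
    qed
    thus ?thesis using V(1) n(1) unfolding dev_at_def germ_rep_def by blast
  qed
  have sz: "s z = z"
  proof -
    have "mirror (h z) = h z" using z(2) by (simp add: complex_eq_iff)
    thus ?thesis using h'(2) z(1) by (simp add: s_def)
  qed
  have ev: "eventually (\<lambda>w. E (s w) = E w) (nhds z)"
  proof -
    have "eventually (\<lambda>w. E (s w) \<in> U \<and> \<phi> (E (s w)) = hfold (h (s w))) (nhds z)"
      by (rule eventually_nhds_isCont[OF scont[OF z(1)]]) (use germ_repD(2)[OF U(2)] sz in simp)
    thus ?thesis using germ_repD(2)[OF U(2)] eventually_in_plane[OF z(1)]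
    proof eventually_elim
      case (elim y)
      hence "\<phi> (E (s y)) = \<phi> (E y)" "E (s y) \<in> U" "E y \<in> U" using hs by simp_all
      thus ?case using chart_props(3)[OF U(1)] by (rule inj_onD[rotated])
    qed
  qed
  have "eventually (\<lambda>w. E (s w) = E w) (nhds w)"
    by (rule dev_identity[OF open_hyp_plane convex_connected[OF convex_hyp_plane] subset_refl sdev dev z(1) ev w])
  thus ?thesis using eventually_nhds_x_imp_x unfolding s_def by fast
qed

text \<open>The germ at \<open>z\<close> yields the line only near \<open>z\<close>. Global
  reflection symmetry of \<open>E\<close> in that line then forces all of it over the
  boundary.\<close>

lemma boundary_line:
  assumes dev: "\<And>w. w \<in> hyp_plane \<Longrightarrow> dev_at A E w"
    and z: "z \<in> hyp_plane" "E z \<in> hyp_boundary A"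
  shows "\<exists>h. hyp_motion h \<and> Re (h z) = 0 \<and> (\<forall>w \<in> hyp_plane. Re (h w) = 0 \<longrightarrow> E w \<in> hyp_boundary A) \<and>
    eventually (\<lambda>w. E w \<in> hyp_boundary A \<longleftrightarrow> Re (h w) = 0) (nhds z)"
proof -
  obtain U \<phi> h where U: "(U, \<phi>) \<in> A" "germ_rep U \<phi> h E z" using dev[OF z(1)] unfolding dev_at_def by blast
  have h: "hyp_motion h" using germ_repD(1)[OF U(2)] .
  note ev = germ_boundary[OF U]
  have 0: "Re (h z) = 0" using eventually_nhds_x_imp_x[OF ev] z(2) by simp
  obtain h' where h': "hyp_motion h'" "\<forall>z \<in> hyp_plane. h' (h z) = z \<and> h (h' z) = z"
    using motion_inverse[OF h] by blast
  \<comment> \<open>\<open>E\<close> is invariant under the reflection in the line, hence not injective near a point of the line.\<close>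
  have "E w \<in> hyp_boundary A" if w: "w \<in> hyp_plane" "Re (h w) = 0" for w
  proof (rule ccontr)
    assume nb: "E w \<notin> hyp_boundary A"
    obtain V \<psi> k where V: "(V, \<psi>) \<in> A" "germ_rep V \<psi> k E w" using dev[OF w(1)] unfolding dev_at_def by blast
    have k: "hyp_motion k" using germ_repD(1)[OF V(2)] .
    have "Re (k w) \<noteq> 0" using eventually_nhds_x_imp_x[OF germ_boundary[OF V]] nb by simp
    note evS = motion_Re_sign_locally[OF k w(1) \<open>Re (k w) \<noteq> 0\<close>]
    define s where "s w = h' (mirror (h w))" for w
    have scont: "isCont s w" unfolding s_def by (rule isCont_reflection[OF h h'(1) w(1)])
    have "mirror (h w) = h w" using w(2) by (simp add: complex_eq_iff)
    hence sw: "s w = w" using h'(2) w(1) by (simp add: s_def)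
    define Q where "Q y \<longleftrightarrow> y \<in> hyp_plane \<and> Re (k y) * Re (k w) > 0 \<and> E y \<in> V \<and> \<psi> (E y) = hfold (k y)" for y
    have Q: "eventually Q (nhds w)" unfolding Q_def
      using evS germ_repD(2)[OF V(2)] eventually_in_plane[OF w(1)] by eventually_elim auto
    have "eventually (\<lambda>y. Q (s y)) (nhds w)"
      by (rule eventually_nhds_isCont[OF scont]) (use Q sw in simp)
    with Q have "eventually (\<lambda>y. Re (h y) \<ge> 0) (nhds w)"
    proof eventually_elim
      case (elim y)
      have yH: "y \<in> hyp_plane" "s y \<in> hyp_plane" using elim by (auto simp: Q_def)
      have "E (s y) = E y" unfolding s_def by (rule dev_reflection[OF dev U z(1) 0 h' yH(1)])
      hence "hfold (k (s y)) = hfold (k y)" using elim by (auto simp: Q_def)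
      moreover have "Re (k (s y)) * Re (k w) > 0" "Re (k y) * Re (k w) > 0"
        using elim by (auto simp: Q_def)
      ultimately have "k (s y) = k y" by (auto simp: hfold_eq_iff zero_less_mult_iff)
      obtain k' where k': "\<forall>z \<in> hyp_plane. k' (k z) = z \<and> k (k' z) = z"
        using motion_inverse[OF k] by blast
      have "s y = y" using k' yH \<open>k (s y) = k y\<close> by metis
      moreover have "h (s y) = mirror (h y)"
        unfolding s_def using motion_in_plane[OF h yH(1)] h'(2) by simp
      ultimately have "h y = mirror (h y)" by simp
      hence "Re (h y) = - Re (h y)" by (metis mirror_simps(1))
      thus ?case by simp
    qed
    from motion_Re_nonneg_interior[OF h w(1) this] w(2) show False by simp
  qed
  thus ?thesis using h 0 ev by blast
qed

text \<open>One motion \<open>h\<close> describes both \<open>E\<close> and the curve, and the curve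
  without \<open>hfold\<close>. This is stronger than equality of \<open>c\<close> with
  \<open>E\<close> on the axis: it excludes that the curve is only the folded image of the
  axis.\<close>

definition follows :: "(real \<Rightarrow> 'a) \<Rightarrow> (complex \<Rightarrow> 'a) \<Rightarrow> 'a set \<Rightarrow> ('a \<Rightarrow> complex) \<Rightarrow> (complex \<Rightarrow> complex) \<Rightarrow> real \<Rightarrow> bool" where
  "follows c E U \<phi> h t \<longleftrightarrow> (U, \<phi>) \<in> A \<and> germ_rep U \<phi> h E (iaxis t) \<and>
    eventually (\<lambda>s. c s \<in> U \<and> \<phi> (c s) = h (iaxis s)) (nhds t)"

lemma geodesic_local_form:
  assumes "geodesic_on A UNIV c"
  shows "\<exists>U \<phi> h. (U, \<phi>) \<in> A \<and> hyp_motion h \<and> eventually (\<lambda>s. c s \<in> U \<and> \<phi> (c s) = h (iaxis s)) (nhds t)"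
proof -
  obtain U \<phi> e where U: "(U, \<phi>) \<in> A" "e > 0" "\<forall>s \<in> ball t e. c s \<in> U"
    "\<forall>s \<in> ball t e. \<forall>s' \<in> ball t e. hyp_dist (\<phi> (c s)) (\<phi> (c s')) = \<bar>s - s'\<bar>"
    using assms unfolding geodesic_on_def by fastforce
  have "\<exists>h. hyp_motion h \<and> (\<forall>s \<in> ball t e. \<phi> (c s) = h (iaxis s))"
  proof (rule isometric_curve_is_axis[of "ball t e" "\<lambda>s. \<phi> (c s)" t "t + e/2"])
    show "\<phi> (c s) \<in> hyp_plane" if "s \<in> ball t e" for s using U chart_in_half(1)[OF U(1)] that by blast
  qed (use U in \<open>auto simp: dist_real_def\<close>)
  then obtain h where h: "hyp_motion h" "\<forall>s \<in> ball t e. \<phi> (c s) = h (iaxis s)" by blast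
  have "eventually (\<lambda>s. s \<in> ball t e) (nhds t)" using U(2) by (intro eventually_nhds_in_open) auto
  hence "eventually (\<lambda>s. c s \<in> U \<and> \<phi> (c s) = h (iaxis s)) (nhds t)"
    by eventually_elim (use U h in auto)
  thus ?thesis using U(1) h(1) by blast
qed

text \<open>Continuity of the curve as a map into \<open>M\<close>, recovered from its expression in
  one chart.\<close>

lemma curve_eventually_in:
  assumes "(U, \<phi>) \<in> A" "hyp_motion h" "eventually (\<lambda>s. c s \<in> U \<and> \<phi> (c s) = h (iaxis s)) (nhds t)"
    and W: "openin (top_of_set M) W" "c t \<in> W"
  shows "eventually (\<lambda>s. c s \<in> W) (nhds t)"
proof -
  have t: "c t \<in> U" "\<phi> (c t) = h (iaxis t)" using eventually_nhds_x_imp_x[OF assms(3)] by auto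
  obtain e where e: "e > 0" "ball (\<phi> (c t)) e \<inter> hyp_half_plane \<subseteq> \<phi> ` (U \<inter> W)"
    by (rule chart_ball[OF assms(1) W(1) t(1) W(2)])
  have "eventually (\<lambda>v. v \<in> ball (\<phi> (c t)) e) (nhds (h (iaxis t)))"
    using e(1) t by (intro eventually_nhds_in_open) auto
  from eventually_iaxis[OF eventually_nhds_isCont[OF isCont_motion[OF assms(2)] this]]
  have "eventually (\<lambda>s. h (iaxis s) \<in> ball (\<phi> (c t)) e) (nhds t)" by simp
  with assms(3) show ?thesis
  proof eventually_elim
    case (elim s)
    hence "\<phi> (c s) \<in> hyp_half_plane" using chart_props(2)[OF assms(1)] by blast
    then obtain q where q: "q \<in> U" "q \<in> W" "\<phi> (c s) = \<phi> q" using e(2) elim by auto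
    hence "c s = q" using elim chart_props(3)[OF assms(1)] by (auto dest: inj_onD)
    thus ?case using q by simp
  qed
qed

lemma followsD:
  assumes "follows c E U \<phi> h t"
  shows "(U, \<phi>) \<in> A" "germ_rep U \<phi> h E (iaxis t)" "hyp_motion h"
    "eventually (\<lambda>s. c s \<in> U \<and> \<phi> (c s) = h (iaxis s)) (nhds t)"
    "c t \<in> U" "\<phi> (c t) = h (iaxis t)" "E (iaxis t) = c t" "Re (h (iaxis t)) \<ge> 0"
proof -
  show 1: "(U, \<phi>) \<in> A" and 2: "germ_rep U \<phi> h E (iaxis t)"
    and 4: "eventually (\<lambda>s. c s \<in> U \<and> \<phi> (c s) = h (iaxis s)) (nhds t)"
    using assms by (auto simp: follows_def)
  show "hyp_motion h" using germ_repD(1)[OF 2] .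
  show 5: "c t \<in> U" and 6: "\<phi> (c t) = h (iaxis t)" using eventually_nhds_x_imp_x[OF 4] by auto
  show 8: "Re (h (iaxis t)) \<ge> 0" using chart_in_half(2)[OF 1 5] 6 by simp
  have "\<phi> (E (iaxis t)) = \<phi> (c t)" using germ_repD(4)[OF 2] 6 8 by (simp add: hfold_pos)
  thus "E (iaxis t) = c t" using germ_repD(3)[OF 2] 5 chart_props(3)[OF 1] by (auto dest: inj_onD)
qed

lemma follows_chart:
  assumes "follows c E U \<phi> h t" "(V, \<psi>) \<in> A" "c t \<in> V"
  shows "\<exists>h2. follows c E V \<psi> h2 t"
proof -
  note f = followsD[OF assms(1)]
  have "E (iaxis t) \<in> V" using f(7) assms(3) by simp
  from chart_change[OF f(1) assms(2) iaxis_simps(3) f(2) this] f(8)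
  obtain h2 k W where h2: "germ_rep V \<psi> h2 E (iaxis t)" and
    W: "openin (top_of_set M) W" "E (iaxis t) \<in> W" "W \<subseteq> U \<inter> V" "\<forall>q \<in> W. \<psi> q = k (\<phi> q)"
    "\<forall>w \<in> hyp_plane. h2 w = k (h w)" by blast
  have "eventually (\<lambda>s. c s \<in> W) (nhds t)"
    using curve_eventually_in[OF f(1,3,4) W(1)] W(2) f(7) by simp
  with f(4) have "eventually (\<lambda>s. c s \<in> V \<and> \<psi> (c s) = h2 (iaxis s)) (nhds t)"
    by eventually_elim (use W(3,4,5) in auto)
  thus ?thesis using assms(2) h2 unfolding follows_def by blast
qed

text \<open>Open and closed argument on the parameter line. At a limit parameter the Hausdorff
  property gives \<open>E (iaxis t) = c t\<close>, hence a common chart, with motions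
  \<open>k\<close> for \<open>E\<close> and \<open>h\<close> for \<open>c\<close> that remain to be
  identified.\<close>

lemma follows_everywhere:
  assumes geo: "geodesic_on A UNIV c" and dev: "\<And>w. w \<in> hyp_plane \<Longrightarrow> dev_at A E w"
    and start: "follows c E U0 \<phi>0 h0 t0"
  shows "\<exists>U \<phi> h. follows c E U \<phi> h t"
proof -
  define S where "S = {t. \<exists>U \<phi> h. follows c E U \<phi> h t}"
  define T where "T = {t. \<exists>N. open N \<and> t \<in> N \<and> N \<inter> S = {}}"
  have "open S"
  proof (subst open_subopen, rule ballI)
    fix t assume "t \<in> S"
    then obtain U \<phi> h where f: "follows c E U \<phi> h t" unfolding S_def by blast
    note f' = followsD[OF f]
    have 1: "eventually (\<lambda>s. eventually (\<lambda>s. c s \<in> U \<and> \<phi> (c s) = h (iaxis s)) (nhds s)) (nhds t)"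
      using f'(4) by (simp add: eventually_eventually)
    have "eventually (\<lambda>z. eventually (\<lambda>w. E w \<in> U \<and> \<phi> (E w) = hfold (h w)) (nhds z)) (nhds (iaxis t))"
      using germ_repD(2)[OF f'(2)] by (simp add: eventually_eventually)
    from eventually_iaxis[OF this] 1 have "eventually (\<lambda>s. follows c E U \<phi> h s) (nhds t)"
      by eventually_elim (use f'(1,3) in \<open>simp add: follows_def germ_rep_def\<close>)
    then obtain N where "open N" "t \<in> N" "\<forall>s \<in> N. follows c E U \<phi> h s" unfolding eventually_nhds by blast
    thus "\<exists>N. open N \<and> t \<in> N \<and> N \<subseteq> S" unfolding S_def by blast
  qed
  moreover have "open T" unfolding T_def by (subst open_subopen) blast
  moreover have "S \<inter> T \<inter> UNIV = {}" unfolding T_def by blast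
  moreover have "UNIV \<subseteq> S \<union> T"
  proof
    fix t :: real
    show "t \<in> S \<union> T"
    proof (rule ccontr)
      assume n: "t \<notin> S \<union> T"
      hence near: "\<exists>s \<in> N. s \<in> S" if "open N" "t \<in> N" for N using that unfolding T_def by blast
      obtain U \<phi> h where U: "(U, \<phi>) \<in> A" "hyp_motion h"
        "eventually (\<lambda>s. c s \<in> U \<and> \<phi> (c s) = h (iaxis s)) (nhds t)"
        using geodesic_local_form[OF geo] by blast
      have tU: "c t \<in> U" using eventually_nhds_x_imp_x[OF U(3)] by simp
      have "E (iaxis t) = c t"
      proof (rule ccontr)
        assume "E (iaxis t) \<noteq> c t"
        then obtain P Q where PQ: "open P" "open Q" "E (iaxis t) \<in> P" "c t \<in> Q" "P \<inter> Q = {}"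
          using hausdorff by metis
        have "eventually (\<lambda>w. E w \<in> M \<inter> P) (nhds (iaxis t))"
          using dev_at_in(1)[OF dev iaxis_simps(3)] PQ
          by (intro dev_at_in(2)[OF dev iaxis_simps(3) openin_open_Int]) auto
        from eventually_iaxis[OF this]
        have "eventually (\<lambda>s. E (iaxis s) \<in> M \<inter> P) (nhds t)" .
        moreover have "eventually (\<lambda>s. c s \<in> M \<inter> Q) (nhds t)"
          using PQ chart_in_half(3)[OF U(1) tU]
          by (intro curve_eventually_in[OF U openin_open_Int]) auto
        ultimately have "eventually (\<lambda>s. E (iaxis s) \<in> P \<and> c s \<in> Q) (nhds t)" by eventually_elim auto
        then obtain N where N: "open N" "t \<in> N" "\<forall>s \<in> N. E (iaxis s) \<in> P \<and> c s \<in> Q" unfolding eventually_nhds by blast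
        obtain s where s: "s \<in> N" "s \<in> S" using near[OF N(1,2)] by blast
        hence "E (iaxis s) = c s" using followsD(7) unfolding S_def by blast
        thus False using N(3) s PQ(5) by auto
      qed
      then obtain k where k: "germ_rep U \<phi> k E (iaxis t)"
        using dev_at_rep[OF dev[OF iaxis_simps(3)] iaxis_simps(3) U(1), of t] tU by auto
      have "eventually (\<lambda>z. eventually (\<lambda>w. E w \<in> U \<and> \<phi> (E w) = hfold (k w)) (nhds z)) (nhds (iaxis t))"
        using germ_repD(2)[OF k] by (simp add: eventually_eventually)
      from eventually_iaxis[OF this]
      have "eventually (\<lambda>s. eventually (\<lambda>w. E w \<in> U \<and> \<phi> (E w) = hfold (k w)) (nhds (iaxis s))) (nhds t)" .
      moreover have "eventually (\<lambda>s. eventually (\<lambda>s. c s \<in> U \<and> \<phi> (c s) = h (iaxis s)) (nhds s)) (nhds t)"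
        using U(3) by (simp add: eventually_eventually)
      ultimately have "eventually (\<lambda>s. germ_rep U \<phi> k E (iaxis s) \<and>
          eventually (\<lambda>s. c s \<in> U \<and> \<phi> (c s) = h (iaxis s)) (nhds s)) (nhds t)"
        by eventually_elim (use germ_repD(1)[OF k] in \<open>simp add: germ_rep_def\<close>)
      then obtain N where N: "open N" "t \<in> N" "\<forall>s \<in> N. germ_rep U \<phi> k E (iaxis s) \<and>
          eventually (\<lambda>s. c s \<in> U \<and> \<phi> (c s) = h (iaxis s)) (nhds s)" unfolding eventually_nhds by blast
      obtain s where s: "s \<in> N" "s \<in> S" using near[OF N(1,2)] by blast
      have gk: "germ_rep U \<phi> k E (iaxis s)" and
        evs: "eventually (\<lambda>s. c s \<in> U \<and> \<phi> (c s) = h (iaxis s)) (nhds s)" using N(3) s(1) by auto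
      have "c s \<in> U" using eventually_nhds_x_imp_x[OF evs] by simp
      then obtain h2 where h2: "follows c E U \<phi> h2 s" using follows_chart s(2) U(1) unfolding S_def by blast
      note f2 = followsD[OF h2]
      \<comment> \<open>At a nearby followed parameter \<open>s\<close> a single motion
        \<open>h2\<close> serves both: it equals \<open>k\<close> by uniqueness of the germ of
        \<open>E\<close>, and \<open>h\<close> because both describe the curve on an arc.\<close>
      have k2: "k w = h2 w" if "w \<in> hyp_plane" for w
        by (rule germ_unique(1)[OF U(1) iaxis_simps(3) gk f2(2) _ that]) (auto intro!: bexI[of _ "iaxis s"])
      have "eventually (\<lambda>s. h2 (iaxis s) = h (iaxis s)) (nhds s)" using evs f2(4) by eventually_elim simp
      from infinite_if_eventually_nhds[OF this]
      have "h2 w = h w" if "w \<in> hyp_plane" for w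
        by (rule motion_eq_on_axis[OF f2(3) U(2) _ _ that]) auto
      hence "eventually (\<lambda>s. c s \<in> U \<and> \<phi> (c s) = k (iaxis s)) (nhds t)" using U(3) k2 by simp
      hence "follows c E U \<phi> k t" using U(1) k by (simp add: follows_def)
      thus False using n unfolding S_def by blast
    qed
  qed
  ultimately have "S \<inter> UNIV = {} \<or> T \<inter> UNIV = {}" by (intro connectedD[OF connected_UNIV]) auto
  moreover have "t0 \<in> S" using start unfolding S_def by blast
  ultimately have "T = {}" by blast
  thus ?thesis using \<open>UNIV \<subseteq> S \<union> T\<close> unfolding S_def by blast
qed

text \<open>Periodicity of the curve shows that the motion at parameter \<open>l\<close>, composed
  with the scaling, is the motion at 0. Hence \<open>E\<close> and its composition with the scaling
  have the same germ at \<open>iaxis 0\<close>, and the identity principle applies.\<close>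

lemma closed_geodesic_development:
  assumes "compact M" "closed_geodesic A c l"
  shows "\<exists>E. (\<forall>w \<in> hyp_plane. dev_at A E w) \<and> (\<forall>w \<in> hyp_plane. E (of_real (exp l) * w) = E w) \<and>
    (\<forall>t. eventually (\<lambda>z. E z \<in> hyp_boundary A \<longrightarrow> Re z = 0) (nhds (iaxis t)))"
proof -
  have geo: "geodesic_on A UNIV c" and per: "\<And>t. c (t + l) = c t"
    using assms(2) by (auto simp: closed_geodesic_def)
  obtain U \<phi> h where U: "(U, \<phi>) \<in> A" "hyp_motion h"
    "eventually (\<lambda>s. c s \<in> U \<and> \<phi> (c s) = h (iaxis s)) (nhds 0)"
    using geodesic_local_form[OF geo] by blast
  have c0: "c 0 \<in> U" "\<phi> (c 0) = h (iaxis 0)" using eventually_nhds_x_imp_x[OF U(3)] by auto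
  have hf: "hfold (h (iaxis 0)) = \<phi> (c 0)" using chart_in_half(2)[OF U(1) c0(1)] c0(2) by (simp add: hfold_pos)
  obtain e where e: "e > 0" "ball (\<phi> (c 0)) e \<inter> hyp_half_plane \<subseteq> \<phi> ` U"
    using chart_ball[OF U(1) chart_props(1)[OF U(1)] c0(1) c0(1)] by auto
  have "germ_rep U \<phi> h (\<lambda>w. inv_into U \<phi> (hfold (h w))) (iaxis 0)"
  proof (rule germ_rep_inv_into[OF U(2) iaxis_simps(3), where B = "ball (h (iaxis 0)) e"])
    fix v assume v: "v \<in> ball (h (iaxis 0)) e" "v \<in> hyp_plane"
    have "dist (\<phi> (c 0)) (hfold v) < e" using dist_hfold[of "h (iaxis 0)" v] v hf by simp
    thus "hfold v \<in> \<phi> ` U" using e(2) hfold_in_plane[OF v(2)] by auto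
  qed (use e in auto)
  then obtain E0 where E0: "germ_rep U \<phi> h E0 (iaxis 0)" by blast
  hence "dev_at A E0 (iaxis 0)" using U(1) unfolding dev_at_def by blast
  from global_extension[OF assms(1) iaxis_simps(3) this]
  obtain E where dev: "\<And>w. w \<in> hyp_plane \<Longrightarrow> dev_at A E w" and E: "eventually (\<lambda>w. E0 w = E w) (nhds (iaxis 0))"
    unfolding germ_extends_def by blast
  have "eventually (\<lambda>w. E w \<in> U \<and> \<phi> (E w) = hfold (h w)) (nhds (iaxis 0))"
    using germ_repD(2)[OF E0] E by eventually_elim simp
  hence f0: "follows c E U \<phi> h 0" using U by (simp add: follows_def germ_rep_def)
  note all = follows_everywhere[OF geo dev f0]
  have "E (of_real (exp l) * w) = E w" if w: "w \<in> hyp_plane" for w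
  proof -
    have "c l \<in> U" using per[of 0] c0 by simp
    then obtain k where k: "follows c E U \<phi> k l" using all[of l] follows_chart U(1) by blast
    note fk = followsD[OF k]
    obtain g where g: "hyp_motion g" "\<forall>z. g z = of_real (exp l) * z" using motion_scale[of "exp l"] by auto
    obtain m where m: "hyp_motion m" "\<forall>w \<in> hyp_plane. m w = k (g w)"
      using motion_compose[OF fk(3) g(1)] by blast
    have "isCont (\<lambda>s. l + s) 0" by simp
    from eventually_nhds_isCont[OF this, of "\<lambda>s. c s \<in> U \<and> \<phi> (c s) = k (iaxis s)"] fk(4)
    have "eventually (\<lambda>s. c (l + s) \<in> U \<and> \<phi> (c (l + s)) = k (iaxis (l + s))) (nhds 0)" by simp
    with U(3) have "eventually (\<lambda>s. m (iaxis s) = h (iaxis s)) (nhds 0)"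
    proof eventually_elim
      case (elim s)
      have "m (iaxis s) = k (iaxis (l + s))" using m(2) g(2) by (simp add: iaxis_shift)
      also have "\<dots> = h (iaxis s)" using elim per[of s] by (simp add: add.commute)
      finally show ?case .
    qed
    from infinite_if_eventually_nhds[OF this]
    have mh: "m w = h w" if "w \<in> hyp_plane" for w
      by (rule motion_eq_on_axis[OF m(1) U(2) _ _ that]) auto
    have gl: "g (iaxis 0) = iaxis l" using g(2) by (simp add: iaxis_shift)
    have "eventually (\<lambda>w. E (g w) \<in> U \<and> \<phi> (E (g w)) = hfold (k (g w))) (nhds (iaxis 0))"
      by (rule eventually_nhds_isCont[OF isCont_motion[OF g(1) iaxis_simps(3)]])
        (use germ_repD(2)[OF fk(2)] gl in simp)
    with germ_repD(2)[OF followsD(2)[OF f0]] eventually_in_plane[OF iaxis_simps(3)]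
    have ev: "eventually (\<lambda>w. E (g w) = E w) (nhds (iaxis 0))"
    proof eventually_elim
      case (elim y)
      have "k (g y) = h y" using mh m(2) elim by simp
      hence "\<phi> (E (g y)) = \<phi> (E y)" "E (g y) \<in> U" "E y \<in> U" using elim by simp_all
      thus ?case using chart_props(3)[OF U(1)] by (rule inj_onD[rotated])
    qed
    have gdev: "dev_at A (\<lambda>w. E (g w)) w" if "w \<in> hyp_plane" for w
      by (rule dev_at_compose_motion[OF dev[OF motion_in_plane[OF g(1) that]] g(1) that])
    have "eventually (\<lambda>w. E (g w) = E w) (nhds w)"
      by (rule dev_identity[OF open_hyp_plane convex_connected[OF convex_hyp_plane] subset_refl gdev dev iaxis_simps(3) ev w])
    hence "E (g w) = E w" by (rule eventually_nhds_x_imp_x)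
    thus ?thesis using g(2) by simp
  qed
  moreover have "eventually (\<lambda>z. E z \<in> hyp_boundary A \<longrightarrow> Re z = 0) (nhds (iaxis t))" for t
  proof -
    obtain V \<psi> k where k: "follows c E V \<psi> k t" using all[of t] by blast
    note fk = followsD[OF k]
    note ev = germ_boundary[OF fk(1,2)]
    show ?thesis
    proof (cases "Re (k (iaxis t)) = 0")
      case False
      from ev motion_Re_sign_locally[OF fk(3) iaxis_simps(3) this]
      show ?thesis by eventually_elim auto
    next
      case True
      \<comment> \<open>The curve stays in the half-plane of the chart, so a boundary line met by
        the axis is tangent to it and hence is the axis.\<close>
      have "eventually (\<lambda>s. Re (k (iaxis s)) \<ge> 0) (nhds t)" using fk(4)
      proof eventually_elim
        case (elim s)
        thus ?case using chart_in_half(2)[OF fk(1), of "c s"] by simp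
      qed
      from ev eventually_in_plane[OF iaxis_simps(3)] show ?thesis
        by eventually_elim
          (use tangent_to_axis[OF fk(3) \<open>eventually (\<lambda>s. Re (k (iaxis s)) \<ge> 0) (nhds t)\<close> True] in auto)
    qed
  qed
  ultimately show ?thesis using dev by blast
qed

end

section \<open>Common perpendiculars\<close>

lemma lform_zero_on_axis:
  assumes "\<And>z. z \<in> hyp_plane \<Longrightarrow> Re z = 0 \<Longrightarrow> lform v z = 0"
  shows "\<exists>b. v = (0, b, 0)"
proof -
  obtain \<alpha> \<beta> \<gamma> where v: "v = (\<alpha>, \<beta>, \<gamma>)" by (cases v)
  have "lform v (iaxis 0) = 0" "lform v (iaxis (ln 2)) = 0" using assms by auto
  hence "\<alpha> + \<gamma> = 0" "\<alpha> * 4 + \<gamma> = 0" unfolding v by simp_all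
  hence "\<alpha> = 0" "\<gamma> = 0" by linarith+
  thus ?thesis using v by simp
qed

lemma circle_zero_iff:
  fixes \<alpha> \<gamma> x :: real
  assumes "4 * \<alpha> * \<gamma> = - 1" "x \<ge> 0"
  shows "\<alpha> * x\<^sup>2 + \<gamma> = 0 \<longleftrightarrow> x = exp (- ln (2 * \<bar>\<alpha>\<bar>))"
proof -
  have a: "\<alpha> \<noteq> 0" using assms by auto
  have g: "\<gamma> = - 1 / (4 * \<alpha>)" using assms(1) a by (simp add: field_simps)
  have e: "exp (- ln (2 * \<bar>\<alpha>\<bar>)) = 1 / (2 * \<bar>\<alpha>\<bar>)" using a by (simp add: exp_minus field_simps)
  have sq: "(1 / (2 * \<bar>\<alpha>\<bar>))\<^sup>2 = 1 / (4 * \<alpha>\<^sup>2)" by (simp add: power_divide power_mult_distrib)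
  have "\<alpha> * x\<^sup>2 + \<gamma> = 0 \<longleftrightarrow> x\<^sup>2 = (1 / (2 * \<bar>\<alpha>\<bar>))\<^sup>2"
    unfolding g sq using a by (simp add: field_simps power2_eq_square)
  also have "\<dots> \<longleftrightarrow> x = 1 / (2 * \<bar>\<alpha>\<bar>)" using assms(2) by (simp add: power2_eq_iff_nonneg)
  finally show ?thesis using e by simp
qed

text \<open>\<open>u\<close> is the form of the perpendicular, which \<open>h\<close> moves to the
  imaginary axis. Orthogonality to \<open>u\<close> removes the middle coefficients of the
  pulled-back \<open>v\<close> and \<open>w\<close>, so their lines become circles centred at 0,
  crossing the axis at heights \<open>exp a\<close> and \<open>exp b\<close>.\<close>

lemma common_perpendicular:
  assumes unit: "linner u u = 1" "linner v v = 1" "linner w w = 1"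
    and orth: "linner u v = 0" "linner u w = 0" and C: "linner v w = - C" "C > 1"
  shows "\<exists>h a b. hyp_motion h \<and> a \<noteq> b \<and> cosh (b - a) = C \<and>
    (\<forall>z \<in> hyp_plane. lform v (h z) = 0 \<longleftrightarrow> cmod z = exp a) \<and>
    (\<forall>z \<in> hyp_plane. lform w (h z) = 0 \<longleftrightarrow> cmod z = exp b)"
proof -
  obtain k where k: "hyp_motion k" "\<forall>z \<in> hyp_plane. \<exists>c > 0. lform u z = c * Re (k z)"
    using hyp_motion_of_lform[OF unit(1)] by blast
  obtain h where h: "hyp_motion h" "\<forall>z \<in> hyp_plane. h (k z) = z \<and> k (h z) = z"
    using motion_inverse[OF k(1)] by blast
  obtain T where T: "\<forall>v w. linner (T v) (T w) = linner v w"
    "\<forall>z \<in> hyp_plane. \<exists>c > 0. \<forall>v. lform (T v) z = c * lform v (h z)"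
    using lform_pullback[OF h(1)] by blast
  have T1: "linner (T v) (T w) = linner v w" for v w using T(1) by blast
  have "lform (T u) z = 0" if z: "z \<in> hyp_plane" "Re z = 0" for z
  proof -
    have hz: "h z \<in> hyp_plane" using motion_in_plane[OF h(1) z(1)] .
    obtain c where c: "\<forall>v. lform (T v) z = c * lform v (h z)" using bspec[OF T(2) z(1)] by blast
    obtain c' where "lform u (h z) = c' * Re (k (h z))" using bspec[OF k(2) hz] by blast
    hence "lform u (h z) = 0" using h(2) z by simp
    thus ?thesis using spec[OF c, of u] by (simp only: mult_zero_right)
  qed
  then obtain B where B: "T u = (0, B, 0)" using lform_zero_on_axis by blast
  have "B * B = 1" using T1[of u u] unfolding B unit(1) by simp
  hence B0: "B \<noteq> 0" by auto
  have form: "\<exists>\<alpha> \<gamma>. T x = (\<alpha>, 0, \<gamma>) \<and> 4 * \<alpha> * \<gamma> = - 1" if "linner u x = 0" "linner x x = 1" for x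
  proof -
    obtain \<alpha> \<beta> \<gamma> where e: "T x = (\<alpha>, \<beta>, \<gamma>)" by (cases "T x")
    have "linner (T u) (T x) = 0" "linner (T x) (T x) = 1" unfolding T1 using that by simp_all
    thus ?thesis using B B0 e by simp
  qed
  obtain \<alpha> \<gamma> where v: "T v = (\<alpha>, 0, \<gamma>)" "4 * \<alpha> * \<gamma> = - 1" using form[OF orth(1) unit(2)] by blast
  obtain \<alpha>' \<gamma>' where w: "T w = (\<alpha>', 0, \<gamma>')" "4 * \<alpha>' * \<gamma>' = - 1" using form[OF orth(2) unit(3)] by blast
  have a0: "\<alpha> \<noteq> 0" "\<alpha>' \<noteq> 0" using v(2) w(2) by auto
  have "linner (T v) (T w) = - C" unfolding T1 using C by simp
  hence "2 * \<alpha> * \<gamma>' + 2 * \<alpha>' * \<gamma> = C" using v w by simp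
  moreover have "\<gamma> = - 1 / (4 * \<alpha>)" "\<gamma>' = - 1 / (4 * \<alpha>')" using v(2) w(2) a0 by (simp_all add: field_simps)
  ultimately have C2: "- (\<alpha> / \<alpha>' + \<alpha>' / \<alpha>) / 2 = C" using a0 by (simp add: field_simps)
  \<comment> \<open>The sign in \<open>linner v w = - C\<close> means that the leading coefficients
    have opposite signs; this is what turns \<open>C2\<close> into the formula for
    \<open>cosh (b - a)\<close>.\<close>
  have neg: "\<alpha> / \<alpha>' < 0"
  proof (rule ccontr)
    assume "\<not> \<alpha> / \<alpha>' < 0"
    hence "\<alpha> / \<alpha>' \<ge> 0" "\<alpha>' / \<alpha> \<ge> 0" by (auto simp: zero_le_divide_iff not_less)
    thus False using C2 C(2) by simp
  qed
  define a where "a = - ln (2 * \<bar>\<alpha>\<bar>)"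
  define b where "b = - ln (2 * \<bar>\<alpha>'\<bar>)"
  have "exp (b - a) = \<bar>\<alpha>\<bar> / \<bar>\<alpha>'\<bar>" "exp (- (b - a)) = \<bar>\<alpha>'\<bar> / \<bar>\<alpha>\<bar>"
    using a0 by (simp_all add: a_def b_def exp_diff exp_minus field_simps)
  hence e: "exp (b - a) = - (\<alpha> / \<alpha>')" "exp (- (b - a)) = - (\<alpha>' / \<alpha>)"
    using neg a0 by (auto simp: divide_less_0_iff abs_if)
  hence ch: "cosh (b - a) = C" using C2 unfolding cosh_real_eq by simp
  have zero: "lform x (h z) = 0 \<longleftrightarrow> cmod z = exp (- ln (2 * \<bar>\<alpha>\<bar>))"
    if zx: "z \<in> hyp_plane" "T x = (\<alpha>, 0, \<gamma>)" "4 * \<alpha> * \<gamma> = - 1" for z x \<alpha> \<gamma>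
  proof -
    obtain c where c: "c > 0" "\<forall>v. lform (T v) z = c * lform v (h z)" using bspec[OF T(2) zx(1)] by blast
    have "lform x (h z) = 0 \<longleftrightarrow> lform (T x) z = 0" using spec[OF c(2), of x] c(1) by (simp only: mult_eq_0_iff) simp
    also have "\<dots> \<longleftrightarrow> \<alpha> * (cmod z)\<^sup>2 + \<gamma> = 0" using zx(2) by simp
    also have "\<dots> \<longleftrightarrow> cmod z = exp (- ln (2 * \<bar>\<alpha>\<bar>))" using zx(3) by (rule circle_zero_iff) simp
    finally show ?thesis .
  qed
  have "a \<noteq> b" using ch C(2) by auto
  thus ?thesis using h(1) ch zero[OF _ v] zero[OF _ w] unfolding a_def b_def by blast
qed

lemma same_sign_connected:
  fixes f :: "complex \<Rightarrow> real"
  assumes "connected X" "continuous_on X f" "\<And>x. x \<in> X \<Longrightarrow> f x \<noteq> 0" "x \<in> X" "y \<in> X"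
  shows "sgn (f x) = sgn (f y)"
proof (rule ccontr)
  assume ne: "sgn (f x) \<noteq> sgn (f y)"
  have c: "connected (f ` X)" using connected_continuous_image[OF assms(2,1)] .
  have "f x \<noteq> 0" "f y \<noteq> 0" using assms by auto
  hence "f x < 0 \<and> f y > 0 \<or> f y < 0 \<and> f x > 0" using ne by (auto simp: sgn_if split: if_splits)
  moreover have "{f x..f y} \<subseteq> f ` X" "{f y..f x} \<subseteq> f ` X"
    by (intro connected_contains_Icc[OF c] imageI assms(4,5))+
  ultimately have "0 \<in> f ` X" by auto
  thus False using assms(3) by auto
qed

lemma continuous_on_lform: "continuous_on X (lform v)"
proof -
  obtain \<alpha> \<beta> \<gamma> where v: "v = (\<alpha>, \<beta>, \<gamma>)" by (cases v)
  have "lform v = (\<lambda>z. \<alpha> * (cmod z)\<^sup>2 + \<beta> * Re z + \<gamma>)" by (rule ext) (simp add: v)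
  thus ?thesis by (simp only:) (intro continuous_intros)
qed

text \<open>Along a geodesic in axis form, a form is a positive multiple of
  \<open>\<alpha> * (exp s)\<^sup>2 + \<gamma>\<close>, which is monotone and so changes sign at any
  zero, unless it vanishes identically.\<close>

lemma lform_between:
  assumes "hyp_motion h" "a < t" "t < b" "sgn (lform v (h (iaxis a))) = sgn (lform v (h (iaxis b)))"
    "lform v (h (iaxis a)) \<noteq> 0"
  shows "lform v (h (iaxis t)) \<noteq> 0"
proof -
  obtain T where T: "\<forall>z \<in> hyp_plane. \<exists>c > 0. \<forall>v. lform (T v) z = c * lform v (h z)"
    using lform_pullback[OF assms(1)] by blast
  obtain \<alpha> \<beta> \<gamma> where e: "T v = (\<alpha>, \<beta>, \<gamma>)" by (cases "T v")
  have *: "\<exists>c > 0. \<alpha> * (exp s)\<^sup>2 + \<gamma> = c * lform v (h (iaxis s))" for s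
    using bspec[OF T, of "iaxis s"] e by (metis add.right_neutral iaxis_simps(1,3,4) lform.simps mult_zero_right)
  hence sg: "sgn (\<alpha> * (exp s)\<^sup>2 + \<gamma>) = sgn (lform v (h (iaxis s)))" for s
  proof -
    obtain c where "c > 0" "\<alpha> * (exp s)\<^sup>2 + \<gamma> = c * lform v (h (iaxis s))" using * by blast
    thus ?thesis by (simp add: sgn_mult)
  qed
  have m: "(exp a)\<^sup>2 < (exp t)\<^sup>2" "(exp t)\<^sup>2 < (exp b)\<^sup>2" using assms by (simp_all add: power_strict_mono)
  have "\<alpha> * (exp t)\<^sup>2 + \<gamma> \<noteq> 0"
  proof
    assume 0: "\<alpha> * (exp t)\<^sup>2 + \<gamma> = 0"
    have "\<alpha> * (exp a)\<^sup>2 + \<gamma> \<noteq> 0" using sg[of a] assms(5) by (metis sgn_zero_iff)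
    hence "\<alpha> \<noteq> 0" using 0 by auto
    have "\<alpha> * (exp a)\<^sup>2 + \<gamma> = \<alpha> * ((exp a)\<^sup>2 - (exp t)\<^sup>2)" "\<alpha> * (exp b)\<^sup>2 + \<gamma> = \<alpha> * ((exp b)\<^sup>2 - (exp t)\<^sup>2)"
      using 0 by (simp_all add: algebra_simps)
    hence "sgn (\<alpha> * ((exp a)\<^sup>2 - (exp t)\<^sup>2)) = sgn (\<alpha> * ((exp b)\<^sup>2 - (exp t)\<^sup>2))"
      using sg[of a] sg[of b] assms(4) by simp
    thus False using \<open>\<alpha> \<noteq> 0\<close> m by (simp add: sgn_mult sgn_eq_0_iff)
  qed
  thus ?thesis using sg[of t] by (metis sgn_zero_iff)
qed

lemma motion_id: "\<exists>k. hyp_motion k \<and> (\<forall>z. k z = z)"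
  by (intro exI[of _ "mob 1 0 0 1"] conjI hyp_motionI) (simp_all add: moebius_def)

text \<open>All that is kept of the development: \<open>F\<close> is the preimage of the boundary.
  \<open>F_axis\<close> says that only the axis itself can be a line of \<open>F\<close> meeting the
  axis, and \<open>F_scale\<close> is the periodicity of the closed geodesic.\<close>

locale line_pattern =
  fixes F :: "complex set" and l :: real
  assumes F_line: "\<And>z. z \<in> F \<Longrightarrow> \<exists>h. hyp_motion h \<and> Re (h z) = 0 \<and>
      (\<forall>w \<in> hyp_plane. Re (h w) = 0 \<longrightarrow> w \<in> F) \<and> eventually (\<lambda>w. w \<in> F \<longleftrightarrow> Re (h w) = 0) (nhds z)"
    and F_plane: "F \<subseteq> hyp_plane"
    and F_scale: "\<And>z. z \<in> hyp_plane \<Longrightarrow> of_real (exp l) * z \<in> F \<longleftrightarrow> z \<in> F"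
    and F_axis: "\<And>t. eventually (\<lambda>z. z \<in> F \<longrightarrow> Re z = 0) (nhds (iaxis t))"
    and F_closed: "\<And>z. z \<in> hyp_plane \<Longrightarrow> z \<notin> F \<Longrightarrow> eventually (\<lambda>w. w \<notin> F) (nhds z)"
    and F_off_axis: "\<exists>z \<in> F. Re z \<noteq> 0"
    and l_pos: "l > 0"
begin

lemma scale_in_plane: "r > 0 \<Longrightarrow> of_real r * z \<in> hyp_plane \<longleftrightarrow> z \<in> hyp_plane"
  by (simp add: hyp_plane_def zero_less_mult_iff)

lemma F_scale_power: "z \<in> hyp_plane \<Longrightarrow> of_real (exp (real n * l)) * z \<in> F \<longleftrightarrow> z \<in> F"
proof (induction n)
  case (Suc n)
  have "exp (real (Suc n) * l) = exp l * exp (real n * l)" by (simp add: distrib_right exp_add)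
  hence e: "of_real (exp (real (Suc n) * l)) * z = of_real (exp l) * (of_real (exp (real n * l)) * z)" by simp
  show ?case unfolding e
    using F_scale[of "of_real (exp (real n * l)) * z"] Suc scale_in_plane[of "exp (real n * l)" z] by simp
qed simp

lemma line_meeting_axis:
  assumes "hyp_motion h" "\<forall>w \<in> hyp_plane. Re (h w) = 0 \<longrightarrow> w \<in> F" "Re (h (iaxis t)) = 0" "y \<in> hyp_plane"
  shows "Re (h y) = 0 \<longleftrightarrow> Re y = 0"
proof -
  obtain k where k: "hyp_motion k" "\<forall>z. k z = z" using motion_id by blast
  have "eventually (\<lambda>y. Re (h y) = 0 \<longrightarrow> Re (k y) = 0) (nhds (iaxis t))"
    using F_axis[of t] eventually_in_plane[OF iaxis_simps(3)] by eventually_elim (use assms(2) k(2) in auto)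
  from hline_unique[OF assms(1) k(1) iaxis_simps(3) assms(3) this assms(4)] show ?thesis using k(2) by simp
qed

text \<open>Near a common point both lines lie in \<open>F\<close>, which is there a single
  line.\<close>

lemma lines_meeting:
  assumes "hyp_motion h" "\<forall>w \<in> hyp_plane. Re (h w) = 0 \<longrightarrow> w \<in> F"
    and "hyp_motion k" "\<forall>w \<in> hyp_plane. Re (k w) = 0 \<longrightarrow> w \<in> F"
    and z: "z \<in> hyp_plane" "Re (h z) = 0" "Re (k z) = 0" and y: "y \<in> hyp_plane"
  shows "Re (h y) = 0 \<longleftrightarrow> Re (k y) = 0"
proof -
  have "z \<in> F" using assms by blast
  then obtain m where m: "hyp_motion m" "eventually (\<lambda>w. w \<in> F \<longleftrightarrow> Re (m w) = 0) (nhds z)"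
    using F_line by blast
  have "eventually (\<lambda>y. Re (h y) = 0 \<longrightarrow> Re (m y) = 0) (nhds z)"
    using m(2) eventually_in_plane[OF z(1)] by eventually_elim (use assms(2) in auto)
  moreover have "eventually (\<lambda>y. Re (k y) = 0 \<longrightarrow> Re (m y) = 0) (nhds z)"
    using m(2) eventually_in_plane[OF z(1)] by eventually_elim (use assms(4) in auto)
  ultimately show ?thesis
    using hline_unique[OF assms(1) m(1) z(1,2) _ y] hline_unique[OF assms(3) m(1) z(1,3) _ y] by blast
qed

definition approach :: "complex \<Rightarrow> real \<Rightarrow> complex" where
  "approach z s = Complex (s * Re z) (Im z)"

lemma approach_simps [simp]: "Re (approach z s) = s * Re z" "Im (approach z s) = Im z"
  "approach z s \<in> hyp_plane \<longleftrightarrow> z \<in> hyp_plane" "approach z 1 = z"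
  by (simp_all add: approach_def hyp_plane_def)

lemma continuous_on_approach: "continuous_on X (approach z)"
  unfolding approach_def Complex_eq by (intro continuous_intros)

text \<open>On the horizontal segment from the axis to a point of \<open>F\<close>, the set
  \<open>F\<close> is closed and by \<open>F_axis\<close> stays away from the end on the axis, so
  there is a first hit. The line through it is separated from the axis by no line of
  \<open>F\<close>; only connectedness of the segment matters, so it need not be geodesic.\<close>

lemma first_line:
  "\<exists>z \<in> F. Re z \<noteq> 0 \<and> (\<forall>s. 0 < s \<and> s < 1 \<longrightarrow> approach z s \<notin> F)"
proof -
  obtain z1 where z1: "z1 \<in> F" "Re z1 \<noteq> 0" using F_off_axis by blast
  have H: "z1 \<in> hyp_plane" using z1 F_plane by blast
  have cont: "isCont (approach z1) s" for s
    using continuous_on_approach[of UNIV z1] by (simp add: continuous_on_eq_continuous_at)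
  have a0: "approach z1 0 = iaxis (ln (Im z1))" using hyp_planeD[OF H] by (simp add: complex_eq_iff)
  have "eventually (\<lambda>s. approach z1 s \<in> F \<longrightarrow> Re (approach z1 s) = 0) (nhds 0)"
    by (rule eventually_nhds_isCont[OF cont]) (use F_axis a0 in simp)
  then obtain d where d: "d > 0" "\<And>s. dist s 0 < d \<Longrightarrow> approach z1 s \<in> F \<Longrightarrow> Re (approach z1 s) = 0"
    unfolding eventually_nhds_metric by blast
  define S where "S = {s \<in> {min d 1..1}. approach z1 s \<in> F}"
  have "open {s. approach z1 s \<notin> F}"
  proof (subst open_subopen, rule ballI)
    fix s assume "s \<in> {s. approach z1 s \<notin> F}"
    hence "eventually (\<lambda>s. approach z1 s \<notin> F) (nhds s)"
      using H by (intro eventually_nhds_isCont[OF cont] F_closed) auto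
    thus "\<exists>T. open T \<and> s \<in> T \<and> T \<subseteq> {s. approach z1 s \<notin> F}" unfolding eventually_nhds by blast
  qed
  moreover have "S = {min d 1..1} - {s. approach z1 s \<notin> F}" by (auto simp: S_def)
  ultimately have "compact S" by (simp add: compact_diff)
  moreover have "1 \<in> S" using z1 by (simp add: S_def)
  ultimately obtain s0 where s0: "s0 \<in> S" "\<And>s. s \<in> S \<Longrightarrow> s0 \<le> s" using compact_attains_inf[of S] by blast
  have s0p: "s0 > 0" "s0 \<le> 1" using s0(1) d(1) by (auto simp: S_def)
  show ?thesis
  proof (intro bexI[of _ "approach z1 s0"] conjI allI impI)
    show "approach z1 s0 \<in> F" using s0 by (simp add: S_def)
    show "Re (approach z1 s0) \<noteq> 0" using s0p z1 by simp
    fix s :: real assume s: "0 < s \<and> s < 1"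
    have e: "approach (approach z1 s0) s = approach z1 (s * s0)" by (simp add: approach_def)
    have lt: "s * s0 < s0" "s * s0 > 0" using s s0p by auto
    show "approach (approach z1 s0) s \<notin> F"
    proof
      assume "approach (approach z1 s0) s \<in> F"
      hence f: "approach z1 (s * s0) \<in> F" using e by simp
      have "s * s0 \<ge> d" using d(2)[OF _ f] lt z1 by (force simp: dist_real_def)
      moreover have "s * s0 \<le> 1" using lt s0p by linarith
      ultimately have "s * s0 \<in> S" using f unfolding S_def by auto
      thus False using s0(2) lt by force
    qed
  qed
qed

lemma contraction_tendsto: "(\<lambda>n. x * exp (- (real n * l))) \<longlonglongrightarrow> 0"
proof -
  have "(\<lambda>n. exp (- l) ^ n) \<longlonglongrightarrow> 0" using l_pos by (intro LIMSEQ_power_zero) auto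
  moreover have "exp (- l) ^ n = exp (- (real n * l))" for n by (simp flip: exp_of_nat_mult)
  ultimately show ?thesis using tendsto_mult_right_zero by simp
qed

text \<open>Excludes lines asymptotic to the axis: their translates would provide points of
  \<open>F\<close> off the axis converging to \<open>iaxis 0\<close>.\<close>

lemma no_line_approaching_axis:
  assumes "x0 \<noteq> 0" "Y \<longlonglongrightarrow> 1" "\<And>n. n \<ge> N \<Longrightarrow> Complex (x0 * exp (- (real n * l))) (Y n) \<in> F"
  shows False
proof -
  have "(\<lambda>n. Complex (x0 * exp (- (real n * l))) (Y n)) \<longlonglongrightarrow> Complex 0 1"
    by (intro tendsto_Complex contraction_tendsto assms(2))
  moreover have "Complex 0 1 = iaxis 0" by (simp add: iaxis_def)
  ultimately have "filterlim (\<lambda>n. Complex (x0 * exp (- (real n * l))) (Y n)) (nhds (iaxis 0)) sequentially" by simp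
  from filterlim_iff[THEN iffD1, rule_format, OF this F_axis]
  have "eventually (\<lambda>n. Complex (x0 * exp (- (real n * l))) (Y n) \<in> F \<longrightarrow>
     Re (Complex (x0 * exp (- (real n * l))) (Y n)) = 0) sequentially" .
  moreover have "eventually (\<lambda>n. n \<ge> N) sequentially" by (rule eventually_ge_at_top)
  ultimately have "eventually (\<lambda>n. False) sequentially"
    by eventually_elim (use assms in auto)
  thus False by simp
qed

text \<open>A negative product makes the line cross the axis. For \<open>\<alpha> = 0\<close> the
  line is vertical and shares the endpoint at infinity, for \<open>\<gamma> = 0\<close> it is a
  circle through the endpoint 0; in both cases its translates accumulate at the axis.\<close>

lemma line_coefficients:
  assumes f: "linner (\<alpha>, \<beta>, \<gamma>) (\<alpha>, \<beta>, \<gamma>) = 1" "\<forall>w \<in> hyp_plane. lform (\<alpha>, \<beta>, \<gamma>) w = 0 \<longrightarrow> w \<in> F"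
    and ax: "\<And>t. lform (\<alpha>, \<beta>, \<gamma>) (iaxis t) \<noteq> 0"
  shows "\<alpha> * \<gamma> > 0"
proof -
  have nz: "\<alpha> * (exp t)\<^sup>2 + \<gamma> \<noteq> 0" for t using ax[of t] by simp
  have b2: "\<beta> * \<beta> = 1 + 4 * \<alpha> * \<gamma>" using f(1) by simp
  have "\<alpha> * \<gamma> \<ge> 0"
  proof (rule ccontr)
    assume n: "\<not> \<alpha> * \<gamma> \<ge> 0"
    hence "- \<gamma> / \<alpha> > 0" by (auto simp: mult_less_0_iff not_le divide_simps)
    hence "(exp (ln (- \<gamma> / \<alpha>) / 2))\<^sup>2 = - \<gamma> / \<alpha>" by (simp flip: exp_double)
    hence "\<alpha> * (exp (ln (- \<gamma> / \<alpha>) / 2))\<^sup>2 + \<gamma> = 0" using n by auto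
    thus False using nz by blast
  qed
  moreover have "\<alpha> \<noteq> 0"
  proof
    assume a: "\<alpha> = 0"
    hence g: "\<gamma> \<noteq> 0" "\<beta> \<noteq> 0" using nz b2 by auto
    have "Complex ((- \<gamma> / \<beta>) * exp (- (real n * l))) 1 \<in> F" for n
    proof -
      have "Complex (- \<gamma> / \<beta>) (exp (real n * l)) \<in> F"
        using f(2) a g by (auto simp: hyp_plane_def)
      moreover have "Complex (- \<gamma> / \<beta>) (exp (real n * l)) = of_real (exp (real n * l)) * Complex ((- \<gamma> / \<beta>) * exp (- (real n * l))) 1"
        by (simp add: complex_eq_iff exp_minus)
      ultimately show ?thesis using F_scale_power[of "Complex ((- \<gamma> / \<beta>) * exp (- (real n * l))) 1" n]
        by (simp add: hyp_plane_def)
    qed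
    thus False using no_line_approaching_axis[of "- \<gamma> / \<beta>" "\<lambda>_. 1" 0] g by simp
  qed
  moreover have "\<gamma> \<noteq> 0"
  proof
    assume g: "\<gamma> = 0"
    hence a: "\<alpha> \<noteq> 0" "\<beta> \<noteq> 0" using nz b2 by auto
    \<comment> \<open>The point of the line with modulus \<open>exp (- (n * l))\<close>, scaled up
      to modulus 1, has real part \<open>x n\<close>.\<close>
    define x where "x n = (- \<alpha> / \<beta>) * exp (- (real n * l))" for n
    have x: "x \<longlonglongrightarrow> 0" unfolding x_def by (rule contraction_tendsto)
    have Y: "(\<lambda>n. sqrt (1 - (x n)\<^sup>2)) \<longlonglongrightarrow> 1" using tendsto_intros(1) x by (auto intro!: tendsto_eq_intros)
    have "eventually (\<lambda>n. \<bar>x n\<bar> < 1) sequentially" using x by (auto dest: tendstoD[where e = 1])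
    then obtain N where N: "\<And>n. n \<ge> N \<Longrightarrow> \<bar>x n\<bar> < 1" unfolding eventually_sequentially by blast
    have "Complex (x n) (sqrt (1 - (x n)\<^sup>2)) \<in> F" if "n \<ge> N" for n
    proof -
      define E where "E = exp (- (real n * l))"
      have E: "E > 0" by (simp add: E_def)
      have x1: "(x n)\<^sup>2 < 1" using N[OF that] by (simp add: abs_square_less_1)
      define z where "z = of_real E * Complex (x n) (sqrt (1 - (x n)\<^sup>2))"
      have zH: "Complex (x n) (sqrt (1 - (x n)\<^sup>2)) \<in> hyp_plane" using x1 by (simp add: hyp_plane_def)
      have z2: "z \<in> hyp_plane" unfolding z_def using scale_in_plane[OF E] zH by simp
      have "cmod (Complex (x n) (sqrt (1 - (x n)\<^sup>2))) = 1" using x1 by (simp add: cmod_def)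
      hence "cmod z = E" using E by (simp add: z_def norm_mult)
      moreover have "Re z = E * ((- \<alpha> / \<beta>) * E)" by (simp add: z_def x_def E_def)
      ultimately have "lform (\<alpha>, \<beta>, \<gamma>) z = 0" using g a by (simp add: power2_eq_square)
      hence "z \<in> F" using f(2) z2 by blast
      moreover have "Complex (x n) (sqrt (1 - (x n)\<^sup>2)) = of_real (exp (real n * l)) * z"
      proof -
        have "complex_of_real (exp (real n * l)) * of_real E = 1"
          by (simp add: E_def exp_minus flip: of_real_mult)
        thus ?thesis unfolding z_def by (simp flip: mult.assoc)
      qed
      ultimately show ?thesis using F_scale_power[OF z2] by simp
    qed
    thus False using no_line_approaching_axis[of "- \<alpha> / \<beta>" "\<lambda>n. sqrt (1 - (x n)\<^sup>2)" N] Y a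
      unfolding x_def by simp
  qed
  ultimately show ?thesis by (simp add: less_le)
qed

text \<open>Circles centred at 0 are the geodesics perpendicular to the imaginary axis, so requiring
  whole circles to go into \<open>F\<close> encodes orthogonality at both ends without
  derivatives.\<close>

definition free_perpendicular :: "(complex \<Rightarrow> complex) \<Rightarrow> real \<Rightarrow> real \<Rightarrow> bool" where
  "free_perpendicular h a b \<longleftrightarrow> hyp_motion h \<and> a < b \<and>
    (\<forall>z \<in> hyp_plane. cmod z = exp a \<or> cmod z = exp b \<longrightarrow> h z \<in> F) \<and>
    (\<forall>t. a < t \<and> t < b \<longrightarrow> h (iaxis t) \<notin> F)"

text \<open>With \<open>r = exp (n * l)\<close> the translate of the line of
  \<open>(\<alpha>, \<beta>, \<gamma>)\<close> has the form
  \<open>(\<alpha> / r, \<beta>, \<gamma> * r)\<close>. Their product is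
  \<open>\<beta>\<^sup>2 - 2 * \<alpha> * \<gamma> * (r + 1 / r)\<close>, and
  \<open>\<beta>\<^sup>2 = 1 + K\<close> turns this into
  \<open>- (K * (cosh (n * l) - 1) - 1)\<close>.\<close>

lemma perpendicular_segment:
  "\<exists>K > 0. \<forall>n. K * (cosh (real n * l) - 1) - 1 > 1 \<longrightarrow>
    (\<exists>h a b. free_perpendicular h a b \<and> cosh (b - a) = K * (cosh (real n * l) - 1) - 1)"
proof -
  obtain z0 where z0: "z0 \<in> F" "Re z0 \<noteq> 0" "\<And>s. 0 < s \<Longrightarrow> s < 1 \<Longrightarrow> approach z0 s \<notin> F"
    using first_line by blast
  have z0H: "z0 \<in> hyp_plane" using z0 F_plane by blast
  obtain h0 where h0: "hyp_motion h0" "Re (h0 z0) = 0" "\<forall>w \<in> hyp_plane. Re (h0 w) = 0 \<longrightarrow> w \<in> F"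
    using F_line[OF z0(1)] by blast
  obtain v where v: "linner v v = 1" "\<forall>z \<in> hyp_plane. \<exists>c > 0. lform v z = c * Re (h0 z)"
    using lform_of_hyp_motion[OF h0(1)] by blast
  have v0: "lform v z = 0 \<longleftrightarrow> Re (h0 z) = 0" if "z \<in> hyp_plane" for z using bspec[OF v(2) that] by auto
  obtain \<alpha> \<beta> \<gamma> where ve: "v = (\<alpha>, \<beta>, \<gamma>)" by (cases v)
  have off: "lform v (iaxis t) \<noteq> 0" for t
  proof
    assume "lform v (iaxis t) = 0"
    hence "Re (h0 (iaxis t)) = 0" using v0 by simp
    from line_meeting_axis[OF h0(1,3) this z0H] h0(2) z0(2) show False by simp
  qed
  have ag: "\<alpha> * \<gamma> > 0"
    by (rule line_coefficients) (use v(1) v0 h0(3) off ve in auto)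
  have b2: "\<beta> * \<beta> = 1 + 4 * \<alpha> * \<gamma>" using v(1) ve by simp
  hence b0: "\<beta> \<noteq> 0" using ag by auto
  define K where "K = 4 * \<alpha> * \<gamma>"
  have K0: "K > 0" using ag by (simp add: K_def)
  define L where "L = {z \<in> hyp_plane. Re (h0 z) = 0}"
  have Lc: "connected L" unfolding L_def by (rule hline_connected[OF h0(1)])
  have LF: "L \<subseteq> F" using h0(3) by (auto simp: L_def)
  have L_off: "Re z \<noteq> 0" if "z \<in> L" for z
  proof
    assume "Re z = 0"
    hence "z = iaxis (ln (Im z))" using that iaxis_ln by (simp add: L_def)
    thus False using off v0 that unfolding L_def by (metis (mono_tags, lifting) mem_Collect_eq)
  qed
  show ?thesis
  proof (intro exI[of _ K] conjI K0 allI impI)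
    fix n :: nat
    define C where "C = K * (cosh (real n * l) - 1) - 1"
    assume "K * (cosh (real n * l) - 1) - 1 > 1"
    hence C1: "C > 1" by (simp add: C_def)
    define r where "r = exp (real n * l)"
    have La: "r > 0" by (simp add: r_def)
    have Cch: "C = 2 * \<alpha> * \<gamma> * (r + 1 / r) - K - 1"
      unfolding C_def K_def cosh_real_eq r_def by (simp add: exp_minus field_simps)
    define w where "w = (\<alpha> / r, \<beta>, \<gamma> * r)"
    have w1: "linner w w = 1" using b2 La by (simp add: w_def)
    have vw: "linner v w = - C" using b2 La by (simp add: ve w_def Cch K_def field_simps)
    have wl: "lform w (of_real r * z) = r * lform v z" for z
      using La by (simp add: ve w_def norm_mult power_mult_distrib field_simps power2_eq_square)
    \<comment> \<open>\<open>u\<close> is the normalised Lorentzian cross product of \<open>v\<close> and \<open>w\<close>.\<close>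
    define D where "D = \<alpha> * \<gamma> * (r - 1)\<^sup>2 - r"
    have D0: "D > 0"
    proof -
      have "r * (C - 1) = 2 * D" using La by (simp add: Cch K_def D_def field_simps power2_eq_square)
      moreover have "r * (C - 1) > 0" using La C1 by simp
      ultimately show ?thesis by simp
    qed
    \<comment> \<open>The squared norm of the cross product. It is positive because
      \<open>2 * D = r * (C - 1)\<close>, that is, because the two lines are disjoint with
      \<open>C > 1\<close>.\<close>
    define N where "N = sqrt (4 * \<alpha> * \<gamma> * D)"
    have N: "N > 0" "N * N = 4 * \<alpha> * \<gamma> * D" using ag D0 by (simp_all add: N_def mult.assoc)
    define u where "u = (\<alpha> * \<beta> / N, 2 * \<alpha> * \<gamma> * (r + 1) / N, r * \<gamma> * \<beta> / N)"
    have uv: "linner u v = 0" using N(1) by (simp add: u_def ve field_simps)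
    have uw: "linner u w = 0" using N(1) La by (simp add: u_def w_def field_simps)
    have uu: "linner u u = 1"
    proof -
      have "linner u u = ((2 * \<alpha> * \<gamma> * (r + 1))\<^sup>2 - 4 * \<alpha> * \<gamma> * r * (\<beta> * \<beta>)) / (N * N)"
        using N(1) by (simp add: u_def diff_divide_distrib power2_eq_square)
      also have "(2 * \<alpha> * \<gamma> * (r + 1))\<^sup>2 - 4 * \<alpha> * \<gamma> * r * (\<beta> * \<beta>) = N * N"
        unfolding b2 N(2) D_def by (simp add: algebra_simps power2_eq_square)
      finally show ?thesis using N(1) by simp
    qed
    obtain h a b where h: "hyp_motion h" "a \<noteq> b" "cosh (b - a) = C"
      "\<forall>z \<in> hyp_plane. lform v (h z) = 0 \<longleftrightarrow> cmod z = exp a"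
      "\<forall>z \<in> hyp_plane. lform w (h z) = 0 \<longleftrightarrow> cmod z = exp b"
      using common_perpendicular[OF uu v(1) w1 uv uw vw C1] by blast
    have hH: "h z \<in> hyp_plane" if "z \<in> hyp_plane" for z using motion_in_plane[OF h(1) that] .
    have vF: "z \<in> L" if "z \<in> hyp_plane" "lform v z = 0" for z using that v0 by (simp add: L_def)
    have wF: "\<exists>y \<in> L. z = of_real r * y" if z: "z \<in> hyp_plane" "lform w z = 0" for z
    proof (intro bexI)
      let ?y = "of_real (1 / r) * z"
      show e: "z = of_real r * ?y" using La by simp
      have "?y \<in> hyp_plane" using z(1) La scale_in_plane[of "1 / r" z] by simp
      moreover have "lform v ?y = 0" using wl[of ?y] z(2) La by (simp flip: e)
      ultimately show "?y \<in> L" by (rule vF)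
    qed
    have scF: "of_real r * y \<in> F" if "y \<in> L" for y
      using F_scale_power[of y n] that LF F_plane unfolding r_def by blast
    have ends: "h z \<in> F" if z: "z \<in> hyp_plane" "cmod z = exp a \<or> cmod z = exp b" for z
      using z(2)
    proof
      assume "cmod z = exp a"
      hence "lform v (h z) = 0" using h(4) z(1) by simp
      thus ?thesis using vF[OF hH[OF z(1)]] LF by blast
    next
      assume "cmod z = exp b"
      hence "lform w (h z) = 0" using h(5) z(1) by simp
      then obtain y where "y \<in> L" "h z = of_real r * y" using wF[OF hH[OF z(1)]] by blast
      thus ?thesis using scF by simp
    qed
    \<comment> \<open>
      A boundary line that crosses the perpendicular would separate \<open>L\<close> from its translate, but both are
      connected to the axis by segments that do not meet it.
    \<close>
    have inner: "h (iaxis t) \<notin> F" if t: "a < t \<and> t < b \<or> b < t \<and> t < a" for t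
    proof
      assume tF: "h (iaxis t) \<in> F"
      obtain k where k: "hyp_motion k" "Re (k (h (iaxis t))) = 0" "\<forall>w \<in> hyp_plane. Re (k w) = 0 \<longrightarrow> w \<in> F"
        using F_line[OF tF] by blast
      have A0: "h (iaxis a) \<in> L" using h(4) by (intro vF hH) auto
      obtain y0 where y0: "y0 \<in> L" "h (iaxis b) = of_real r * y0" using wF[OF hH[of "iaxis b"]] h(5) by auto
      have z0L: "z0 \<in> L" using z0H h0(2) by (simp add: L_def)
      have between: "lform f (h (iaxis t)) \<noteq> 0"
        if "sgn (lform f (h (iaxis a))) = sgn (lform f (h (iaxis b)))" "lform f (h (iaxis a)) \<noteq> 0" for f
      proof -
        have "lform f (h (iaxis b)) \<noteq> 0" using that by (metis sgn_zero_iff)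
        thus ?thesis using t that lform_between[OF h(1), of a t b f] lform_between[OF h(1), of b t a f] by auto
      qed
      show False
      proof (cases "\<exists>s. Re (k (iaxis s)) = 0")
        \<comment> \<open>The crossing line is then the axis itself, with form
          \<open>(0, 1, 0)\<close>. The line \<open>L\<close> stays on one side of the axis and
          scaling preserves sides, so both ends of the perpendicular lie on the same side.\<close>
        case True
        then obtain s where s: "Re (k (iaxis s)) = 0" by blast
        have "Re (h (iaxis t)) = 0" using line_meeting_axis[OF k(1,3) s hH] k(2) by simp
        moreover have "sgn (Re (h (iaxis a))) = sgn (Re y0)"
          by (rule same_sign_connected[OF Lc _ L_off A0 y0(1)]) (auto intro: continuous_intros)
        moreover have "sgn (Re y0) = sgn (Re (h (iaxis b)))" using y0(2) La by (simp add: sgn_mult)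
        ultimately show False using between[of "(0, 1, 0)"] L_off[OF A0] by simp
      next
        case False
        obtain f where f: "\<forall>z \<in> hyp_plane. \<exists>c > 0. lform f z = c * Re (k z)"
          using lform_of_hyp_motion[OF k(1)] by blast
        have f0: "lform f z = 0 \<longleftrightarrow> Re (k z) = 0" if "z \<in> hyp_plane" for z using bspec[OF f that] by auto
        have fF: "z \<in> F" if "z \<in> hyp_plane" "lform f z = 0" for z using that f0 k(3) by blast
        have tH: "h (iaxis t) \<in> hyp_plane" by (rule hH) simp
        \<comment> \<open>If the crossing line met \<open>L\<close> it would be \<open>L\<close>,
          and the crossing point would be the end at \<open>a\<close> instead of lying strictly
          between the ends.\<close>
        have LfL: "lform f y \<noteq> 0" if y: "y \<in> L" for y
        proof
          assume "lform f y = 0"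
          hence "Re (k y) = 0" "y \<in> hyp_plane" "Re (h0 y) = 0" using f0 y by (auto simp: L_def)
          from lines_meeting[OF h0(1,3) k(1,3) this(2,3,1) tH] k(2)
          have "lform v (h (iaxis t)) = 0" using v0[OF tH] by simp
          hence "cmod (iaxis t) = exp a" using h(4) by simp
          thus False using t by simp
        qed
        obtain g where g: "hyp_motion g" "\<forall>z. g z = of_real (1 / r) * z"
          using motion_scale[of "1 / r"] La by auto
        obtain hg where hg: "hyp_motion hg" "\<forall>z \<in> hyp_plane. hg z = h0 (g z)"
          using motion_compose[OF h0(1) g(1)] by blast
        have hg0: "Re (hg z) = 0 \<longleftrightarrow> lform w z = 0" if z: "z \<in> hyp_plane" for z
        proof -
          have "of_real r * g z = z" using g(2) La by simp
          hence "lform w z = r * lform v (g z)" using wl[of "g z"] by simp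
          thus ?thesis using v0[OF motion_in_plane[OF g(1) z]] hg(2) z La by simp
        qed
        have hgF: "\<forall>z \<in> hyp_plane. Re (hg z) = 0 \<longrightarrow> z \<in> F" using hg0 wF scF by blast
        have LfwL: "lform f (of_real r * y) \<noteq> 0" if y: "y \<in> L" for y
        proof
          let ?y = "of_real r * y"
          assume 0: "lform f ?y = 0"
          have yH: "?y \<in> hyp_plane" using y La scale_in_plane by (simp add: L_def)
          have "lform v y = 0" using y v0 by (simp add: L_def)
          hence "lform w ?y = 0" using wl by simp
          hence "Re (hg ?y) = 0" using hg0[OF yH] by simp
          moreover have "Re (k ?y) = 0" using 0 f0[OF yH] by simp
          ultimately have "lform w (h (iaxis t)) = 0"
            using lines_meeting[OF hg(1) hgF k(1,3) yH _ _ tH] k(2) hg0[OF tH] by simp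
          hence "cmod (iaxis t) = exp b" using h(5) by simp
          thus False using t by simp
        qed
        have P: "lform f (approach z0 s) \<noteq> 0 \<and> lform f (of_real r * approach z0 s) \<noteq> 0" if s: "s \<in> {0..1}" for s
        proof -
          have aH: "approach z0 s \<in> hyp_plane" using z0H by simp
          have aH2: "of_real r * approach z0 s \<in> hyp_plane" using aH La scale_in_plane by simp
          consider "s = 0" | "s = 1" | "0 < s" "s < 1" using s by force
          thus ?thesis
          proof cases
            case 1
            have "approach z0 s = iaxis (ln (Im z0))" using 1 hyp_planeD[OF z0H] by (simp add: complex_eq_iff)
            moreover from this have "of_real r * approach z0 s = iaxis (real n * l + ln (Im z0))"
              unfolding r_def by (simp add: iaxis_shift)
            ultimately show ?thesis using False f0 by simp
          next
            case 2 thus ?thesis using LfL[OF z0L] LfwL[OF z0L] by simp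
          next
            case 3
            hence nF: "approach z0 s \<notin> F" by (rule z0(3))
            hence "of_real r * approach z0 s \<notin> F" using F_scale_power[OF aH] unfolding r_def by simp
            thus ?thesis using nF fF aH aH2 by blast
          qed
        qed
        \<comment> \<open>The sign of \<open>f\<close> is transported along \<open>L\<close>, the
          segment, the axis, the translated segment and the translated line.\<close>
        have "sgn (lform f (h (iaxis a))) = sgn (lform f z0)"
          by (rule same_sign_connected[OF Lc continuous_on_lform LfL A0 z0L])
        also have "\<dots> = sgn (lform f (approach z0 0))"
        proof (rule same_sign_connected[of "approach z0 ` {0..1}"])
          show "connected (approach z0 ` {0..1})"
            by (intro connected_continuous_image continuous_on_approach) simp
          show "z0 \<in> approach z0 ` {0..1}" by (rule image_eqI[of _ _ 1]) simp_all
        qed (use P in \<open>auto intro: continuous_on_lform\<close>)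
        also have "\<dots> = sgn (lform f (of_real r * approach z0 0))"
        proof (rule same_sign_connected[of "range iaxis"])
          show "connected (range iaxis)"
            by (intro connected_continuous_image continuous_on_iaxis continuous_on_id) simp
          have e: "approach z0 0 = iaxis (ln (Im z0))" using hyp_planeD[OF z0H] by (simp add: complex_eq_iff)
          thus "approach z0 0 \<in> range iaxis" by simp
          show "of_real r * approach z0 0 \<in> range iaxis" unfolding e r_def iaxis_shift by simp
        qed (use False f0 in \<open>auto intro: continuous_on_lform\<close>)
        also have "\<dots> = sgn (lform f (of_real r * z0))"
        proof (rule same_sign_connected[of "(\<lambda>s. of_real r * approach z0 s) ` {0..1}"])
          show "connected ((\<lambda>s. of_real r * approach z0 s) ` {0..1})"
            by (intro connected_continuous_image continuous_on_mult continuous_on_const continuous_on_approach) simp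
          show "of_real r * z0 \<in> (\<lambda>s. of_real r * approach z0 s) ` {0..1}" by (rule image_eqI[of _ _ 1]) simp_all
        qed (use P in \<open>auto intro: continuous_on_lform\<close>)
        also have "\<dots> = sgn (lform f (h (iaxis b)))"
        proof (rule same_sign_connected[of "(\<lambda>y. of_real r * y) ` L"])
          show "connected ((\<lambda>y. of_real r * y) ` L)"
            by (intro connected_continuous_image Lc continuous_intros)
          show "of_real r * z0 \<in> (\<lambda>y. of_real r * y) ` L" using z0L by blast
          show "h (iaxis b) \<in> (\<lambda>y. of_real r * y) ` L" using y0 by blast
        qed (use LfwL in \<open>auto intro: continuous_on_lform\<close>)
        finally have "lform f (h (iaxis t)) \<noteq> 0" using between LfL[OF A0] by blast
        thus False using f0[OF tH] k(2) by simp
      qed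
    qed
    show "\<exists>h a b. free_perpendicular h a b \<and> cosh (b - a) = K * (cosh (real n * l) - 1) - 1"
    proof (cases "a < b")
      case True
      thus ?thesis using h(1,3) ends inner unfolding C_def free_perpendicular_def by blast
    next
      case False
      hence "b < a" using h(2) by simp
      moreover have "cosh (a - b) = C" using h(3) by (metis cosh_minus minus_diff_eq)
      ultimately show ?thesis using h(1) ends inner unfolding C_def free_perpendicular_def by blast
    qed
  qed
qed

end

section \<open>Orthogeodesics\<close>

lemma iaxis_has_vector_derivative: "(iaxis has_vector_derivative iaxis t) (at t)"
proof -
  have ax: "iaxis = (\<lambda>t. \<i> * of_real (exp t))" by (rule ext) (simp add: complex_eq_iff)
  show ?thesis unfolding ax by (auto intro!: derivative_eq_intros)
qed

lemma motion_has_field_derivative: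
  assumes "a * d - b * c = 1" "Im z > 0"
  shows "(mob a b c d has_field_derivative 1 / (c * z + d)\<^sup>2) (at z)"
proof -
  have n: "of_real c * z + d \<noteq> 0" using moebius_denom_nonzero[OF assms] .
  have "(mob a b c d has_field_derivative (a * (c * z + d) - (a * z + b) * c) / ((c * z + d) * (c * z + d))) (at z)"
    unfolding moebius_def using n by (auto intro!: derivative_eq_intros)
  also have "a * (c * z + d) - (a * z + b) * c = complex_of_real (a * d - b * c)"
    by (simp add: algebra_simps)
  finally show ?thesis using assms(1) by (simp add: power2_eq_square)
qed

text \<open>Vanishing of \<open>Re o k\<close> on an arc of the circle of radius
  \<open>r = exp t\<close> gives \<open>a * d + b * c = 0\<close> and
  \<open>a * c * r\<^sup>2 + b * d = 0\<close>. They make the square of the denominator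
  \<open>q\<close> at \<open>iaxis t\<close> purely imaginary, so the velocity
  \<open>iaxis t / q\<^sup>2\<close> is real.\<close>

lemma perpendicular_derivative:
  assumes "hyp_motion k" "eventually (\<lambda>z. cmod z = exp t \<longrightarrow> Re (k z) = 0) (nhds (iaxis t))"
  shows "\<exists>v. v \<noteq> 0 \<and> Im v = 0 \<and> ((\<lambda>s. k (iaxis s)) has_vector_derivative v) (at t)"
proof -
  obtain a b c d where k: "a * d - b * c = 1" "k = mob a b c d"
    using assms(1) by (rule hyp_motionE)
  define r where "r = exp t"
  have r: "r > 0" by (simp add: r_def)
  define p where "p x = Complex x (sqrt (r\<^sup>2 - x\<^sup>2))" for x
  have p0: "p 0 = iaxis t" using r by (simp add: p_def iaxis_def r_def)
  have "isCont p 0" unfolding p_def Complex_eq by (intro continuous_intros)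
  from eventually_nhds_isCont[OF this, of "\<lambda>z. cmod z = exp t \<longrightarrow> Re (k z) = 0"] assms(2)
  have "eventually (\<lambda>x. cmod (p x) = exp t \<longrightarrow> Re (k (p x)) = 0) (nhds 0)" by (simp add: p0)
  moreover have "eventually (\<lambda>x. x \<in> {-r<..<r}) (nhds 0)" using r by (intro eventually_nhds_in_open) auto
  ultimately have "eventually (\<lambda>x. 0 * x\<^sup>2 + (a * d + b * c) * x + (a * c * r\<^sup>2 + b * d) = 0) (nhds 0)"
  proof eventually_elim
    case (elim x)
    have "\<bar>x\<bar>\<^sup>2 < r\<^sup>2" using elim r by (intro power_strict_mono) auto
    hence x: "x\<^sup>2 < r\<^sup>2" by simp
    have cp: "cmod (p x) = r" using x r by (simp add: p_def cmod_def)
    have ip: "Im (p x) > 0" using x by (simp add: p_def)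
    have "Re (k (p x)) = 0" using elim cp by (simp add: r_def)
    hence "a * c * (cmod (p x))\<^sup>2 + (a * d + b * c) * Re (p x) + b * d = 0"
      using Re_mob[OF k(1) ip] moebius_denom_nonzero[OF k(1) ip] k(2) by simp
    thus ?case unfolding cp by (simp add: p_def)
  qed
  hence inf: "infinite {x. 0 * x\<^sup>2 + (a * d + b * c) * x + (a * c * r\<^sup>2 + b * d) = 0}"
    by (rule infinite_if_eventually_nhds)
  have "0 = (0::real) \<and> a * d + b * c = 0 \<and> a * c * r\<^sup>2 + b * d = 0"
    by (rule quadratic_zero_infinite[OF inf]) simp
  hence e: "a * d + b * c = 0" "a * c * r\<^sup>2 + b * d = 0" by auto
  have ad: "a * d = 1/2" "b * c = - 1/2" using e(1) k(1) by linarith+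
  \<comment> \<open>Multiplying the second relation by \<open>2 * c * d\<close> lets the values of
    \<open>a * d\<close> and \<open>b * c\<close> eliminate \<open>a\<close> and
    \<open>b\<close>.\<close>
  have dc: "d\<^sup>2 = c\<^sup>2 * r\<^sup>2"
  proof -
    have "2 * (c * d) * (a * c * r\<^sup>2 + b * d) = 2 * (a * d) * (c\<^sup>2 * r\<^sup>2) + 2 * (b * c) * d\<^sup>2"
      by (simp add: algebra_simps power2_eq_square)
    thus ?thesis using e(2) ad by simp
  qed
  define q where "q = complex_of_real c * iaxis t + d"
  have q0: "q \<noteq> 0" unfolding q_def by (rule moebius_denom_nonzero[OF k(1)]) simp
  have "Re (q\<^sup>2) = 0" using dc by (simp add: q_def power2_eq_square r_def algebra_simps)
  hence qi: "q\<^sup>2 = \<i> * of_real (Im (q\<^sup>2))" by (simp add: complex_eq_iff)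
  have "iaxis t = \<i> * of_real r" by (simp add: complex_eq_iff r_def)
  hence v: "iaxis t * (1 / q\<^sup>2) = of_real (r / Im (q\<^sup>2))" by (subst qi) simp
  have "((k \<circ> iaxis) has_vector_derivative (iaxis t * (1 / q\<^sup>2))) (at t)"
    by (rule field_vector_diff_chain_at[OF iaxis_has_vector_derivative])
      (use motion_has_field_derivative[OF k(1), of "iaxis t"] k(2) q_def in simp)
  hence "((\<lambda>s. k (iaxis s)) has_vector_derivative of_real (r / Im (q\<^sup>2))) (at t)"
    unfolding v by (simp add: o_def)
  moreover have "Im (q\<^sup>2) \<noteq> 0" using qi q0 by (metis mult_zero_right of_real_0 power_not_zero)
  ultimately show ?thesis using r by (intro exI[of _ "of_real (r / Im (q\<^sup>2))"]) simp
qed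

context surface_atlas
begin

text \<open>Away from its ends the segment avoids the preimage of the boundary, so it never crosses
  a fold: locally \<open>hfold\<close> acts on it as the identity or as the mirror, both
  isometric.\<close>

lemma orthogeodesic_of_segment:
  assumes dev: "\<And>w. w \<in> hyp_plane \<Longrightarrow> dev_at A E w" and ab: "a < b"
    and perp: "\<And>z. z \<in> hyp_plane \<Longrightarrow> cmod z = exp a \<or> cmod z = exp b \<Longrightarrow> E z \<in> hyp_boundary A"
    and inner: "\<And>t. a < t \<Longrightarrow> t < b \<Longrightarrow> E (iaxis t) \<notin> hyp_boundary A"
  shows "orthogeodesic A (\<lambda>s. E (iaxis (a + s))) (b - a)"
proof -
  define c where "c s = E (iaxis (a + s))" for s
  have local: "\<exists>U \<phi> k \<sigma> e. (U, \<phi>) \<in> A \<and> hyp_motion k \<and> (\<sigma> = id \<or> \<sigma> = mirror) \<and> e > 0 \<and>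
     (\<forall>s \<in> {0..b - a} \<inter> ball t e. c s \<in> U \<and> \<phi> (c s) = \<sigma> (k (iaxis (a + s)))) \<and>
     eventually (\<lambda>w. E w \<in> hyp_boundary A \<longleftrightarrow> Re (k w) = 0) (nhds (iaxis (a + t)))" for t
  proof -
    obtain U \<phi> k where U: "(U, \<phi>) \<in> A" "germ_rep U \<phi> k E (iaxis (a + t))"
      using dev[OF iaxis_simps(3)] unfolding dev_at_def by blast
    note ev = germ_boundary[OF U]
    have k: "hyp_motion k" using germ_repD(1)[OF U(2)] .
    have "isCont (\<lambda>s. iaxis (a + s)) t"
      using continuous_on_iaxis[of UNIV "\<lambda>s. a + s"] by (simp add: continuous_on_eq_continuous_at continuous_on_add)
    from eventually_nhds_isCont[OF this eventually_conj[OF germ_repD(2)[OF U(2)] ev]]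
    obtain e where e: "e > 0" "\<And>s. dist s t < e \<Longrightarrow> (c s \<in> U \<and> \<phi> (c s) = hfold (k (iaxis (a + s)))) \<and>
        (c s \<in> hyp_boundary A \<longleftrightarrow> Re (k (iaxis (a + s))) = 0)"
      unfolding eventually_nhds_metric c_def by blast
    \<comment> \<open>The ends are left out, as \<open>f\<close> vanishes there; both descriptions
      of \<open>hfold\<close> are valid at a zero of \<open>f\<close>.\<close>
    define J where "J = {0<..<b - a} \<inter> ball t e"
    define f where "f s = Re (k (iaxis (a + s)))" for s
    have fc: "continuous_on UNIV f" unfolding f_def
      by (intro continuous_on_Re continuous_on_compose2[OF continuous_on_motion[OF k]] continuous_intros) auto
    have J: "connected J" unfolding J_def by (intro convex_connected convex_Int) auto
    have nz: "f s \<noteq> 0" if "s \<in> J" for s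
    proof -
      have "c s \<notin> hyp_boundary A" unfolding c_def by (rule inner) (use that in \<open>auto simp: J_def\<close>)
      thus ?thesis using e(2)[of s] that unfolding J_def f_def by (auto simp: dist_commute)
    qed
    have "open {s. f s > 0}" "open {s. f s < 0}"
      using fc by (auto intro: open_Collect_less continuous_on_const)
    from connectedD[OF J this] nz have sg: "{s. f s > 0} \<inter> J = {} \<or> {s. f s < 0} \<inter> J = {}"
      by (force simp: neq_iff)
    have ends: "f s = 0" if "s \<in> {0, b - a}" "dist s t < e" for s
    proof -
      have "c s \<in> hyp_boundary A" unfolding c_def by (rule perp) (use that in auto)
      thus ?thesis using e(2)[OF that(2)] by (simp add: f_def)
    qed
    have cases: "s \<in> J \<or> f s = 0" if "s \<in> {0..b - a} \<inter> ball t e" for s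
      using that ends[of s] unfolding J_def by (auto simp: dist_commute less_le)
    have in_e: "c s \<in> U" "\<phi> (c s) = hfold (k (iaxis (a + s)))" if "s \<in> {0..b - a} \<inter> ball t e" for s
      using that e(2)[of s] by (auto simp: dist_commute)
    from sg show ?thesis
    proof
      assume neg: "{s. f s > 0} \<inter> J = {}"
      have "\<phi> (c s) = mirror (k (iaxis (a + s)))" if s: "s \<in> {0..b - a} \<inter> ball t e" for s
      proof -
        have "\<not> f s > 0" using cases[OF s] neg by auto
        thus ?thesis using in_e(2)[OF s] by (simp add: f_def hfold_neg)
      qed
      thus ?thesis using U(1) k e(1) in_e(1) ev
        by (intro exI[of _ U] exI[of _ \<phi>] exI[of _ k] exI[of _ mirror] exI[of _ e]) simp
    next
      assume pos: "{s. f s < 0} \<inter> J = {}"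
      have "\<phi> (c s) = id (k (iaxis (a + s)))" if s: "s \<in> {0..b - a} \<inter> ball t e" for s
      proof -
        have "\<not> f s < 0" using cases[OF s] pos by auto
        thus ?thesis using in_e(2)[OF s] by (simp add: f_def hfold_pos)
      qed
      thus ?thesis using U(1) k e(1) in_e(1) ev
        by (intro exI[of _ U] exI[of _ \<phi>] exI[of _ k] exI[of _ id] exI[of _ e]) simp
    qed
  qed
  have geo: "geodesic_on A {0..b - a} c"
    unfolding geodesic_on_def
  proof
    fix t assume "t \<in> {0..b - a}"
    obtain U \<phi> k \<sigma> e where L: "(U, \<phi>) \<in> A" "hyp_motion k" "\<sigma> = id \<or> \<sigma> = mirror" "e > 0"
      "\<forall>s \<in> {0..b - a} \<inter> ball t e. c s \<in> U \<and> \<phi> (c s) = \<sigma> (k (iaxis (a + s)))"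
      using local[of t] by blast
    have "hyp_dist (\<sigma> (k (iaxis (a + s)))) (\<sigma> (k (iaxis (a + s')))) = \<bar>s - s'\<bar>" for s s'
      using L(3) hyp_dist_motion_axis[OF L(2), of "a + s" "a + s'"] by (auto simp: hyp_dist_mirror)
    thus "\<exists>(U, \<phi>) \<in> A. \<exists>e > 0. (\<forall>s \<in> {0..b - a} \<inter> ball t e. c s \<in> U) \<and>
       (\<forall>s \<in> {0..b - a} \<inter> ball t e. \<forall>s' \<in> {0..b - a} \<inter> ball t e. hyp_dist (\<phi> (c s)) (\<phi> (c s')) = \<bar>s - s'\<bar>)"
      using L by (intro bexI[OF _ L(1)]) auto
  qed
  have perp_end: "perp_boundary_at A {0..b - a} c t" if t: "t = 0 \<or> t = b - a" for t
  proof -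
    obtain U \<phi> k \<sigma> e where L: "(U, \<phi>) \<in> A" "hyp_motion k" "\<sigma> = id \<or> \<sigma> = mirror" "e > 0"
      "\<forall>s \<in> {0..b - a} \<inter> ball t e. c s \<in> U \<and> \<phi> (c s) = \<sigma> (k (iaxis (a + s)))"
      "eventually (\<lambda>w. E w \<in> hyp_boundary A \<longleftrightarrow> Re (k w) = 0) (nhds (iaxis (a + t)))"
      using local[of t] by blast
    have tin: "t \<in> {0..b - a} \<inter> ball t e" using t ab L(4) by auto
    have ct: "c t \<in> U" "c t \<in> hyp_boundary A"
      using L(5) tin perp[of "iaxis (a + t)"] t unfolding c_def by auto
    hence "Re (\<phi> (c t)) = 0" using boundary_iff[OF L(1)] by blast
    moreover have "eventually (\<lambda>z. cmod z = exp (a + t) \<longrightarrow> Re (k z) = 0) (nhds (iaxis (a + t)))"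
      using L(6) eventually_in_plane[OF iaxis_simps(3)]
      by eventually_elim (use perp t in auto)
    from perpendicular_derivative[OF L(2) this]
    obtain v where v: "v \<noteq> 0" "Im v = 0" "((\<lambda>s. k (iaxis s)) has_vector_derivative v) (at (a + t))" by blast
    have "((\<lambda>s. a + s) has_vector_derivative 1) (at t)" by (auto intro!: derivative_eq_intros)
    from vector_diff_chain_at[OF this v(3)]
    have d: "((\<lambda>s. k (iaxis (a + s))) has_vector_derivative v) (at t)" by (simp add: o_def)
    have "\<exists>v. ((\<lambda>s. \<sigma> (k (iaxis (a + s)))) has_vector_derivative v) (at t) \<and> v \<noteq> 0 \<and> v \<bullet> \<i> = 0"
      using L(3)
    proof
      assume "\<sigma> = id" thus ?thesis using d v by (intro exI[of _ v]) (simp add: inner_complex_def)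
    next
      assume m: "\<sigma> = mirror"
      have "((\<lambda>s. - cnj (k (iaxis (a + s)))) has_vector_derivative - cnj v) (at t)"
        by (intro has_vector_derivative_minus has_vector_derivative_cnj d)
      thus ?thesis using v unfolding m mirror_def by (intro exI[of _ "- cnj v"]) (simp add: inner_complex_def)
    qed
    then obtain u where u: "((\<lambda>s. \<sigma> (k (iaxis (a + s)))) has_vector_derivative u) (at t)" "u \<noteq> 0" "u \<bullet> \<i> = 0" by blast
    have "((\<lambda>s. \<phi> (c s)) has_vector_derivative u) (at t within {0..b - a})"
    proof (rule has_vector_derivative_transform_within[OF has_vector_derivative_at_within[OF u(1)] L(4)])
      show "t \<in> {0..b - a}" using tin by blast
      show "\<sigma> (k (iaxis (a + s))) = \<phi> (c s)" if "s \<in> {0..b - a}" "dist s t < e" for s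
        using L(5) that by (auto simp: dist_commute)
    qed
    ultimately show ?thesis unfolding perp_boundary_at_def
      using u ct(1) by (intro bexI[OF _ L(1)]) auto
  qed
  show ?thesis using geo perp_end ab unfolding orthogeodesic_def c_def by simp
qed

lemma closed_geodesic_trace:
  assumes "compact M" "connected M" "hyp_boundary A \<noteq> {}" "ortho_integral A" "closed_geodesic A c l"
  shows "2 * cosh l \<in> \<int>"
proof -
  have l: "l > 0" using assms(5) by (simp add: closed_geodesic_def)
  obtain E where dev: "\<And>w. w \<in> hyp_plane \<Longrightarrow> dev_at A E w"
    and inv: "\<And>w. w \<in> hyp_plane \<Longrightarrow> E (of_real (exp l) * w) = E w"
    and ax: "\<And>t. eventually (\<lambda>z. E z \<in> hyp_boundary A \<longrightarrow> Re z = 0) (nhds (iaxis t))"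
    using closed_geodesic_development[OF assms(1,5)] by blast
  define F where "F = {z \<in> hyp_plane. E z \<in> hyp_boundary A}"
  interpret line_pattern F l
  proof
    fix z assume z: "z \<in> F"
    hence zH: "z \<in> hyp_plane" by (simp add: F_def)
    obtain h where h: "hyp_motion h" "Re (h z) = 0" "\<forall>w \<in> hyp_plane. Re (h w) = 0 \<longrightarrow> E w \<in> hyp_boundary A"
      "eventually (\<lambda>w. E w \<in> hyp_boundary A \<longleftrightarrow> Re (h w) = 0) (nhds z)"
      using boundary_line[OF dev, of z] z unfolding F_def by blast
    have "eventually (\<lambda>w. w \<in> F \<longleftrightarrow> Re (h w) = 0) (nhds z)"
      using h(4) eventually_in_plane[OF zH] by eventually_elim (simp add: F_def)
    thus "\<exists>h. hyp_motion h \<and> Re (h z) = 0 \<and> (\<forall>w \<in> hyp_plane. Re (h w) = 0 \<longrightarrow> w \<in> F) \<and>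
        eventually (\<lambda>w. w \<in> F \<longleftrightarrow> Re (h w) = 0) (nhds z)"
      using h unfolding F_def by blast
  next
    fix z assume z: "z \<in> hyp_plane"
    have "of_real (exp l) * z \<in> hyp_plane" using z by (simp add: hyp_plane_def)
    thus "of_real (exp l) * z \<in> F \<longleftrightarrow> z \<in> F" using inv[OF z] z by (simp add: F_def)
  next
    fix t show "eventually (\<lambda>z. z \<in> F \<longrightarrow> Re z = 0) (nhds (iaxis t))"
      using ax[of t] by eventually_elim (simp add: F_def)
  next
    fix z assume z: "z \<in> hyp_plane" "z \<notin> F"
    obtain U \<phi> h where U: "(U, \<phi>) \<in> A" "germ_rep U \<phi> h E z" using dev[OF z(1)] unfolding dev_at_def by blast
    note ev = germ_boundary[OF U]
    have "Re (h z) \<noteq> 0" using eventually_nhds_x_imp_x[OF ev] z by (simp add: F_def)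
    from ev motion_Re_sign_locally[OF germ_repD(1)[OF U(2)] z(1) this]
    show "eventually (\<lambda>w. w \<notin> F) (nhds z)" by eventually_elim (auto simp: F_def)
  next
    \<comment> \<open>Some boundary point is attained off the axis, even when the closed geodesic
      runs in the boundary and the axis itself belongs to \<open>F\<close>.\<close>
    obtain p U \<phi> where p: "(U, \<phi>) \<in> A" "p \<in> U" "p \<in> hyp_boundary A" using assms(3) unfolding hyp_boundary_def by blast
    obtain z where "z \<in> hyp_plane" "E z = p" "Re z \<noteq> 0"
      using fibre_not_in_axis[OF assms(1,2) dev chart_in_half(3)[OF p(1,2)]] by blast
    thus "\<exists>z \<in> F. Re z \<noteq> 0" using p(3) unfolding F_def by blast
  qed (use l F_def in auto)
  obtain K where K: "K > 0" and seg: "\<And>n. K * (cosh (real n * l) - 1) - 1 > 1 \<Longrightarrow>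
    \<exists>h a b. free_perpendicular h a b \<and> cosh (b - a) = K * (cosh (real n * l) - 1) - 1"
    using perpendicular_segment by blast
  have int: "K * (cosh (real n * l) - 1) - 1 \<in> \<int>" if n: "K * (cosh (real n * l) - 1) - 1 > 1" for n
  proof -
    obtain h a b where h: "hyp_motion h" "a < b" "cosh (b - a) = K * (cosh (real n * l) - 1) - 1"
      "\<forall>z \<in> hyp_plane. cmod z = exp a \<or> cmod z = exp b \<longrightarrow> h z \<in> F"
      "\<forall>t. a < t \<and> t < b \<longrightarrow> h (iaxis t) \<notin> F" using seg[OF n] unfolding free_perpendicular_def by blast
    have "orthogeodesic A (\<lambda>s. E (h (iaxis (a + s)))) (b - a)"
    proof (rule orthogeodesic_of_segment)
      show "dev_at A (\<lambda>w. E (h w)) w" if "w \<in> hyp_plane" for w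
        by (rule dev_at_compose_motion[OF dev[OF motion_in_plane[OF h(1) that]] h(1) that])
      show "E (h z) \<in> hyp_boundary A" if "z \<in> hyp_plane" "cmod z = exp a \<or> cmod z = exp b" for z
        using h(4) that unfolding F_def by blast
      show "E (h (iaxis t)) \<notin> hyp_boundary A" if "a < t" "t < b" for t
        using h(5) that motion_in_plane[OF h(1), of "iaxis t"] unfolding F_def by auto
    qed (rule h(2))
    hence "cosh (b - a) \<in> \<int>" using assms(4) unfolding ortho_integral_def by blast
    thus ?thesis using h(3) by simp
  qed
  have "\<exists>N. \<forall>n \<ge> N. K * (cosh (real n * l) - 1) - 1 > 1"
  proof -
    \<comment> \<open>The desired inequality is \<open>cosh (n * l) - 1 > 2 / K\<close>, which
      follows from \<open>cosh x \<ge> exp x / 2 \<ge> (1 + x) / 2\<close>.\<close>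
    define B where "B = 2 / K"
    obtain N where N: "2 * (B + 1) < real N * l" using reals_Archimedean3[OF l] by blast
    have "K * (cosh (real n * l) - 1) - 1 > 1" if "n \<ge> N" for n
    proof -
      have "real n * l \<ge> real N * l" using that l by simp
      hence "real n * l > 2 * (B + 1)" using N by linarith
      moreover have "exp (real n * l) \<ge> 1 + real n * l" by (rule exp_ge_add_one_self)
      moreover have "cosh (real n * l) \<ge> exp (real n * l) / 2" by (simp add: cosh_real_eq)
      ultimately have "cosh (real n * l) - 1 > B" by argo
      thus ?thesis using K by (simp add: B_def divide_less_eq mult.commute)
    qed
    thus ?thesis by blast
  qed
  then obtain N where "\<And>n. n \<ge> N \<Longrightarrow> K * (cosh (real n * l) - 1) - 1 > 1" by blast
  thus ?thesis using two_cosh_Ints[OF K l, of N] int by blast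
qed

end

theorem theorem1p3:
  fixes M :: "'a::t2_space set" and A :: "'a chart set"
    and \<mu> :: "real \<Rightarrow> 'a" and l :: real
  assumes "hyperbolic_surface M A"
    and "ortho_integral A"
    and "closed_geodesic A \<mu> l"
  shows "(abs_tr_SL l)\<^sup>2 \<in> \<int>"
proof -
  interpret surface_atlas M A
    using assms(1) by unfold_locales (simp add: hyperbolic_surface_def)
  have "2 * cosh l \<in> \<int>"
    using closed_geodesic_trace assms by (simp add: hyperbolic_surface_def)
  moreover have "(abs_tr_SL l)\<^sup>2 = 2 * cosh l + 2"
    using cosh_double_cosh[of "l / 2"] by (simp add: abs_tr_SL_def power_mult_distrib)
  ultimately show ?thesis by simp
qed

end
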